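(* Let $\rho$ be a strictly positive probability density on $\mathbb{R}$ with $\log\rho\in\mathcal{S}^4$ and $\lim_{|x|\to\infty}\frac{x}{|x|}(\log\rho)'(x)=-\infty$, and let $l>0$ be a fixed constant. Let $a=\{a_d\}_{d\in\mathbb{N}}$ be a sluggish sequence. There exist constants $c_3,C_3>0$ (dependent on $a$) and measurable sets $\mathcal{A}_d\subset\mathbb{R}^d$, such that for all $d\in\mathbb{N}$ we have $\rho_d(\mathbb{R}^d\setminus\mathcal{A}_d)\le c_3e^{-a_d^2}$ and $$\left|\mathcal{G}f(x^d_1)-\mathcal{G}_df(\mathbf{x}^d)\right|\le C_3\left(\sum_{i=1}^3\|f^{(i)}\|_{\infty,1/2}\right)e^{|x^d_1|}\frac{a_d}{\sqrt d}\qquad\text{for any } f\in\mathcal{S}^3\text{ and }\mathbf{x}^d\in\mathcal{A}_d.$$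
   Context: $\mathbb{N}=\{1,2,\dots\}$. For $s>0$, $\|g\|_{\infty,s}:=\sup_{x\in\mathbb{R}}(e^{-s|x|}|g(x)|)$; for $n\in\mathbb{N}\cup\{0\}$, $\mathcal{S}^n:=\{g\in\mathcal{C}^n(\mathbb{R}):\sum_{i=0}^n\|g^{(i)}\|_{\infty,s}<\infty\ \forall s>0\}$. $\rho(g):=\int_{\mathbb{R}}g\rho\,dx$. $\rho_d(\mathbf{x}^d):=\prod_{i=1}^d\rho(x^d_i)$ for $\mathbf{x}^d=(x^d_1,\dots,x^d_d)\in\mathbb{R}^d$; $\rho_d(B)$ is the probability of a measurable set $B\subset\mathbb{R}^d$ under this density. A positive sequence $a=\{a_d\}_{d\in\mathbb{N}}$ is sluggish if $\lim_{d\to\infty}a_d=\infty$ and $\sup_{d\in\mathbb{N}\setminus\{1\}}a_d/\sqrt{\log d}<\infty$. A function $f$ on $\mathbb{R}$ is identified with $\mathbf{x}^d\mapsto f(x^d_1)$ on $\mathbb{R}^d$. $\mathcal{G}_df(\mathbf{x}^d):=d\,\mathbb{E}\left[(f(\mathbf{Y}^d)-f(\mathbf{x}^d))\left(1\wedge\frac{\rho_d(\mathbf{Y}^d)}{\rho_d(\mathbf{x}^d)}\right)\right]$ with $\mathbf{Y}^d\sim N(\mathbf{x}^d,(l^2/d)I_d)$. $\mathcal{G}f:=\frac{h(l)}2\left(f''+(\log\rho)'f'\right)$, where $h(l):=2l^2\Phi(-l\sqrt J/2)$, $J:=\rho(((\log\rho)')^2)$ and $\Phi$ is the standard normal distribution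 function. The constants and the sets may depend on $\rho,l,a$; they do not depend on $f$, and the constants do not depend on $d$. *)

theory Defs
  imports "HOL-Probability.Probability"
begin

definition wnorm :: "real \<Rightarrow> (real \<Rightarrow> real) \<Rightarrow> ennreal" where
  "wnorm s g = (SUP x. ennreal (exp (- s * \<bar>x\<bar>) * \<bar>g x\<bar>))"

definition C_class :: "nat \<Rightarrow> (real \<Rightarrow> real) set" where
  "C_class n = {g. (\<forall>i<n. \<forall>x. (deriv ^^ i) g differentiable (at x)) \<and>
                   continuous_on UNIV ((deriv ^^ n) g)}"

definition S_class :: "nat \<Rightarrow> (real \<Rightarrow> real) set" where
  "S_class n = {g \<in> C_class n. \<forall>s>0. (\<Sum>i\<le>n. wnorm s ((deriv ^^ i) g)) < \<infinity>}"

definition positive_prob_density :: "(real \<Rightarrow> real) \<Rightarrow> bool" where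
  "positive_prob_density \<rho> \<longleftrightarrow>
     (\<forall>x. 0 < \<rho> x) \<and> integrable lborel \<rho> \<and> (\<integral>x. \<rho> x \<partial>lborel) = 1"

text \<open>Only the values at indices \<open>d \<ge> 1\<close> of a sequence are relevant.\<close>

definition sluggish :: "(nat \<Rightarrow> real) \<Rightarrow> bool" where
  "sluggish a \<longleftrightarrow> (\<forall>d\<ge>1. 0 < a d) \<and> filterlim a at_top sequentially \<and>
     bdd_above ((\<lambda>d. a d / sqrt (ln (real d))) ` {2..})"

text \<open>Since the dimension \<open>d\<close> varies within a statement, \<open>\<real>\<^sup>d\<close> is represented by the
  extensional functions on the index set \<open>{1..d}\<close>, with Lebesgue measure on the product Borel sets.\<close>

abbreviation lborel_d :: "nat \<Rightarrow> (nat \<Rightarrow> real) measure" where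
  "lborel_d d \<equiv> Pi\<^sub>M {1..d} (\<lambda>_. lborel)"

definition rho_d :: "(real \<Rightarrow> real) \<Rightarrow> nat \<Rightarrow> (nat \<Rightarrow> real) \<Rightarrow> real" where
  "rho_d \<rho> d x = (\<Prod>i=1..d. \<rho> (x i))"

definition rho_d_measure :: "(real \<Rightarrow> real) \<Rightarrow> nat \<Rightarrow> (nat \<Rightarrow> real) measure" where
  "rho_d_measure \<rho> d = density (lborel_d d) (\<lambda>x. ennreal (rho_d \<rho> d x))"

text \<open>The law \<open>N(x, \<sigma>\<^sup>2 I\<^sub>d)\<close>, as the product of its one-dimensional marginals. As for
  \<open>normal_density\<close>, the parameter \<open>\<sigma>\<close> is the standard deviation.\<close>

definition normal_d :: "nat \<Rightarrow> (nat \<Rightarrow> real) \<Rightarrow> real \<Rightarrow> (nat \<Rightarrow> real) measure" where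
  "normal_d d x \<sigma> = Pi\<^sub>M {1..d} (\<lambda>i. density lborel (\<lambda>y. ennreal (normal_density (x i) \<sigma> y)))"

definition gen_d ::
  "(real \<Rightarrow> real) \<Rightarrow> real \<Rightarrow> nat \<Rightarrow> ((nat \<Rightarrow> real) \<Rightarrow> real) \<Rightarrow> (nat \<Rightarrow> real) \<Rightarrow> real" where
  "gen_d \<rho> l d F x =
     real d * (\<integral>y. (F y - F x) * min 1 (rho_d \<rho> d y / rho_d \<rho> d x)
                  \<partial>normal_d d x (l / sqrt (real d)))"

definition J_const :: "(real \<Rightarrow> real) \<Rightarrow> real" where
  "J_const \<rho> = (\<integral>x. (deriv (\<lambda>u. ln (\<rho> u)) x)\<^sup>2 * \<rho> x \<partial>lborel)"

definition h_const :: "(real \<Rightarrow> real) \<Rightarrow> real \<Rightarrow> real" where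
  "h_const \<rho> l = 2 * l\<^sup>2 * cdf std_normal_distribution (- l * sqrt (J_const \<rho>) / 2)"

definition gen_limit :: "(real \<Rightarrow> real) \<Rightarrow> real \<Rightarrow> (real \<Rightarrow> real) \<Rightarrow> real \<Rightarrow> real" where
  "gen_limit \<rho> l f x =
     h_const \<rho> l / 2 * ((deriv ^^ 2) f x + deriv (\<lambda>u. ln (\<rho> u)) x * deriv f x)"

end

theory Submission
  imports Defs
begin

text \<open>
  Given the first coordinate, the acceptance probability is the mean of \<open>min 1 (exp (u + W))\<close>, where
  \<open>u\<close> and \<open>W\<close> are the increments of the log-density in the first and in the remaining coordinates.
  With \<open>v i = (ln \<rho>)' (x i)\<close> and a standard Gaussian vector \<open>Z\<close>, the variable \<open>W\<close> is within
  \<open>O(a d / sqrt d)\<close> in \<open>L\<^sup>2\<close> of \<open>N = \<sigma> (v \<bullet> Z) - \<sigma>\<^sup>2 |v|\<^sup>2 / 2\<close> as soon as three empirical means of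
  \<open>x 2, \<dots>, x d\<close> are close to their expectations. This gives the mean acceptance; its slope in \<open>u\<close>
  is obtained by a Cameron-Martin shift of \<open>Z\<close> along \<open>v\<close>, which replaces differentiating the
  non-smooth acceptance function. A Taylor expansion in the first coordinate then produces the
  limiting generator. The atypical points are controlled by a truncated Chernoff bound.
\<close>

text \<open>The generator multiplies by \<open>d\<close>, while the linear Taylor term of
  \<open>f\<close> is only of size \<open>\<sigma> = l / sqrt d\<close>. A general error of order
  \<open>a d / sqrt d\<close> in the acceptance would be amplified to order \<open>a d\<close>.
  Affordable are an error that does not depend on \<open>u\<close>, which the symmetry of the step
  cancels in the linear term, and one of order |u| * (a d / sqrt d + |u|). Closeness of
  \<open>W\<close> and \<open>N\<close> gives only the former, so the slope needs an estimate of its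
  own. The three empirical means have separate tasks. That of the squared derivative of
  \<open>ln \<rho>\<close> fixes the variance of \<open>N\<close>. That of the second derivative
  plus this square has expectation zero, by integration by parts, and keeps the mean of
  \<open>W - N\<close> small. That of exp (|x| / 2) dominates the Taylor remainders. For
  \<open>N\<close> the mean acceptance is twice the slope; hence the second-order term of
  \<open>f\<close> and the drift term carry the same factor. The averaged functions may lack
  exponential moments, so the Chernoff bound needs a truncation.\<close>

abbreviation "\<gamma> \<equiv> std_normal_distribution"

section \<open>Product measures, Gaussian translations and linear forms\<close>

lemma distr_PiM_coordinates:
  assumes fin: "finite I" and M: "\<And>i. prob_space (M i)" and M': "\<And>i. sigma_finite_measure (distr (M i) (M' i) (f i))"
    and f[measurable]: "\<And>i. f i \<in> measurable (M i) (M' i)"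
  shows "distr (Pi\<^sub>M I M) (Pi\<^sub>M I M') (\<lambda>z. \<lambda>i\<in>I. f i (z i)) = Pi\<^sub>M I (\<lambda>i. distr (M i) (M' i) (f i))"
proof -
  interpret N: product_sigma_finite "\<lambda>i. distr (M i) (M' i) (f i)"
    using M' by (simp add: product_sigma_finite_def)
  interpret M: product_sigma_finite M
    using M by (simp add: product_sigma_finite_def prob_space_imp_sigma_finite)
  show ?thesis
  proof (rule N.PiM_eqI[OF fin])
    show "sets (distr (Pi\<^sub>M I M) (Pi\<^sub>M I M') (\<lambda>z. \<lambda>i\<in>I. f i (z i))) = sets (Pi\<^sub>M I (\<lambda>i. distr (M i) (M' i) (f i)))"
      by (simp cong: sets_PiM_cong)
    fix A assume A: "\<And>i. i \<in> I \<Longrightarrow> A i \<in> sets (distr (M i) (M' i) (f i))"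
    have "emeasure (distr (Pi\<^sub>M I M) (Pi\<^sub>M I M') (\<lambda>z. \<lambda>i\<in>I. f i (z i))) (Pi\<^sub>E I A)
      = emeasure (Pi\<^sub>M I M) ((\<lambda>z. \<lambda>i\<in>I. f i (z i)) -` Pi\<^sub>E I A \<inter> space (Pi\<^sub>M I M))"
      using A fin by (intro emeasure_distr sets_PiM_I_finite measurable_restrict) auto
    also have "(\<lambda>z. \<lambda>i\<in>I. f i (z i)) -` Pi\<^sub>E I A \<inter> space (Pi\<^sub>M I M) = Pi\<^sub>E I (\<lambda>i. f i -` A i \<inter> space (M i))"
      by (auto simp: space_PiM PiE_iff)
    also have "emeasure (Pi\<^sub>M I M) \<dots> = (\<Prod>i\<in>I. emeasure (M i) (f i -` A i \<inter> space (M i)))"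
      using A fin by (intro M.emeasure_PiM) auto
    also have "\<dots> = (\<Prod>i\<in>I. emeasure (distr (M i) (M' i) (f i)) (A i))"
      using A by (intro prod.cong refl) (simp add: emeasure_distr)
    finally show "emeasure (distr (Pi\<^sub>M I M) (Pi\<^sub>M I M') (\<lambda>z. \<lambda>i\<in>I. f i (z i))) (Pi\<^sub>E I A) = \<dots>" .
  qed
qed

text \<open>The indicator of a box is a product of indicators, so on boxes the claim is Fubini for
  product integrands, and boxes determine the measure. It serves both for the density of a
  translated Gaussian vector and for the target density in \<open>d\<close> dimensions.\<close>

lemma density_PiM:
  assumes fin: "finite I" and M: "\<And>i. sigma_finite_measure (M i)" and D: "\<And>i. sigma_finite_measure (density (M i) (g i))"
    and g[measurable]: "\<And>i. g i \<in> borel_measurable (M i)"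
  shows "density (Pi\<^sub>M I M) (\<lambda>z. \<Prod>i\<in>I. g i (z i)) = Pi\<^sub>M I (\<lambda>i. density (M i) (g i))"
proof -
  interpret N: product_sigma_finite "\<lambda>i. density (M i) (g i)"
    using D by (simp add: product_sigma_finite_def)
  interpret M: product_sigma_finite M
    using M by (simp add: product_sigma_finite_def)
  show ?thesis
  proof (rule N.PiM_eqI[OF fin])
    show "sets (density (Pi\<^sub>M I M) (\<lambda>z. \<Prod>i\<in>I. g i (z i))) = sets (Pi\<^sub>M I (\<lambda>i. density (M i) (g i)))"
      by (simp cong: sets_PiM_cong)
    fix A assume "\<And>i. i \<in> I \<Longrightarrow> A i \<in> sets (density (M i) (g i))"
    then have A[measurable]: "\<And>i. i \<in> I \<Longrightarrow> A i \<in> sets (M i)" by simp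
    have "emeasure (density (Pi\<^sub>M I M) (\<lambda>z. \<Prod>i\<in>I. g i (z i))) (Pi\<^sub>E I A)
      = (\<integral>\<^sup>+z. (\<Prod>i\<in>I. g i (z i)) * indicator (Pi\<^sub>E I A) z \<partial>Pi\<^sub>M I M)"
      using A fin by (intro emeasure_density sets_PiM_I_finite) auto
    also have "\<dots> = (\<integral>\<^sup>+z. (\<Prod>i\<in>I. g i (z i) * indicator (A i) (z i)) \<partial>Pi\<^sub>M I M)"
      using fin by (intro nn_integral_cong)
        (auto simp: prod.distrib space_PiM PiE_iff indicator_def prod_zero_iff)
    also have "\<dots> = (\<Prod>i\<in>I. \<integral>\<^sup>+z. g i z * indicator (A i) z \<partial>M i)"
      using fin A by (intro M.product_nn_integral_prod) auto
    also have "\<dots> = (\<Prod>i\<in>I. emeasure (density (M i) (g i)) (A i))"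
      using A by (intro prod.cong refl) (simp add: emeasure_density)
    finally show "emeasure (density (Pi\<^sub>M I M) (\<lambda>z. \<Prod>i\<in>I. g i (z i))) (Pi\<^sub>E I A) = \<dots>" .
  qed
qed

lemma prob_space_std_normal: "prob_space \<gamma>"
  by (rule prob_space_normal_density) simp

lemma distr_std_normal_affine:
  assumes "0 < \<sigma>"
  shows "distr \<gamma> borel (\<lambda>z. m + \<sigma> * z) = density lborel (normal_density m \<sigma>)"
proof -
  interpret prob_space \<gamma> by (rule prob_space_std_normal)
  have "distributed \<gamma> lborel (\<lambda>z. z) std_normal_density"
    by (auto simp: distributed_def distr_id2[unfolded id_def] intro!: measure_eqI)
  from normal_density_affine[OF this, of \<sigma> m] assms
  have "distr \<gamma> lborel (\<lambda>z. m + \<sigma> * z) = density lborel (normal_density m \<sigma>)"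
    by (simp add: distributed_def)
  then show ?thesis by (simp cong: distr_cong)
qed

text \<open>Completing the square: the ratio of the densities of N(c, 1) and N(0, 1) at
  \<open>z\<close> is \<open>exp (c * z - c^2 / 2)\<close>.\<close>

lemma distr_std_normal_shift:
  "distr \<gamma> borel (\<lambda>z. z + c)
     = density \<gamma> (\<lambda>z. ennreal (exp (c * z - c^2 / 2)))"
proof -
  have "distr \<gamma> borel (\<lambda>z. z + c) = density lborel (normal_density c 1)"
    using distr_std_normal_affine[of 1 c] by (simp add: add.commute)
  also have "\<dots> = density lborel (\<lambda>z. ennreal (std_normal_density z) * ennreal (exp (c * z - c^2 / 2)))"
    by (intro density_cong)
       (auto simp: normal_density_def ennreal_mult[symmetric] mult_exp_exp power2_eq_square field_simps
          simp flip: exp_add)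
  also have "\<dots> = density \<gamma> (\<lambda>z. ennreal (exp (c * z - c^2 / 2)))"
    by (intro density_density_eq[symmetric]) auto
  finally show ?thesis .
qed

text \<open>The finite-dimensional Cameron-Martin formula: the translated law and the density both
  factor over the coordinates.\<close>

lemma gaussian_shift:
  assumes fin: "finite I"
  shows "distr (Pi\<^sub>M I (\<lambda>_. \<gamma>)) (Pi\<^sub>M I (\<lambda>_. borel)) (\<lambda>z. \<lambda>i\<in>I. z i + c i)
    = density (Pi\<^sub>M I (\<lambda>_. \<gamma>))
        (\<lambda>z. ennreal (exp ((\<Sum>i\<in>I. c i * z i) - (\<Sum>i\<in>I. (c i)^2) / 2)))"
proof -
  have pr: "prob_space (distr \<gamma> borel (\<lambda>z. z + b))" for b
    by (intro prob_space.prob_space_distr prob_space_std_normal) auto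
  have "distr (Pi\<^sub>M I (\<lambda>_. \<gamma>)) (Pi\<^sub>M I (\<lambda>_. borel)) (\<lambda>z. \<lambda>i\<in>I. z i + c i)
    = Pi\<^sub>M I (\<lambda>i. distr \<gamma> borel (\<lambda>z. z + c i))"
    using fin prob_space_std_normal pr
    by (intro distr_PiM_coordinates[where f="\<lambda>i z. z + c i"]) (auto intro: prob_space_imp_sigma_finite)
  also have "\<dots> = Pi\<^sub>M I (\<lambda>i. density \<gamma> (\<lambda>z. ennreal (exp (c i * z - (c i)^2 / 2))))"
    by (simp add: distr_std_normal_shift)
  also have "\<dots> = density (Pi\<^sub>M I (\<lambda>_. \<gamma>))
        (\<lambda>z. \<Prod>i\<in>I. ennreal (exp (c i * z i - (c i)^2 / 2)))"
    using fin pr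
    by (intro density_PiM[symmetric])
       (auto intro: prob_space_imp_sigma_finite prob_space_std_normal simp flip: distr_std_normal_shift)
  also have "(\<lambda>z. \<Prod>i\<in>I. ennreal (exp (c i * z i - (c i)^2 / 2)))
    = (\<lambda>z. ennreal (exp ((\<Sum>i\<in>I. c i * z i) - (\<Sum>i\<in>I. (c i)^2) / 2)))"
    using fin by (simp add: prod_ennreal exp_sum[symmetric] sum_subtractf sum_divide_distrib)
  finally show ?thesis .
qed

lemma gaussian_linear_form:
  fixes v :: "'i \<Rightarrow> real"
  assumes fin: "finite I" and pos: "0 < (\<Sum>i\<in>I. (v i)^2)"
  shows "distr (Pi\<^sub>M I (\<lambda>_. \<gamma>)) borel (\<lambda>z. (\<Sum>i\<in>I. v i * z i) / sqrt (\<Sum>i\<in>I. (v i)^2))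
    = \<gamma>"
proof -
  let ?P = "Pi\<^sub>M I (\<lambda>_. \<gamma>) :: ('i \<Rightarrow> real) measure"
  let ?S = "\<Sum>i\<in>I. (v i)^2"
  interpret G: product_prob_space "\<lambda>_::'i. \<gamma>" I
    by (intro product_prob_spaceI prob_space_std_normal)
  \<comment> \<open>A zero coefficient gives a degenerate law without a density, so only the support
    of \<open>v\<close> enters the sum of independent normal variables.\<close>
  define J where "J = {i\<in>I. v i \<noteq> 0}"
  have J: "J \<subseteq> I" "finite J" using fin by (auto simp: J_def)
  have SJ: "?S = (\<Sum>i\<in>J. (v i)^2)" unfolding J_def using fin by (intro sum.mono_neutral_right) auto
  have J0: "J \<noteq> {}" using pos SJ by auto
  have I0: "I \<noteq> {}" using J J0 by auto
  have comp: "distr ?P borel (\<lambda>z. z i) = \<gamma>" if "i \<in> I" for i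
    using distr_PiM_component[of I "\<lambda>_. \<gamma>" i] that prob_space_std_normal
    by (simp cong: distr_cong)
  have m: "(\<lambda>z. z i) \<in> borel_measurable ?P" if "i \<in> I" for i
    using measurable_component_singleton[OF that, of "\<lambda>_. \<gamma>"]
      measurable_cong_sets[OF refl, of \<gamma> borel ?P] by simp
  have ind: "G.P.indep_vars (\<lambda>_. borel) (\<lambda>i z. z i) I"
  proof (subst G.P.indep_vars_iff_distr_eq_PiM'[OF I0])
    show "\<And>i. i \<in> I \<Longrightarrow> (\<lambda>z. z i) \<in> borel_measurable ?P" by (rule m)
    have "distr ?P (Pi\<^sub>M I (\<lambda>_. borel)) (\<lambda>x. \<lambda>i\<in>I. x i) = distr ?P ?P (\<lambda>x. x)"
      by (intro distr_cong) (auto simp: space_PiM intro!: sets_PiM_cong)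
    also have "\<dots> = ?P" by (rule distr_id2) simp
    also have "\<dots> = Pi\<^sub>M I (\<lambda>i. distr ?P borel (\<lambda>z. z i))"
      by (intro PiM_cong refl) (simp add: comp)
    finally show "distr ?P (Pi\<^sub>M I (\<lambda>_. borel)) (\<lambda>x. \<lambda>i\<in>I. x i) = Pi\<^sub>M I (\<lambda>i. distr ?P borel (\<lambda>z. z i))" .
  qed
  have d: "distributed ?P lborel (\<lambda>z. 0 + v i * z i) (normal_density (0 + v i * 0) (\<bar>v i\<bar> * 1))" if "i \<in> J" for i
  proof (rule G.P.normal_density_affine)
    have "distr ?P lborel (\<lambda>z. z i) = \<gamma>"
      using comp[of i] that J by (auto cong: distr_cong)
    then show "distributed ?P lborel (\<lambda>z. z i) std_normal_density"
      using m that J by (auto simp: distributed_def)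
  qed (use that in \<open>auto simp: J_def\<close>)
  have ind2: "G.P.indep_vars (\<lambda>_. borel) (\<lambda>i z. v i * z i) J"
    by (rule G.P.indep_vars_compose2[where Y="\<lambda>i z. v i * z", OF G.P.indep_vars_subset[OF ind J(1)]]) auto
  have "distributed ?P lborel (\<lambda>z. \<Sum>i\<in>J. v i * z i) (normal_density (\<Sum>i\<in>J. 0) (sqrt (\<Sum>i\<in>J. \<bar>v i\<bar>^2)))"
    using d by (intro G.P.sum_indep_normal J J0 ind2) (auto simp: J_def)
  then have "distributed ?P lborel (\<lambda>z. \<Sum>i\<in>J. v i * z i) (normal_density 0 (sqrt ?S))"
    by (simp add: SJ)
  from G.P.normal_density_affine[OF this, of "1 / sqrt ?S" 0] pos
  have "distributed ?P lborel (\<lambda>z. (\<Sum>i\<in>J. v i * z i) / sqrt ?S) (normal_density 0 1)"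
    by simp
  moreover have "(\<lambda>z. \<Sum>i\<in>J. v i * z i) = (\<lambda>z. \<Sum>i\<in>I. v i * z i)"
    unfolding J_def using fin by (intro ext sum.mono_neutral_left) auto
  ultimately have "distr ?P lborel (\<lambda>z. (\<Sum>i\<in>I. v i * z i) / sqrt ?S) = \<gamma>"
    by (simp add: distributed_def fun_eq_iff)
  then show ?thesis by (simp cong: distr_cong)
qed

section \<open>Second moments and exponential moments\<close>

lemma integrable_mult_of_squares:
  fixes f g :: "'a \<Rightarrow> real"
  assumes [measurable]: "f \<in> borel_measurable M" "g \<in> borel_measurable M"
    and f: "integrable M (\<lambda>x. (f x)^2)" and g: "integrable M (\<lambda>x. (g x)^2)"
  shows "integrable M (\<lambda>x. f x * g x)"
proof (rule Bochner_Integration.integrable_bound)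
  show "integrable M (\<lambda>x. (f x)^2 + (g x)^2)" using f g by simp
  show "AE x in M. norm (f x * g x) \<le> norm ((f x)^2 + (g x)^2)"
  proof (rule AE_I2)
    fix x
    have "2 * (\<bar>f x\<bar> * \<bar>g x\<bar>) \<le> (f x)^2 + (g x)^2" "0 \<le> \<bar>f x\<bar> * \<bar>g x\<bar>"
      using sum_squares_bound[of "\<bar>f x\<bar>" "\<bar>g x\<bar>"] by simp_all
    then show "norm (f x * g x) \<le> norm ((f x)^2 + (g x)^2)"
      unfolding real_norm_def abs_mult by linarith
  qed
qed simp

text \<open>Integrates 2 |f g| \<le> (b / a) f^2 + (a / b) g^2, where the weights balance the two
  terms. Upper bounds \<open>a\<close> and \<open>b\<close> stand in for the norms, so no square
  roots of integrals occur.\<close>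

lemma Cauchy_Schwarz_integral_le:
  fixes f g :: "'a \<Rightarrow> real"
  assumes [measurable]: "f \<in> borel_measurable M" "g \<in> borel_measurable M"
    and f: "integrable M (\<lambda>x. (f x)^2)" "(\<integral>x. (f x)^2 \<partial>M) \<le> a^2"
    and g: "integrable M (\<lambda>x. (g x)^2)" "(\<integral>x. (g x)^2 \<partial>M) \<le> b^2"
    and pos: "0 < a" "0 < b"
  shows "(\<integral>x. \<bar>f x * g x\<bar> \<partial>M) \<le> a * b"
proof -
  have fg: "integrable M (\<lambda>x. f x * g x)" by (intro integrable_mult_of_squares f g) auto
  have "(\<integral>x. \<bar>f x * g x\<bar> \<partial>M) \<le> (\<integral>x. b / (2 * a) * (f x)^2 + a / (2 * b) * (g x)^2 \<partial>M)"
  proof (rule integral_mono)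
    fix x
    have "0 \<le> (b * \<bar>f x\<bar> - a * \<bar>g x\<bar>)^2" by simp
    then have "2 * a * b * \<bar>f x * g x\<bar> \<le> b^2 * (f x)^2 + a^2 * (g x)^2"
      by (simp add: power2_diff power_mult_distrib abs_mult mult_ac)
    then show "\<bar>f x * g x\<bar> \<le> b / (2 * a) * (f x)^2 + a / (2 * b) * (g x)^2"
      using pos by (simp add: field_simps power2_eq_square)
  qed (use f g fg in auto)
  also have "\<dots> = b / (2 * a) * (\<integral>x. (f x)^2 \<partial>M) + a / (2 * b) * (\<integral>x. (g x)^2 \<partial>M)"
    using f g by simp
  also have "\<dots> \<le> b / (2 * a) * a^2 + a / (2 * b) * b^2"
    using pos f g by (intro add_mono mult_left_mono) auto
  also have "\<dots> = a * b" using pos by (simp add: field_simps power2_eq_square)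
  finally show ?thesis .
qed

lemma (in prob_space) L1_le_L2:
  fixes f :: "'a \<Rightarrow> real"
  assumes [measurable]: "f \<in> borel_measurable M"
    and f: "integrable M (\<lambda>x. (f x)^2)" "(\<integral>x. (f x)^2 \<partial>M) \<le> a^2" "0 < a"
  shows "integrable M f" "(\<integral>x. \<bar>f x\<bar> \<partial>M) \<le> a"
  using integrable_mult_of_squares[of f M "\<lambda>_. 1"] Cauchy_Schwarz_integral_le[of f M "\<lambda>_. 1" a 1] f
  by (auto simp: prob_space)

lemma PiM_component:
  fixes f :: "'a \<Rightarrow> real"
  assumes "\<And>i. prob_space (M i)" "i \<in> I" and f[measurable]: "f \<in> borel_measurable (M i)"
  shows integral_PiM_component: "(\<integral>z. f (z i) \<partial>Pi\<^sub>M I M) = (\<integral>x. f x \<partial>M i)"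
    and integrable_PiM_component: "integrable (Pi\<^sub>M I M) (\<lambda>z. f (z i)) \<longleftrightarrow> integrable (M i) f"
proof -
  have d: "distr (Pi\<^sub>M I M) (M i) (\<lambda>z. z i) = M i"
    using assms by (intro distr_PiM_component) auto
  have m[measurable]: "(\<lambda>z. z i) \<in> measurable (Pi\<^sub>M I M) (M i)" using assms by auto
  show "(\<integral>z. f (z i) \<partial>Pi\<^sub>M I M) = (\<integral>x. f x \<partial>M i)"
    using integral_distr[OF m f] by (simp add: d)
  show "integrable (Pi\<^sub>M I M) (\<lambda>z. f (z i)) \<longleftrightarrow> integrable (M i) f"
    using integrable_distr_eq[OF m f] by (simp add: d)
qed

text \<open>By independence the off-diagonal products integrate to products of means. This separates
  the fluctuations, whose second moments add up, from the accumulated bias, which enters through its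
  square.\<close>

lemma second_moment_sum:
  fixes g :: "'i \<Rightarrow> 'a \<Rightarrow> real"
  assumes fin: "finite I" and M: "\<And>i. prob_space (M i)"
    and g[measurable]: "\<And>i. i \<in> I \<Longrightarrow> g i \<in> borel_measurable (M i)"
    and g2: "\<And>i. i \<in> I \<Longrightarrow> integrable (M i) (\<lambda>x. (g i x)^2)"
  shows "integrable (Pi\<^sub>M I M) (\<lambda>z. (\<Sum>i\<in>I. g i (z i))^2)"
    and "(\<integral>z. (\<Sum>i\<in>I. g i (z i))^2 \<partial>Pi\<^sub>M I M)
      \<le> (\<Sum>i\<in>I. \<integral>x. (g i x)^2 \<partial>M i) + (\<Sum>i\<in>I. \<integral>x. g i x \<partial>M i)^2"
proof -
  interpret product_sigma_finite M
    using M by (simp add: product_sigma_finite_def prob_space_imp_sigma_finite)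
  have g1: "integrable (M i) (g i)" if "i \<in> I" for i
    using integrable_mult_of_squares[of "g i" "M i" "\<lambda>_. 1"] that g2[OF that] M[of i]
    by (simp add: prob_space.finite_measure finite_measure.integrable_const)
  \<comment> \<open>Turns \<open>g i (z i) * g j (z j)\<close> into a product over all of
    \<open>I\<close> with factors \<open>1\<close> elsewhere; for \<open>i = j\<close> both factors
    meet at the same index.\<close>
  define h where "h i j k x = (if k = i then g i x else 1) * (if k = j then g j x else 1)" for i j k x
  define q where "q i = (\<integral>x. g i x \<partial>M i)" for i
  have h_int: "integrable (M k) (h i j k)" if "i \<in> I" "j \<in> I" for i j k
    using g1 g2 that M[of k]
    by (cases "k = i"; cases "k = j") (auto simp: h_def[abs_def] power2_eq_square
      prob_space.finite_measure finite_measure.integrable_const)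
  have h_prod: "(\<Prod>k\<in>I. h i j k (z k)) = g i (z i) * g j (z j)" if "i \<in> I" "j \<in> I" for i j z
    using fin that by (simp add: h_def prod.distrib prod.delta)
  have h_val: "(\<integral>z. g i (z i) * g j (z j) \<partial>Pi\<^sub>M I M) = (if i = j then \<integral>x. (g i x)^2 \<partial>M i else q i * q j)"
    if ij: "i \<in> I" "j \<in> I" for i j
  proof -
    have "(\<integral>z. g i (z i) * g j (z j) \<partial>Pi\<^sub>M I M) = (\<integral>z. (\<Prod>k\<in>I. h i j k (z k)) \<partial>Pi\<^sub>M I M)"
      by (simp add: h_prod ij)
    also have "\<dots> = (\<Prod>k\<in>I. \<integral>x. h i j k x \<partial>M k)"
      using fin h_int ij by (intro product_integral_prod) auto
    also have "\<dots> = (if i = j then \<integral>x. (g i x)^2 \<partial>M i else q i * q j)"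
    proof (cases "i = j")
      case True
      have "(\<integral>x. h i j k x \<partial>M k) = (if k = i then \<integral>x. (g i x)^2 \<partial>M i else 1)" for k
        using True M[of k] by (auto simp: h_def power2_eq_square prob_space.prob_space)
      then show ?thesis using True fin ij by (simp add: prod.delta)
    next
      case False
      have "(\<integral>x. h i j k x \<partial>M k) = (if k = i then q i else 1) * (if k = j then q j else 1)" for k
        using False M[of k] by (auto simp: h_def q_def prob_space.prob_space)
      then show ?thesis using False fin ij by (simp add: prod.distrib prod.delta)
    qed
    finally show ?thesis .
  qed
  have gg: "integrable (Pi\<^sub>M I M) (\<lambda>z. g i (z i) * g j (z j))" if ij: "i \<in> I" "j \<in> I" for i j
  proof -
    have "integrable (Pi\<^sub>M I M) (\<lambda>z. \<Prod>k\<in>I. h i j k (z k))"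
      using fin h_int ij by (intro product_integrable_prod) auto
    then show ?thesis by (simp add: h_prod ij)
  qed
  have sq: "(\<Sum>i\<in>I. g i (z i))^2 = (\<Sum>i\<in>I. \<Sum>j\<in>I. g i (z i) * g j (z j))" for z
    by (simp add: power2_eq_square sum_product)
  show "integrable (Pi\<^sub>M I M) (\<lambda>z. (\<Sum>i\<in>I. g i (z i))^2)"
    unfolding sq by (intro Bochner_Integration.integrable_sum gg) auto
  have "(\<integral>z. (\<Sum>i\<in>I. g i (z i))^2 \<partial>Pi\<^sub>M I M)
    = (\<Sum>i\<in>I. \<Sum>j\<in>I. \<integral>z. g i (z i) * g j (z j) \<partial>Pi\<^sub>M I M)"
    unfolding sq using gg by (simp add: Bochner_Integration.integral_sum Bochner_Integration.integrable_sum)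
  \<comment> \<open>Adding the nonnegative \<open>q i * q i\<close> on the diagonal completes the
    products of means to a full square.\<close>
  also have "\<dots> \<le> (\<Sum>i\<in>I. \<Sum>j\<in>I. (if i = j then \<integral>x. (g i x)^2 \<partial>M i else 0) + q i * q j)"
    by (intro sum_mono) (auto simp: h_val)
  also have "\<dots> = (\<Sum>i\<in>I. \<integral>x. (g i x)^2 \<partial>M i) + (\<Sum>i\<in>I. q i)^2"
    using fin by (simp add: sum.distrib sum.delta power2_eq_square sum_product)
  finally show "(\<integral>z. (\<Sum>i\<in>I. g i (z i))^2 \<partial>Pi\<^sub>M I M)
      \<le> (\<Sum>i\<in>I. \<integral>x. (g i x)^2 \<partial>M i) + (\<Sum>i\<in>I. \<integral>x. g i x \<partial>M i)^2"
    by (simp add: q_def)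
qed

text \<open>The translated Gaussian law is a probability measure, so its density
  \<open>exp (c * z - c^2 / 2)\<close> integrates to \<open>1\<close>; no Gaussian integral has to
  be computed.\<close>

lemma std_normal_exp:
  shows integrable_std_normal_exp: "integrable \<gamma> (\<lambda>z. exp (c * z))"
    and integral_std_normal_exp: "(\<integral>z. exp (c * z) \<partial>\<gamma>) = exp (c^2 / 2)"
proof -
  have "prob_space (distr \<gamma> borel (\<lambda>z. z + c))"
    by (intro prob_space.prob_space_distr prob_space_std_normal) auto
  then have "emeasure (density \<gamma> (\<lambda>z. ennreal (exp (c * z - c^2 / 2)))) (space borel) = 1"
    unfolding distr_std_normal_shift by (auto dest: prob_space.emeasure_space_1)
  then have nn: "(\<integral>\<^sup>+z. ennreal (exp (c * z - c^2 / 2)) \<partial>\<gamma>) = 1"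
    by (subst (asm) emeasure_density) auto
  have e: "exp (c * z) = exp (c^2 / 2) * exp (c * z - c^2 / 2)" for z :: real
    by (simp flip: exp_add)
  have "has_bochner_integral \<gamma> (\<lambda>z. exp (c * z - c^2 / 2)) 1"
    using nn by (intro has_bochner_integral_nn_integral) auto
  then have "has_bochner_integral \<gamma> (\<lambda>z. exp (c^2 / 2) * exp (c * z - c^2 / 2)) (exp (c^2 / 2) * 1)"
    by (intro has_bochner_integral_mult_right) auto
  then have "has_bochner_integral \<gamma> (\<lambda>z. exp (c * z)) (exp (c^2 / 2))"
    by (simp flip: e)
  then show "integrable \<gamma> (\<lambda>z. exp (c * z))"
    "(\<integral>z. exp (c * z) \<partial>\<gamma>) = exp (c^2 / 2)"
    by (auto simp: has_bochner_integral_iff)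
qed

lemma std_normal_exp_abs:
  shows integrable_std_normal_exp_abs: "integrable \<gamma> (\<lambda>z. exp (c * \<bar>z\<bar>))"
    and integral_std_normal_exp_abs: "(\<integral>z. exp (c * \<bar>z\<bar>) \<partial>\<gamma>) \<le> 2 * exp (c^2 / 2)"
proof -
  have s: "integrable \<gamma> (\<lambda>z. exp (c * z) + exp (- c * z))"
    using integrable_std_normal_exp[of c] integrable_std_normal_exp[of "- c"] by simp
  have le: "exp (c * \<bar>z\<bar>) \<le> exp (c * z) + exp (- c * z)" for z :: real
    by (cases "0 \<le> z") (auto intro: less_imp_le)
  show *: "integrable \<gamma> (\<lambda>z. exp (c * \<bar>z\<bar>))"
    by (rule Bochner_Integration.integrable_bound[OF s]) (use le in \<open>auto intro: order_trans[OF _ abs_ge_self]\<close>)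
  have "(\<integral>z. exp (c * \<bar>z\<bar>) \<partial>\<gamma>) \<le> (\<integral>z. exp (c * z) + exp (- c * z) \<partial>\<gamma>)"
    using * s le by (intro integral_mono) auto
  also have "\<dots> = 2 * exp (c^2 / 2)"
    using integrable_std_normal_exp[of c] integrable_std_normal_exp[of "- c"]
      integral_std_normal_exp[of c] integral_std_normal_exp[of "- c"] by simp
  finally show "(\<integral>z. exp (c * \<bar>z\<bar>) \<partial>\<gamma>) \<le> 2 * exp (c^2 / 2)" .
qed

text \<open>For negative \<open>y = - t\<close>, the claim follows from
  \<open>exp t \<ge> 1 + t + t^2 / 2\<close>, since the product of this polynomial with
  \<open>1 - t + t^2\<close> is at least \<open>1\<close>. The range is unbounded below, on which
  the one-sided truncation in the Chernoff bound relies.\<close>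

lemma exp_le_quadratic:
  fixes y :: real
  assumes "y \<le> 1"
  shows "exp y \<le> 1 + y + y^2"
proof (cases "0 \<le> y")
  case True
  then show ?thesis using exp_bound[of y] assms by simp
next
  case False
  define t where "t = - y"
  have t: "0 \<le> t" using False by (simp add: t_def)
  have pos: "0 \<le> 1 - t + t^2"
    using zero_le_power2[of "t - 1/2"] by (simp add: power2_diff power_divide)
  have "1 \<le> (1 - t + t^2) * (1 + t + t^2 / 2)"
  proof -
    have "(1 - t + t^2) * (1 + t + t^2 / 2) = 1 + (t^2 / 2 + t^3 / 2 + t^4 / 2)"
      by (simp add: field_simps power2_eq_square power3_eq_cube power4_eq_xxxx)
    then show ?thesis using t by simp
  qed
  also have "\<dots> \<le> (1 - t + t^2) * exp t"
    using exp_lower_Taylor_quadratic[OF t] pos by (intro mult_left_mono) auto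
  finally have "exp (- t) * 1 \<le> exp (- t) * ((1 - t + t^2) * exp t)" by (intro mult_left_mono) auto
  also have "\<dots> = 1 - t + t^2" by (simp add: exp_minus)
  finally show ?thesis by (simp add: t_def)
qed

section \<open>The Metropolis acceptance as a function of the log density ratio, and its normal
  averages\<close>

definition accept :: "real \<Rightarrow> real" where
  "accept w = min 1 (exp w)"

lemma accept_range: "0 \<le> accept w" "accept w \<le> 1"
  by (auto simp: accept_def)

lemma accept_measurable[measurable]: "accept \<in> borel_measurable borel"
  unfolding accept_def[abs_def] by measurable

text \<open>\<open>accept w\<close> equals \<open>exp (min 0 w)\<close>, and \<open>exp\<close> is
  1-Lipschitz on the nonpositive half-line.\<close>

lemma accept_lipschitz: "\<bar>accept v - accept w\<bar> \<le> \<bar>v - w\<bar>"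
proof -
  have e: "accept w = exp (min 0 w)" for w by (auto simp: accept_def min_def)
  have *: "exp b - exp a \<le> b - a" if "a \<le> b" "b \<le> 0" for a b :: real
  proof -
    have "exp b - exp a = exp b * (1 - exp (a - b))" by (simp add: algebra_simps flip: exp_add)
    also have "\<dots> \<le> 1 * (b - a)"
    proof (intro mult_mono)
      show "1 - exp (a - b) \<le> b - a" using exp_ge_add_one_self[of "a - b"] by linarith
    qed (use that in auto)
    finally show ?thesis by simp
  qed
  have "\<bar>accept v - accept w\<bar> \<le> w - v" if "v \<le> w" for v w
  proof -
    have "min 0 v \<le> min 0 w" using that by auto
    moreover have "exp (min 0 w) - exp (min 0 v) \<le> min 0 w - min 0 v"
      using that by (intro *) auto
    moreover have "min 0 w - min 0 v \<le> w - v" using that by auto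
    ultimately show ?thesis by (auto simp: e)
  qed
  from this[of v w] this[of w v] show ?thesis by (cases "v \<le> w") auto
qed

text \<open>Away from the kink at \<open>0\<close> the error is quadratic. If \<open>w\<close> and
  \<open>w + u\<close> lie on opposite sides of the kink, then |w| \<le> |u| and only the Lipschitz
  bound is left; the indicator records this event. Under a law with bounded density its probability
  is of order |u|, so after integration this term is quadratic too.\<close>

lemma accept_expansion:
  assumes "\<bar>u\<bar> \<le> 1"
  shows "\<bar>accept (w + u) - accept w - u * (exp w * indicator {..0} w)\<bar>
    \<le> u^2 + 2 * \<bar>u\<bar> * indicator {-\<bar>u\<bar>..\<bar>u\<bar>} w"
proof -
  have lip: "\<bar>accept (w + u) - accept w\<bar> \<le> \<bar>u\<bar>" using accept_lipschitz[of "w + u" w] by simp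
  consider "w > 0" "w + u \<ge> 0" | "w > 0" "w + u < 0" | "w \<le> 0" "w + u \<le> 0" | "w \<le> 0" "w + u > 0"
    by linarith
  then show ?thesis
  proof cases
    case 1
    then have "accept (w + u) = 1" "accept w = 1" by (auto simp: accept_def)
    then show ?thesis using 1 by (auto simp: indicator_def)
  next
    case 2
    then have ind: "indicator {-\<bar>u\<bar>..\<bar>u\<bar>} w = (1::real)" "indicator {..0} w = (0::real)"
      by (auto simp: indicator_def)
    show ?thesis
      unfolding ind mult_1_right mult_zero_right using lip zero_le_power2[of u] by linarith
  next
    case 3
    then have "accept (w + u) = exp w * exp u" "accept w = exp w" by (auto simp: accept_def exp_add[symmetric])
    then have "accept (w + u) - accept w - u * (exp w * indicator {..0} w) = exp w * (exp u - 1 - u)"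
      using 3 by (simp add: algebra_simps)
    then have "\<bar>accept (w + u) - accept w - u * (exp w * indicator {..0} w)\<bar> = exp w * \<bar>exp u - 1 - u\<bar>"
      by (simp add: abs_mult)
    also have "\<dots> \<le> 1 * u^2"
    proof (intro mult_mono)
      show "\<bar>exp u - 1 - u\<bar> \<le> u^2"
        using exp_le_quadratic[of u] exp_ge_add_one_self[of u] assms by linarith
    qed (use 3 in auto)
    finally show ?thesis by (simp add: indicator_def)
  next
    case 4
    then have "\<bar>u * (exp w * indicator {..0} w)\<bar> \<le> \<bar>u\<bar> * 1"
      unfolding abs_mult by (intro mult_left_mono) (auto simp: indicator_def)
    moreover have ind: "indicator {-\<bar>u\<bar>..\<bar>u\<bar>} w = (1::real)" using 4 by (auto simp: indicator_def)
    ultimately show ?thesis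
      unfolding ind mult_1_right using lip zero_le_power2[of u] by linarith
  qed
qed

text \<open>As a rewrite rule this moves measurability goals from the Gaussian product to the Borel
  product, over which the measurability facts below are stated.\<close>

lemma measurable_PiM_std_normal[simp]:
  "measurable (Pi\<^sub>M I (\<lambda>_. \<gamma>)) = measurable (Pi\<^sub>M I (\<lambda>_. borel :: real measure))"
  by (intro ext measurable_cong_sets sets_PiM_cong) auto

lemma std_normal_prob_interval:
  assumes "a \<le> b"
  shows "measure \<gamma> {a..b} \<le> (b - a) / 2"
proof -
  interpret prob_space \<gamma> by (rule prob_space_std_normal)
  have bound: "std_normal_density x \<le> 1 / 2" for x
  proof -
    have "2 \<le> sqrt (2 * pi)" using pi_gt3 by (intro real_le_rsqrt) simp
    then have "1 / sqrt (2 * pi) \<le> 1 / 2" by (intro divide_left_mono) auto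
    moreover have "exp (- x\<^sup>2 / 2) \<le> 1" by simp
    ultimately have "1 / sqrt (2 * pi) * exp (- x\<^sup>2 / 2) \<le> 1 / 2 * 1" by (intro mult_mono) auto
    then show ?thesis by (simp add: std_normal_density_def)
  qed
  have "emeasure \<gamma> {a..b} = (\<integral>\<^sup>+x. ennreal (std_normal_density x) * indicator {a..b} x \<partial>lborel)"
    by (intro emeasure_density) auto
  also have "\<dots> \<le> (\<integral>\<^sup>+x. ennreal (1/2) * indicator {a..b} x \<partial>lborel)"
    using bound by (intro nn_integral_mono mult_right_mono ennreal_leI) auto
  also have "\<dots> = ennreal (1/2) * ennreal (b - a)"
    using assms by (subst nn_integral_cmult_indicator) auto
  also have "\<dots> = ennreal ((b - a) / 2)"
    using assms by (subst ennreal_mult[symmetric]) auto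
  finally show ?thesis using assms by (simp add: emeasure_eq_measure)
qed

text \<open>Serves to replace the standard deviation computed from an individual point by its
  limiting value.\<close>

lemma std_normal_cdf_lipschitz:
  "\<bar>cdf \<gamma> x - cdf \<gamma> y\<bar> \<le> \<bar>x - y\<bar> / 2"
proof -
  interpret prob_space \<gamma> by (rule prob_space_std_normal)
  have *: "\<bar>cdf \<gamma> y - cdf \<gamma> x\<bar> \<le> (y - x) / 2" if "x \<le> y" for x y
  proof -
    have "measure \<gamma> {..y} = measure \<gamma> {..x} + measure \<gamma> {x<..y}"
      using that by (subst finite_measure_Union[symmetric]) (auto intro!: arg_cong[of _ _ "measure \<gamma>"])
    moreover have "measure \<gamma> {x<..y} \<le> measure \<gamma> {x..y}"
      by (intro finite_measure_mono) auto
    moreover have "measure \<gamma> {x<..y} \<ge> 0" by simp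
    ultimately show ?thesis using std_normal_prob_interval[OF that] by (auto simp: cdf_def)
  qed
  from *[of x y] *[of y x] show ?thesis by (cases "x \<le> y") (auto simp: abs_minus_commute)
qed

lemma std_normal_prob_greater:
  "measure \<gamma> {x<..} = cdf \<gamma> (- x)"
proof -
  interpret prob_space \<gamma> by (rule prob_space_std_normal)
  have sym: "distr \<gamma> borel (\<lambda>z. - z) = \<gamma>"
  proof -
    have "distributed \<gamma> lborel (\<lambda>z. z) std_normal_density"
      by (auto simp: distributed_def distr_id2[unfolded id_def] intro!: measure_eqI)
    from normal_density_affine[OF this, of "- 1" 0]
    have "distr \<gamma> lborel (\<lambda>z. - z) = \<gamma>"
      by (simp add: distributed_def)
    then show ?thesis by (simp cong: distr_cong)
  qed
  have "measure \<gamma> {x<..} = measure (distr \<gamma> borel (\<lambda>z. - z)) {x<..}"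
    by (simp add: sym)
  also have "\<dots> = measure \<gamma> {..<- x}"
    by (subst measure_distr) (auto intro!: arg_cong[of _ _ "measure \<gamma>"])
  also have "\<dots> = measure \<gamma> {..- x}"
  proof -
    have "measure \<gamma> {- x} = 0"
      using std_normal_prob_interval[of "- x" "- x"] measure_nonneg[of \<gamma> "{- x}"] by auto
    moreover have "measure \<gamma> {..- x} = measure \<gamma> {..<- x} + measure \<gamma> {- x}"
      by (subst finite_measure_Union[symmetric]) (auto intro!: arg_cong[of _ _ "measure \<gamma>"])
    ultimately show ?thesis by simp
  qed
  finally show ?thesis by (simp add: cdf_def)
qed

text \<open>The normal law with mean \<open>-T\<^sup>2/2\<close> and standard deviation \<open>T\<close> is the one for which
  \<open>exp\<close> has expectation \<open>1\<close>, so that tilting it by \<open>exp\<close> reflects it at \<open>0\<close>.\<close>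

lemma accept_normal_slope:
  assumes "0 < T"
  shows "integrable \<gamma> (\<lambda>z. exp (T * z - T^2 / 2) * indicator {..0} (T * z - T^2 / 2))"
    and "(\<integral>z. exp (T * z - T^2 / 2) * indicator {..0} (T * z - T^2 / 2) \<partial>\<gamma>)
      = cdf \<gamma> (- T / 2)"
proof -
  have i: "indicator {..0} (T * z - T^2 / 2) = (indicator {..T/2} z :: real)" for z
    using assms by (auto simp: indicator_def power2_eq_square field_simps)
  have "integrable \<gamma> (\<lambda>z. exp (T * z) * exp (- T\<^sup>2 / 2))"
    using integrable_std_normal_exp[of T] by simp
  then have "integrable \<gamma> (\<lambda>z. exp (T * z - T^2 / 2))"
    by (simp add: diff_conv_add_uminus exp_add del: add_uminus_conv_diff)
  then show "integrable \<gamma> (\<lambda>z. exp (T * z - T^2 / 2) * indicator {..0} (T * z - T^2 / 2))"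
    unfolding i by (intro integrable_real_mult_indicator) auto
  have "(\<integral>z. exp (T * z - T^2 / 2) * indicator {..T/2} z \<partial>\<gamma>)
    = (\<integral>z. indicator {..T/2} z \<partial>density \<gamma> (\<lambda>z. ennreal (exp (T * z - T^2 / 2))))"
    by (subst integral_density) auto
  also have "\<dots> = (\<integral>z. indicator {..T/2} z \<partial>distr \<gamma> borel (\<lambda>z. z + T))"
    by (simp add: distr_std_normal_shift)
  also have "\<dots> = (\<integral>z. indicator {..T/2} (z + T) \<partial>\<gamma>)"
    by (subst integral_distr) auto
  also have "\<dots> = (\<integral>z. indicator {..- T/2} z \<partial>\<gamma>)"
    by (intro Bochner_Integration.integral_cong) (auto simp: indicator_def)
  also have "\<dots> = cdf \<gamma> (- T / 2)" by (simp add: cdf_def)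
  finally show "(\<integral>z. exp (T * z - T^2 / 2) * indicator {..0} (T * z - T^2 / 2) \<partial>\<gamma>)
      = cdf \<gamma> (- T / 2)" by (simp add: i)
qed

text \<open>Below \<open>0\<close> the acceptance is the tilted mass,
  \<open>cdf \<gamma> (- T / 2)\<close> by the preceding reflection. Above \<open>0\<close> it is
  \<open>1\<close>, and the event has the same mass by symmetry. This is the factor \<open>2\<close>
  of \<open>h_const\<close>.\<close>

lemma accept_normal_mean:
  assumes T: "0 < T"
  shows "(\<integral>z. accept (T * z - T^2 / 2) \<partial>\<gamma>) = 2 * cdf \<gamma> (- T / 2)"
proof -
  interpret prob_space \<gamma> by (rule prob_space_std_normal)
  have "accept (T * z - T^2 / 2)
    = exp (T * z - T^2 / 2) * indicator {..0} (T * z - T^2 / 2) + indicator {T/2<..} z" for z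
    using T by (auto simp: indicator_def accept_def power2_eq_square field_simps)
  then have "(\<integral>z. accept (T * z - T^2 / 2) \<partial>\<gamma>)
    = cdf \<gamma> (- T / 2) + measure \<gamma> {T/2<..}"
    using accept_normal_slope[OF T]
    by (simp only:) (subst Bochner_Integration.integral_add, auto simp: integrable_indicator_iff emeasure_eq_measure)
  then show ?thesis by (simp add: std_normal_prob_greater)
qed

text \<open>Averages the pointwise expansion. The term \<open>2 / T\<close> comes from the kink
  event, which for the standard normal variable is an interval of length 2 |u| / T and hence has
  probability at most |u| / T.\<close>

lemma accept_normal_expansion:
  assumes T: "0 < T" and u: "\<bar>u\<bar> \<le> 1"
  shows "\<bar>(\<integral>z. accept (T * z - T^2 / 2 + u) - accept (T * z - T^2 / 2) \<partial>\<gamma>)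
      - u * cdf \<gamma> (- T / 2)\<bar> \<le> (1 + 2 / T) * u^2"
proof -
  interpret prob_space \<gamma> by (rule prob_space_std_normal)
  let ?n = "\<lambda>z. T * z - T^2 / 2"
  let ?D = "\<lambda>z. exp (?n z) * indicator {..0} (?n z)"
  let ?K = "{T/2 - \<bar>u\<bar>/T..T/2 + \<bar>u\<bar>/T}"
  have indK: "integrable \<gamma> (\<lambda>z. 2 * \<bar>u\<bar> * indicator ?K z)"
    by (rule integrable_mult_right, rule integrable_real_indicator) (simp, simp add: emeasure_eq_measure)
  have intK: "integrable \<gamma> (\<lambda>z. u^2 + 2 * \<bar>u\<bar> * indicator ?K z)"
    by (rule Bochner_Integration.integrable_add[OF _ indK]) simp
  have intA: "integrable \<gamma> (\<lambda>z. accept (?n z + u) - accept (?n z))"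
    by (rule integrable_const_bound[where B=1])
       (auto intro!: AE_I2 order_trans[OF accept_lipschitz] simp: u)
  have i: "indicator {- \<bar>u\<bar>..\<bar>u\<bar>} (?n z) = (indicator ?K z :: real)" for z
    using T by (auto simp: indicator_def power2_eq_square field_simps)
  have intD: "integrable \<gamma> (\<lambda>z. u * ?D z)"
    using accept_normal_slope(1)[OF T] by (rule integrable_mult_right)
  have intAD: "integrable \<gamma> (\<lambda>z. accept (?n z + u) - accept (?n z) - u * ?D z)"
    using intA intD by (rule Bochner_Integration.integrable_diff)
  have "(\<integral>z. u * ?D z \<partial>\<gamma>) = u * cdf \<gamma> (- T / 2)"
    unfolding accept_normal_slope(2)[OF T, symmetric] by (rule integral_mult_right_zero)
  then have eq: "(\<integral>z. accept (?n z + u) - accept (?n z) \<partial>\<gamma>) - u * cdf \<gamma> (- T / 2)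
    = (\<integral>z. accept (?n z + u) - accept (?n z) - u * ?D z \<partial>\<gamma>)"
    using Bochner_Integration.integral_diff[OF intA intD] by (simp only:)
  have "\<bar>\<integral>z. accept (?n z + u) - accept (?n z) - u * ?D z \<partial>\<gamma>\<bar>
    \<le> (\<integral>z. \<bar>accept (?n z + u) - accept (?n z) - u * ?D z\<bar> \<partial>\<gamma>)"
    by (rule integral_abs_bound)
  also have "\<dots> \<le> (\<integral>z. u^2 + 2 * \<bar>u\<bar> * indicator ?K z \<partial>\<gamma>)"
  proof (rule integral_mono)
    show "integrable \<gamma> (\<lambda>z. \<bar>accept (?n z + u) - accept (?n z) - u * ?D z\<bar>)"
      using intAD by (rule integrable_abs)
    show "integrable \<gamma> (\<lambda>z. u^2 + 2 * \<bar>u\<bar> * indicator ?K z)"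
      by (rule intK)
    show "\<bar>accept (?n z + u) - accept (?n z) - u * ?D z\<bar> \<le> u^2 + 2 * \<bar>u\<bar> * indicator ?K z" for z
      using accept_expansion[OF u, of "?n z"] by (simp only: i)
  qed
  also have "\<dots> = u^2 + 2 * \<bar>u\<bar> * measure \<gamma> ?K"
    by (subst Bochner_Integration.integral_add[OF _ indK]) (use prob_space in simp_all)
  also have "\<dots> \<le> u^2 + 2 * \<bar>u\<bar> * (\<bar>u\<bar> / T)"
  proof (intro add_left_mono mult_left_mono)
    show "measure \<gamma> ?K \<le> \<bar>u\<bar> / T"
      using std_normal_prob_interval[of "T/2 - \<bar>u\<bar>/T" "T/2 + \<bar>u\<bar>/T"] T by simp
  qed simp
  also have "\<dots> = (1 + 2 / T) * u^2"
    by (simp add: algebra_simps power2_eq_square)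
  finally show ?thesis unfolding eq .
qed

section \<open>The Gaussian surrogate \<open>N\<close> and the translation that moves it\<close>

locale gaussian_linear =
  fixes I :: "'i set" and v :: "'i \<Rightarrow> real" and \<sigma> :: real
  assumes finite_I: "finite I" and \<sigma>_pos: "0 < \<sigma>" and v_pos: "0 < (\<Sum>i\<in>I. (v i)^2)"
begin

abbreviation "P \<equiv> Pi\<^sub>M I (\<lambda>_. \<gamma>)"

definition "S = (\<Sum>i\<in>I. (v i)^2)"
definition "T = \<sigma> * sqrt S"
text \<open>Normal with variance \<open>T^2\<close> and mean \<open>- T^2 / 2\<close>, so that
  \<open>exp (N z)\<close> has expectation \<open>1\<close>. In the application the linear part is
  the first-order change of the log-density.\<close>

definition "N z = \<sigma> * (\<Sum>i\<in>I. v i * z i) - T^2 / 2"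
text \<open>The shift along \<open>v\<close> is scaled so that \<open>\<sigma>\<close> times its
  inner product with \<open>v\<close> is \<open>u\<close>.\<close>

definition "translate u z = (\<lambda>i\<in>I. z i + u / (\<sigma> * S) * v i)"
text \<open>The Cameron-Martin density of this shift, whose squared length is
  \<open>u^2 / T^2\<close>.\<close>

definition "tilt u z = exp (u / (\<sigma> * S) * (\<Sum>i\<in>I. v i * z i) - u^2 / (2 * T^2))"

lemma S_pos: "0 < S" and T_pos: "0 < T"
  using v_pos \<sigma>_pos by (auto simp: S_def T_def)

lemma T_sq: "T^2 = \<sigma>^2 * S"
  using S_pos by (simp add: T_def power_mult_distrib)

lemma prob_space_P: "prob_space P"
  by (intro prob_space_PiM prob_space_std_normal)

lemma meas[measurable]:
  "N \<in> borel_measurable (Pi\<^sub>M I (\<lambda>_. borel))"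
  "translate u \<in> measurable (Pi\<^sub>M I (\<lambda>_. borel)) (Pi\<^sub>M I (\<lambda>_. borel))"
  "tilt u \<in> borel_measurable (Pi\<^sub>M I (\<lambda>_. borel))"
  unfolding N_def[abs_def] translate_def[abs_def] tilt_def[abs_def] by measurable

lemma tilt_pos: "0 < tilt u z" by (simp add: tilt_def)

lemma N_translate: "N (translate u z) = N z + u"
proof -
  have "(\<Sum>i\<in>I. v i * translate u z i) = (\<Sum>i\<in>I. v i * z i + u / (\<sigma> * S) * (v i)^2)"
    by (intro sum.cong) (auto simp: translate_def power2_eq_square distrib_left)
  also have "\<dots> = (\<Sum>i\<in>I. v i * z i) + u / (\<sigma> * S) * S"
  proof -
    have "(\<Sum>i\<in>I. v i * z i + c * (v i)^2) = (\<Sum>i\<in>I. v i * z i) + c * S" for c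
      unfolding S_def by (simp only: sum.distrib sum_distrib_left)
    then show ?thesis .
  qed
  finally show ?thesis using \<sigma>_pos S_pos by (simp add: N_def field_simps)
qed

lemma distr_translate: "distr P (Pi\<^sub>M I (\<lambda>_. borel)) (translate u) = density P (\<lambda>z. ennreal (tilt u z))"
proof -
  have "(\<Sum>i\<in>I. (u / (\<sigma> * S) * v i)^2) = (u / (\<sigma> * S))^2 * S"
    unfolding S_def power_mult_distrib by (simp only: sum_distrib_left)
  also have "\<dots> = u^2 / T^2"
    unfolding T_sq using S_pos \<sigma>_pos by (simp add: power2_eq_square)
  finally have "(\<Sum>i\<in>I. u / (\<sigma> * S) * v i * z i) - (\<Sum>i\<in>I. (u / (\<sigma> * S) * v i)^2) / 2
    = u / (\<sigma> * S) * (\<Sum>i\<in>I. v i * z i) - u^2 / (2 * T^2)" for z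
    by (simp add: sum_distrib_left mult.assoc)
  then show ?thesis
    using gaussian_shift[OF finite_I, of "\<lambda>i. u / (\<sigma> * S) * v i"]
    by (simp add: translate_def[abs_def] tilt_def[abs_def])
qed

lemma tilt_mean: "integrable P (tilt u)" "(\<integral>z. tilt u z \<partial>P) = 1"
proof -
  interpret prob_space P by (rule prob_space_P)
  have "prob_space (density P (\<lambda>z. ennreal (tilt u z)))"
    unfolding distr_translate[symmetric] by (intro prob_space_distr) simp
  then have "emeasure (density P (\<lambda>z. ennreal (tilt u z))) (space P) = 1"
    by (auto dest: prob_space.emeasure_space_1)
  also have "emeasure (density P (\<lambda>z. ennreal (tilt u z))) (space P) = (\<integral>\<^sup>+z. ennreal (tilt u z) * indicator (space P) z \<partial>P)"
    by (rule emeasure_density) auto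
  also have "\<dots> = (\<integral>\<^sup>+z. ennreal (tilt u z) \<partial>P)"
    by (intro nn_integral_cong) auto
  finally have "(\<integral>\<^sup>+z. ennreal (tilt u z) \<partial>P) = 1" .
  then have "has_bochner_integral P (tilt u) 1"
    using tilt_pos by (intro has_bochner_integral_nn_integral) (auto intro: less_imp_le)
  then show "integrable P (tilt u)" "(\<integral>z. tilt u z \<partial>P) = 1"
    by (auto simp: has_bochner_integral_iff)
qed

text \<open>Squaring doubles the exponent, so up to a constant the square is the density of the
  doubled shift, whose mean is known. The variance then needs no further Gaussian integral.\<close>

lemma tilt_square: "(tilt u z)^2 = exp (u^2 / T^2) * tilt (2 * u) z"
proof -
  have "(tilt u z)^2 = exp (2 * (u / (\<sigma> * S) * (\<Sum>i\<in>I. v i * z i) - u^2 / (2 * T^2)))"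
    by (simp add: tilt_def power2_eq_square flip: exp_add)
  also have "\<dots> = exp (u^2 / T^2 + (2 * u / (\<sigma> * S) * (\<Sum>i\<in>I. v i * z i) - (2 * u)^2 / (2 * T^2)))"
  proof (rule arg_cong[where f=exp])
    have "2 * (w - u^2 / (2 * T^2)) = u^2 / T^2 + (2 * w - (2 * u)^2 / (2 * T^2))" for w
      using T_pos by (simp add: field_simps)
    then show "2 * (u / (\<sigma> * S) * (\<Sum>i\<in>I. v i * z i) - u^2 / (2 * T^2))
      = u^2 / T^2 + (2 * u / (\<sigma> * S) * (\<Sum>i\<in>I. v i * z i) - (2 * u)^2 / (2 * T^2))"
      by simp
  qed
  finally show ?thesis by (simp only: tilt_def exp_add)
qed

lemma tilt_variance:
  "integrable P (\<lambda>z. (tilt u z - 1)^2)" "(\<integral>z. (tilt u z - 1)^2 \<partial>P) = exp (u^2 / T^2) - 1"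
proof -
  interpret prob_space P by (rule prob_space_P)
  have e: "(tilt u z - 1)^2 = exp (u^2 / T^2) * tilt (2 * u) z - 2 * tilt u z + 1" for z
    by (simp add: power2_diff tilt_square)
  have i1: "integrable P (\<lambda>z. exp (u^2 / T^2) * tilt (2 * u) z)" "integrable P (\<lambda>z. 2 * tilt u z)"
    using tilt_mean by auto
  show "integrable P (\<lambda>z. (tilt u z - 1)^2)"
    unfolding e using i1 by (intro Bochner_Integration.integrable_add Bochner_Integration.integrable_diff) auto
  have "(\<integral>z. (tilt u z - 1)^2 \<partial>P) = exp (u^2 / T^2) * (\<integral>z. tilt (2 * u) z \<partial>P) - 2 * (\<integral>z. tilt u z \<partial>P) + 1"
    unfolding e using i1 by (simp add: prob_space)
  then show "(\<integral>z. (tilt u z - 1)^2 \<partial>P) = exp (u^2 / T^2) - 1"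
    by (simp add: tilt_mean)
qed

lemma integral_translate:
  fixes h :: "('i \<Rightarrow> real) \<Rightarrow> real"
  assumes [measurable]: "h \<in> borel_measurable (Pi\<^sub>M I (\<lambda>_. borel))"
  shows "(\<integral>z. h (translate u z) \<partial>P) = (\<integral>z. tilt u z * h z \<partial>P)"
proof -
  have "(\<integral>z. h (translate u z) \<partial>P) = (\<integral>z. h z \<partial>distr P (Pi\<^sub>M I (\<lambda>_. borel)) (translate u))"
    by (subst integral_distr) auto
  also have "\<dots> = (\<integral>z. tilt u z * h z \<partial>P)"
    unfolding distr_translate using tilt_pos by (subst integral_density) (auto intro: less_imp_le)
  finally show ?thesis .
qed

lemma integral_N:
  fixes h :: "real \<Rightarrow> real"
  assumes [measurable]: "h \<in> borel_measurable borel"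
  shows "(\<integral>z. h (N z) \<partial>P) = (\<integral>y. h (T * y - T^2 / 2) \<partial>\<gamma>)"
proof -
  have "(\<integral>z. h (N z) \<partial>P) = (\<integral>z. h (T * ((\<Sum>i\<in>I. v i * z i) / sqrt S) - T^2 / 2) \<partial>P)"
    using S_pos by (simp add: N_def T_def)
  also have "\<dots> = (\<integral>y. h (T * y - T^2 / 2) \<partial>distr P borel (\<lambda>z. (\<Sum>i\<in>I. v i * z i) / sqrt S))"
    by (rule integral_distr[where f="\<lambda>y. h (T * y - T^2 / 2)", symmetric]) auto
  also have "distr P borel (\<lambda>z. (\<Sum>i\<in>I. v i * z i) / sqrt S) = \<gamma>"
    using gaussian_linear_form[OF finite_I v_pos] by (simp add: S_def)
  finally show ?thesis .
qed

lemma accept_int: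
  assumes [measurable]: "h \<in> borel_measurable (Pi\<^sub>M I (\<lambda>_. borel))"
  shows "integrable P (\<lambda>z. accept (h z))"
  by (rule finite_measure.integrable_const_bound[where B=1])
     (auto simp: accept_range abs_of_nonneg intro: prob_space.finite_measure prob_space_P)

lemma accept_increment:
  assumes [measurable]: "h \<in> borel_measurable (Pi\<^sub>M I (\<lambda>_. borel))"
  shows "integrable P (\<lambda>z. accept (h z) * (tilt u z - 1))"
    "(\<integral>z. accept (h (translate u z)) \<partial>P) - (\<integral>z. accept (h z) \<partial>P) = (\<integral>z. accept (h z) * (tilt u z - 1) \<partial>P)"
proof -
  have i: "integrable P (\<lambda>z. tilt u z * accept (h z))"
    by (rule Bochner_Integration.integrable_bound[OF tilt_mean(1)[of u]])
       (auto simp: accept_range abs_mult abs_of_nonneg tilt_pos less_imp_le mult_le_cancel_left1 not_less)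
  show "integrable P (\<lambda>z. accept (h z) * (tilt u z - 1))"
    using Bochner_Integration.integrable_diff[OF i accept_int[of h]] by (simp add: algebra_simps)
  show "(\<integral>z. accept (h (translate u z)) \<partial>P) - (\<integral>z. accept (h z) \<partial>P) = (\<integral>z. accept (h z) * (tilt u z - 1) \<partial>P)"
    unfolding integral_translate[of "\<lambda>z. accept (h z)" u, simplified]
    using Bochner_Integration.integral_diff[OF i accept_int[of h]] by (simp add: algebra_simps)
qed

text \<open>The translation moves \<open>N\<close> by exactly \<open>u\<close> and \<open>W\<close> by almost \<open>u\<close>. Turning it into a change of measure
  replaces the increments of the (non-smooth) expected acceptance by \<open>L\<^sup>2\<close> pairings with
  \<open>tilt u - 1\<close>, so that \<open>L\<^sup>2\<close> closeness of \<open>W\<close> and \<open>N\<close> carries over to the slope in \<open>u\<close>.\<close>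

lemma accept_perturbation:
  assumes W[measurable]: "W \<in> borel_measurable (Pi\<^sub>M I (\<lambda>_. borel))"
    and WN: "integrable P (\<lambda>z. (W z - N z)^2)" "(\<integral>z. (W z - N z)^2 \<partial>P) \<le> \<eta>^2" and \<eta>: "0 < \<eta>"
  shows "\<bar>(\<integral>z. accept (W z) \<partial>P) - 2 * cdf \<gamma> (- T / 2)\<bar> \<le> \<eta>"
    and "\<lbrakk>\<bar>u\<bar> \<le> 1; integrable P (\<lambda>z. W (translate u z) - W z - u);
      (\<integral>z. \<bar>W (translate u z) - W z - u\<bar> \<partial>P) \<le> \<beta> * \<bar>u\<bar>\<rbrakk> \<Longrightarrow>
      \<bar>(\<integral>z. accept (W z + u) \<partial>P) - (\<integral>z. accept (W z) \<partial>P) - u * cdf \<gamma> (- T / 2)\<bar>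
        \<le> \<bar>u\<bar> * (\<beta> + \<eta> * (exp (1 / T^2) / T) + (1 + 2 / T) * \<bar>u\<bar>)"
proof -
  interpret prob_space P by (rule prob_space_P)
  have WNi: "integrable P (\<lambda>z. W z - N z)" and WN1: "(\<integral>z. \<bar>W z - N z\<bar> \<partial>P) \<le> \<eta>"
    using L1_le_L2[of "\<lambda>z. W z - N z" \<eta>] WN \<eta> by auto
  have mean: "(\<integral>z. accept (N z) \<partial>P) = 2 * cdf \<gamma> (- T / 2)"
    using integral_N[of accept] accept_normal_mean[OF T_pos] by simp
  have "(\<integral>z. accept (W z) \<partial>P) - (\<integral>z. accept (N z) \<partial>P) = (\<integral>z. accept (W z) - accept (N z) \<partial>P)"
    by (intro Bochner_Integration.integral_diff[symmetric] accept_int) auto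
  then have "\<bar>(\<integral>z. accept (W z) \<partial>P) - (\<integral>z. accept (N z) \<partial>P)\<bar> \<le> (\<integral>z. \<bar>accept (W z) - accept (N z)\<bar> \<partial>P)"
    by (simp only: integral_abs_bound)
  also have "\<dots> \<le> (\<integral>z. \<bar>W z - N z\<bar> \<partial>P)"
    by (intro integral_mono accept_lipschitz integrable_abs[OF WNi] integrable_abs[OF Bochner_Integration.integrable_diff] accept_int) auto
  finally show "\<bar>(\<integral>z. accept (W z) \<partial>P) - 2 * cdf \<gamma> (- T / 2)\<bar> \<le> \<eta>"
    using WN1 mean by simp
  assume u: "\<bar>u\<bar> \<le> 1" and si: "integrable P (\<lambda>z. W (translate u z) - W z - u)"
    and sb: "(\<integral>z. \<bar>W (translate u z) - W z - u\<bar> \<partial>P) \<le> \<beta> * \<bar>u\<bar>"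
  show "\<bar>(\<integral>z. accept (W z + u) \<partial>P) - (\<integral>z. accept (W z) \<partial>P) - u * cdf \<gamma> (- T / 2)\<bar>
        \<le> \<bar>u\<bar> * (\<beta> + \<eta> * (exp (1 / T^2) / T) + (1 + 2 / T) * \<bar>u\<bar>)"
  \<comment> \<open>For \<open>u = 0\<close> both sides vanish; the case is split off because the
    Cauchy-Schwarz bound asks for a positive \<open>m\<close>.\<close>
  proof (cases "u = 0")
    case False
    \<comment> \<open>Bounds the L2 norm of \<open>tilt u - 1\<close>: with
      \<open>s = u^2 / T^2 \<le> 1 / T^2\<close> one has
      \<open>exp s - 1 \<le> s * exp (2 / T^2)\<close>. The point is that \<open>m\<close> is
      proportional to |u|.\<close>
    define m where "m = \<bar>u\<bar> * (exp (1 / T^2) / T)"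
    have m: "0 < m" using False T_pos by (simp add: m_def)
    have var: "(\<integral>z. (tilt u z - 1)^2 \<partial>P) \<le> m^2"
    proof -
      define s where "s = u^2 / T^2"
      have "u^2 \<le> 1" using u by (simp add: abs_square_le_1)
      then have s: "0 \<le> s" "s \<le> 1 / T^2" using T_pos by (auto simp: s_def divide_right_mono)
      have "exp s - 1 = exp s * (1 - exp (- s))" by (simp add: algebra_simps flip: exp_add)
      also have "\<dots> \<le> exp (2 * (1 / T^2)) * s"
      proof (intro mult_mono)
        show "1 - exp (- s) \<le> s" using exp_ge_add_one_self[of "- s"] by linarith
        show "exp s \<le> exp (2 * (1 / T^2))" using s by simp
      qed (use s in auto)
      also have "\<dots> = m^2"
        unfolding exp_double by (simp add: s_def m_def power_mult_distrib power_divide)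
      finally show ?thesis by (simp add: tilt_variance s_def)
    qed
    have A: "\<bar>(\<integral>z. accept (W z + u) \<partial>P) - (\<integral>z. accept (W (translate u z)) \<partial>P)\<bar> \<le> \<beta> * \<bar>u\<bar>"
    proof -
      have "(\<integral>z. accept (W z + u) \<partial>P) - (\<integral>z. accept (W (translate u z)) \<partial>P) = (\<integral>z. accept (W z + u) - accept (W (translate u z)) \<partial>P)"
        by (intro Bochner_Integration.integral_diff[symmetric] accept_int) auto
      then have "\<bar>(\<integral>z. accept (W z + u) \<partial>P) - (\<integral>z. accept (W (translate u z)) \<partial>P)\<bar>
        \<le> (\<integral>z. \<bar>accept (W z + u) - accept (W (translate u z))\<bar> \<partial>P)" by (simp only: integral_abs_bound)
      also have "\<dots> \<le> (\<integral>z. \<bar>W (translate u z) - W z - u\<bar> \<partial>P)"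
      proof (rule integral_mono)
        show "\<bar>accept (W z + u) - accept (W (translate u z))\<bar> \<le> \<bar>W (translate u z) - W z - u\<bar>" for z
          using accept_lipschitz[of "W z + u" "W (translate u z)"] by linarith
      qed (use si in \<open>auto intro!: integrable_abs Bochner_Integration.integrable_diff accept_int\<close>)
      finally show ?thesis using sb by simp
    qed
    \<comment> \<open>Here \<open>\<eta>\<close> is multiplied by \<open>m\<close>, so replacing
      \<open>W\<close> by \<open>N\<close> costs only order \<eta> |u|; comparing the two increments
      directly would cost order \<open>\<eta>\<close>.\<close>
    have B: "\<bar>(\<integral>z. accept (W z) * (tilt u z - 1) \<partial>P) - (\<integral>z. accept (N z) * (tilt u z - 1) \<partial>P)\<bar> \<le> \<eta> * m"
    proof -
      have "(\<integral>z. accept (W z) * (tilt u z - 1) \<partial>P) - (\<integral>z. accept (N z) * (tilt u z - 1) \<partial>P)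
        = (\<integral>z. accept (W z) * (tilt u z - 1) - accept (N z) * (tilt u z - 1) \<partial>P)"
        by (intro Bochner_Integration.integral_diff[symmetric] accept_increment) auto
      then have "\<bar>(\<integral>z. accept (W z) * (tilt u z - 1) \<partial>P) - (\<integral>z. accept (N z) * (tilt u z - 1) \<partial>P)\<bar>
        \<le> (\<integral>z. \<bar>accept (W z) * (tilt u z - 1) - accept (N z) * (tilt u z - 1)\<bar> \<partial>P)" by (simp only: integral_abs_bound)
      also have "\<dots> \<le> (\<integral>z. \<bar>(W z - N z) * (tilt u z - 1)\<bar> \<partial>P)"
      proof (rule integral_mono)
        show "integrable P (\<lambda>z. \<bar>(W z - N z) * (tilt u z - 1)\<bar>)"
          using WN tilt_variance by (intro integrable_abs integrable_mult_of_squares) auto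
        show "\<bar>accept (W z) * (tilt u z - 1) - accept (N z) * (tilt u z - 1)\<bar> \<le> \<bar>(W z - N z) * (tilt u z - 1)\<bar>" for z
          unfolding left_diff_distrib[symmetric] abs_mult by (intro mult_right_mono accept_lipschitz) auto
      qed (intro integrable_abs Bochner_Integration.integrable_diff accept_increment; simp)
      also have "\<dots> \<le> \<eta> * m"
        using WN \<eta> m var tilt_variance by (intro Cauchy_Schwarz_integral_le) auto
      finally show ?thesis .
    qed
    have C: "\<bar>(\<integral>z. accept (N z) * (tilt u z - 1) \<partial>P) - u * cdf \<gamma> (- T / 2)\<bar> \<le> (1 + 2 / T) * u^2"
    proof -
      have "(\<integral>z. accept (N z) * (tilt u z - 1) \<partial>P) = (\<integral>z. accept (N z + u) \<partial>P) - (\<integral>z. accept (N z) \<partial>P)"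
        using accept_increment(2)[of N u] by (simp add: N_translate)
      also have "\<dots> = (\<integral>z. accept (N z + u) - accept (N z) \<partial>P)"
        by (intro Bochner_Integration.integral_diff[symmetric] accept_int) auto
      also have "\<dots> = (\<integral>z. accept (T * z - T^2 / 2 + u) - accept (T * z - T^2 / 2) \<partial>\<gamma>)"
        by (rule integral_N[of "\<lambda>y. accept (y + u) - accept y"]) simp
      finally show ?thesis using accept_normal_expansion[OF T_pos u] by simp
    qed
    have "\<bar>(\<integral>z. accept (W z + u) \<partial>P) - (\<integral>z. accept (W z) \<partial>P) - u * cdf \<gamma> (- T / 2)\<bar>
      \<le> \<beta> * \<bar>u\<bar> + \<eta> * m + (1 + 2 / T) * u^2"
    proof -
      have sum: "\<bar>w1 - w0 - c\<bar> \<le> x + y + z" if "\<bar>w1 - w\<bar> \<le> x" "\<bar>p - q\<bar> \<le> y" "\<bar>q - c\<bar> \<le> z" "w - w0 = p"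
        for w1 w0 w c p q x y z :: real using that by linarith
      show ?thesis by (rule sum[OF A B C accept_increment(2)[OF W]])
    qed
    also have "\<dots> = \<bar>u\<bar> * (\<beta> + \<eta> * (exp (1 / T^2) / T) + (1 + 2 / T) * \<bar>u\<bar>)"
      by (simp add: m_def algebra_simps power2_eq_square)
    finally show ?thesis .
  qed simp
qed

end

section \<open>Taylor bounds for functions of exponential growth\<close>

lemma exp_growth_taylor:
  fixes f f1 f2 f3 :: "real \<Rightarrow> real"
  assumes c: "0 \<le> c"
    and d1: "\<And>x. (f has_real_derivative f1 x) (at x)" and b1: "\<And>x. \<bar>f1 x\<bar> \<le> B * exp (c * \<bar>x\<bar>)"
  shows exp_growth_taylor1: "\<bar>f (x + h) - f x\<bar> \<le> B * exp (c * (\<bar>x\<bar> + \<bar>h\<bar>)) * \<bar>h\<bar>"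
    and exp_growth_taylor2: "\<lbrakk>\<And>x. (f1 has_real_derivative f2 x) (at x); \<And>x. \<bar>f2 x\<bar> \<le> B * exp (c * \<bar>x\<bar>)\<rbrakk>
      \<Longrightarrow> \<bar>f (x + h) - f x - f1 x * h\<bar> \<le> B * exp (c * (\<bar>x\<bar> + \<bar>h\<bar>)) * h^2"
    and exp_growth_taylor3: "\<lbrakk>\<And>x. (f1 has_real_derivative f2 x) (at x); \<And>x. (f2 has_real_derivative f3 x) (at x);
        \<And>x. \<bar>f3 x\<bar> \<le> B * exp (c * \<bar>x\<bar>)\<rbrakk>
      \<Longrightarrow> \<bar>f (x + h) - f x - f1 x * h - f2 x * h^2 / 2\<bar> \<le> B * exp (c * (\<bar>x\<bar> + \<bar>h\<bar>)) * \<bar>h\<bar> ^ 3"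
proof -
  have B: "0 \<le> B" using order_trans[OF abs_ge_zero b1[of 0]] by simp
  let ?K = "\<lambda>h. B * exp (c * (\<bar>x\<bar> + \<bar>h\<bar>))"
  have K: "B * exp (c * \<bar>y\<bar>) \<le> ?K h" if "\<bar>y - x\<bar> \<le> \<bar>h\<bar>" for y h
    using that B c by (intro mult_left_mono exp_le_cancel_iff[THEN iffD2]) auto
  have mvt: "\<bar>g (x + h) - g x\<bar> \<le> M * \<bar>h\<bar>"
    if "\<And>y. (g has_real_derivative g' y) (at y)" "\<And>y. \<bar>y - x\<bar> \<le> \<bar>h\<bar> \<Longrightarrow> \<bar>g' y\<bar> \<le> M" for g g' :: "real \<Rightarrow> real" and h M
  proof -
    have "norm (g (x + h) - g x) \<le> M * norm (x + h - x)"
      using that by (intro field_differentiable_bound[where S="cball x \<bar>h\<bar>" and f'=g'])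
        (auto intro: has_field_derivative_at_within simp: dist_real_def abs_minus_commute)
    then show ?thesis by simp
  qed
  have t1: "\<bar>g (x + h) - g x\<bar> \<le> ?K h * \<bar>h\<bar>"
    if "\<And>y. (g has_real_derivative g' y) (at y)" "\<And>y. \<bar>g' y\<bar> \<le> B * exp (c * \<bar>y\<bar>)" for g g' h
    using mvt[of g g' h "?K h"] that K by (meson order_trans)
  have Kmono: "?K (y - x) * \<bar>y - x\<bar> ^ n \<le> ?K h * \<bar>h\<bar> ^ n" if "\<bar>y - x\<bar> \<le> \<bar>h\<bar>" for y h n
    using that B c by (intro mult_mono power_mono mult_left_mono exp_le_cancel_iff[THEN iffD2]) auto
  \<comment> \<open>Each order is the mean value inequality for the function minus its Taylor
    polynomial, with the preceding order bounding the derivative; so no factorials are gained. The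
    statement is generic in \<open>g\<close> because the third order applies it to
    \<open>f1\<close>.\<close>
  have t2: "\<bar>g (x + h) - g x - g' x * h\<bar> \<le> ?K h * h^2"
    if d: "\<And>y. (g has_real_derivative g' y) (at y)" "\<And>y. (g' has_real_derivative g'' y) (at y)"
      and b: "\<And>y. \<bar>g'' y\<bar> \<le> B * exp (c * \<bar>y\<bar>)" for g g' g'' h
  proof -
    have "\<bar>(g (x + h) - g' x * (x + h)) - (g x - g' x * x)\<bar> \<le> (?K h * \<bar>h\<bar>) * \<bar>h\<bar>"
    proof (rule mvt)
      show "((\<lambda>y. g y - g' x * y) has_real_derivative g' y - g' x) (at y)" for y
        by (auto intro!: derivative_eq_intros d)
      show "\<bar>g' y - g' x\<bar> \<le> ?K h * \<bar>h\<bar>" if "\<bar>y - x\<bar> \<le> \<bar>h\<bar>" for y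
        using t1[OF d(2) b, of "y - x"] Kmono[OF that, of 1] by simp
    qed
    then show ?thesis by (simp add: algebra_simps power2_eq_square)
  qed
  show "\<bar>f (x + h) - f x\<bar> \<le> ?K h * \<bar>h\<bar>" by (rule t1[OF d1 b1])
  show "\<bar>f (x + h) - f x - f1 x * h\<bar> \<le> ?K h * h^2"
    if "\<And>x. (f1 has_real_derivative f2 x) (at x)" "\<And>x. \<bar>f2 x\<bar> \<le> B * exp (c * \<bar>x\<bar>)"
    by (rule t2[OF d1 that])
  show "\<bar>f (x + h) - f x - f1 x * h - f2 x * h^2 / 2\<bar> \<le> ?K h * \<bar>h\<bar> ^ 3"
    if d2: "\<And>x. (f1 has_real_derivative f2 x) (at x)" and d3: "\<And>x. (f2 has_real_derivative f3 x) (at x)"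
      and b3: "\<And>x. \<bar>f3 x\<bar> \<le> B * exp (c * \<bar>x\<bar>)"
  proof -
    have "\<bar>(f (x + h) - f1 x * (x + h) - f2 x * (x + h - x)^2 / 2) - (f x - f1 x * x - f2 x * (x - x)^2 / 2)\<bar> \<le> (?K h * h^2) * \<bar>h\<bar>"
    proof (rule mvt)
      show "((\<lambda>y. f y - f1 x * y - f2 x * (y - x)^2 / 2) has_real_derivative f1 y - f1 x - f2 x * (y - x)) (at y)" for y
        by (auto intro!: derivative_eq_intros d1)
      show "\<bar>f1 y - f1 x - f2 x * (y - x)\<bar> \<le> ?K h * h^2" if "\<bar>y - x\<bar> \<le> \<bar>h\<bar>" for y
        using t2[OF d2 d3 b3, of "y - x"] Kmono[OF that, of 2] by simp
    qed
    then show ?thesis by (simp add: algebra_simps power2_eq_square power3_eq_cube)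
  qed
qed

lemma power_le_exp:
  fixes t :: real
  assumes "0 \<le> t"
  shows "t ^ n \<le> fact n * exp t"
proof -
  have "t ^ n / fact n = (\<Sum>k\<in>{n}. t ^ k /\<^sub>R fact k)"
    by (simp add: field_simps)
  also have "\<dots> \<le> (\<Sum>k. t ^ k /\<^sub>R fact k)"
    using assms exp_converges[of t] by (intro sum_le_suminf) (auto simp: sums_iff)
  also have "\<dots> = exp t" using exp_converges[of t] by (simp add: sums_iff)
  finally show ?thesis by (simp add: field_simps)
qed

lemma std_normal_exp_bound:
  fixes f :: "real \<Rightarrow> real"
  assumes [measurable]: "f \<in> borel_measurable borel" and f: "\<And>z. \<bar>f z\<bar> \<le> A * exp (c * \<bar>z\<bar>)"
  shows "integrable \<gamma> f"
    and "(\<integral>z. \<bar>f z\<bar> \<partial>\<gamma>) \<le> A * (2 * exp (c^2 / 2))"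
    and "\<bar>\<integral>z. f z \<partial>\<gamma>\<bar> \<le> A * (2 * exp (c^2 / 2))"
proof -
  have A: "0 \<le> A" using order_trans[OF abs_ge_zero f[of 0]] by simp
  have i: "integrable \<gamma> (\<lambda>z. A * exp (c * \<bar>z\<bar>))"
    using integrable_std_normal_exp_abs by simp
  show "integrable \<gamma> f"
    by (rule Bochner_Integration.integrable_bound[OF i]) (use f A in auto)
  then have "(\<integral>z. \<bar>f z\<bar> \<partial>\<gamma>) \<le> (\<integral>z. A * exp (c * \<bar>z\<bar>) \<partial>\<gamma>)"
    using i f by (intro integral_mono) auto
  also have "\<dots> = A * (\<integral>z. exp (c * \<bar>z\<bar>) \<partial>\<gamma>)"
    by simp
  also have "\<dots> \<le> A * (2 * exp (c^2 / 2))"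
    using A by (intro mult_left_mono integral_std_normal_exp_abs)
  finally show *: "(\<integral>z. \<bar>f z\<bar> \<partial>\<gamma>) \<le> A * (2 * exp (c^2 / 2))" .
  show "\<bar>\<integral>z. f z \<partial>\<gamma>\<bar> \<le> A * (2 * exp (c^2 / 2))"
    using integral_abs_bound[of \<gamma> f] * by linarith
qed

lemma std_normal_moments:
  shows "integrable \<gamma> (\<lambda>z. z)" "integrable \<gamma> (\<lambda>z. z^2)"
    and "(\<integral>z. z \<partial>\<gamma>) = 0" "(\<integral>z. z^2 \<partial>\<gamma>) = 1"
  using integrable_std_normal_distribution_moment[of 1] integrable_std_normal_distribution_moment[of 2]
    integral_std_normal_distribution_moment_odd[of 1] std_normal_distribution_even_moments(1)[of 1]
  by (simp_all add: fact_numeral)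

text \<open>The rate \<open>1/8\<close> is chosen so that the fourth power of \<open>V1\<close> is
  dominated by exp (|x| / 2), and so that two such factors times the rate \<open>1/2\<close> of a
  test function stay below exp |x|. The bound \<open>1 \<le> B\<close> allows powers of
  \<open>B\<close> to be raised.\<close>

locale smooth_potential =
  fixes V V1 V2 V3 :: "real \<Rightarrow> real" and B :: real
  assumes dV: "\<And>x. (V has_real_derivative V1 x) (at x)"
    and dV1: "\<And>x. (V1 has_real_derivative V2 x) (at x)"
    and dV2: "\<And>x. (V2 has_real_derivative V3 x) (at x)"
    and B1: "1 \<le> B"
    and bV1: "\<And>x. \<bar>V1 x\<bar> \<le> B * exp (1/8 * \<bar>x\<bar>)"
    and bV2: "\<And>x. \<bar>V2 x\<bar> \<le> B * exp (1/8 * \<bar>x\<bar>)"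
    and bV3: "\<And>x. \<bar>V3 x\<bar> \<le> B * exp (1/8 * \<bar>x\<bar>)"
begin

lemma V_meas[measurable]: "V \<in> borel_measurable borel"
  using dV by (intro borel_measurable_continuous_onI) (auto intro!: DERIV_continuous simp: continuous_on_eq_continuous_at)

lemmas taylor1 = exp_growth_taylor1[of "1/8", OF _ dV bV1, simplified]
lemmas taylor2 = exp_growth_taylor2[of "1/8", OF _ dV bV1 dV1 bV2, simplified]
lemmas taylor3 = exp_growth_taylor3[of "1/8", OF _ dV bV1 dV1 dV2 bV3, simplified]
lemmas taylor1' = exp_growth_taylor1[of "1/8", OF _ dV1 bV2, simplified]

text \<open>Compares the effect of a displacement \<open>\<delta>\<close> made after a step
  \<open>h\<close> with its linearisation at the starting point: a second-order Taylor error plus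
  the change of \<open>V1\<close> along the step.\<close>

lemma increment_bound:
  "\<bar>V (x + h + \<delta>) - V (x + h) - \<delta> * V1 x\<bar> \<le> \<bar>\<delta>\<bar> * (\<bar>h\<bar> + \<bar>\<delta>\<bar>) * (B * exp ((\<bar>x\<bar> + \<bar>h\<bar> + \<bar>\<delta>\<bar>) / 8))"
proof -
  have "\<bar>V (x + h + \<delta>) - V (x + h) - V1 (x + h) * \<delta>\<bar> \<le> B * exp ((\<bar>x + h\<bar> + \<bar>\<delta>\<bar>) / 8) * \<delta>^2"
    by (rule taylor2)
  also have "\<dots> \<le> B * exp ((\<bar>x\<bar> + \<bar>h\<bar> + \<bar>\<delta>\<bar>) / 8) * \<delta>^2"
    using B1 abs_triangle_ineq[of x h] by (intro mult_right_mono mult_left_mono) auto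
  finally have 1: "\<bar>V (x + h + \<delta>) - V (x + h) - V1 (x + h) * \<delta>\<bar> \<le> (B * exp ((\<bar>x\<bar> + \<bar>h\<bar> + \<bar>\<delta>\<bar>) / 8)) * (\<bar>\<delta>\<bar> * \<bar>\<delta>\<bar>)"
    by (simp add: power2_eq_square)
  have "\<bar>V1 (x + h) - V1 x\<bar> * \<bar>\<delta>\<bar> \<le> (B * exp ((\<bar>x\<bar> + \<bar>h\<bar>) / 8) * \<bar>h\<bar>) * \<bar>\<delta>\<bar>"
    by (intro mult_right_mono taylor1') auto
  also have "\<dots> \<le> (B * exp ((\<bar>x\<bar> + \<bar>h\<bar> + \<bar>\<delta>\<bar>) / 8) * \<bar>h\<bar>) * \<bar>\<delta>\<bar>"
    using B1 by (intro mult_right_mono mult_left_mono) auto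
  finally have 2: "\<bar>(V1 (x + h) - V1 x) * \<delta>\<bar> \<le> (B * exp ((\<bar>x\<bar> + \<bar>h\<bar> + \<bar>\<delta>\<bar>) / 8)) * (\<bar>h\<bar> * \<bar>\<delta>\<bar>)"
    by (simp add: abs_mult mult_ac)
  have "V (x + h + \<delta>) - V (x + h) - \<delta> * V1 x
    = (V (x + h + \<delta>) - V (x + h) - V1 (x + h) * \<delta>) + (V1 (x + h) - V1 x) * \<delta>"
    by (simp add: algebra_simps)
  from abs_triangle_ineq[of "V (x + h + \<delta>) - V (x + h) - V1 (x + h) * \<delta>" "(V1 (x + h) - V1 x) * \<delta>", folded this]
  have "\<bar>V (x + h + \<delta>) - V (x + h) - \<delta> * V1 x\<bar>
    \<le> (B * exp ((\<bar>x\<bar> + \<bar>h\<bar> + \<bar>\<delta>\<bar>) / 8)) * (\<bar>\<delta>\<bar> * \<bar>\<delta>\<bar>) + (B * exp ((\<bar>x\<bar> + \<bar>h\<bar> + \<bar>\<delta>\<bar>) / 8)) * (\<bar>h\<bar> * \<bar>\<delta>\<bar>)"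
    by (rule order_trans[OF _ add_mono[OF 1 2]])
  also have "\<dots> = \<bar>\<delta>\<bar> * (\<bar>h\<bar> + \<bar>\<delta>\<bar>) * (B * exp ((\<bar>x\<bar> + \<bar>h\<bar> + \<bar>\<delta>\<bar>) / 8))"
    by (simp add: algebra_simps)
  finally show ?thesis .
qed


section \<open>The log-density increment of the remaining coordinates\<close>

definition log_ratio :: "'i set \<Rightarrow> ('i \<Rightarrow> real) \<Rightarrow> real \<Rightarrow> ('i \<Rightarrow> real) \<Rightarrow> real" where
  "log_ratio I x \<sigma> z = (\<Sum>i\<in>I. V (x i + \<sigma> * z i) - V (x i))"

lemma log_ratio_meas[measurable]:
  "log_ratio I x \<sigma> \<in> borel_measurable (Pi\<^sub>M I (\<lambda>_. borel))"
  unfolding log_ratio_def[abs_def] by measurable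

text \<open>\<open>r\<close> is the contribution of one coordinate to \<open>W - N\<close>, with
  leading term \<open>\<sigma>^2 / 2 * (V2 x * z^2 + (V1 x)^2)\<close>. Its second moment, of order
  \<open>\<sigma>^4\<close>, is summable over the coordinates to order 1/d. Its mean, of order
  \<open>\<sigma>^2\<close>, would sum to a constant, so the leading part is kept explicitly in
  order to cancel between coordinates. The weight exp (|x| / 2) accommodates the fourth power of
  \<open>V1\<close>.\<close>

lemma one_step_bounds:
  fixes x \<sigma> l :: real
  assumes \<sigma>: "0 < \<sigma>" "\<sigma> \<le> l"
  defines "r \<equiv> \<lambda>z. V (x + \<sigma> * z) - V x - \<sigma> * V1 x * z + \<sigma>^2 * (V1 x)^2 / 2"
  shows "integrable \<gamma> (\<lambda>z. (r z)^2)"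
    and "(\<integral>z. (r z)^2 \<partial>\<gamma>) \<le> 9 * \<sigma>^4 * B^4 * (2 * exp ((2 * (l + 1))^2 / 2)) * exp (\<bar>x\<bar> / 2)"
    and "\<bar>(\<integral>z. r z \<partial>\<gamma>) - \<sigma>^2 / 2 * (V2 x + (V1 x)^2)\<bar>
      \<le> 6 * \<sigma>^3 * B * (2 * exp ((l + 1)^2 / 2)) * exp (\<bar>x\<bar> / 2)"
proof -
  interpret G: prob_space \<gamma> by (rule prob_space_std_normal)
  have e1: "exp ((\<bar>x\<bar> + \<bar>\<sigma> * z\<bar>) / 8) \<le> exp (\<bar>x\<bar> / 8) * exp (l * \<bar>z\<bar>)" for z
  proof -
    have "\<sigma> * \<bar>z\<bar> / 8 \<le> l * \<bar>z\<bar>"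
    proof -
      have "\<sigma> * \<bar>z\<bar> \<le> l * \<bar>z\<bar>" "0 \<le> \<sigma> * \<bar>z\<bar>" using \<sigma> by (auto intro: mult_right_mono)
      then show ?thesis by linarith
    qed
    then show ?thesis using \<sigma> by (simp add: abs_mult add_divide_distrib flip: exp_add)
  qed
  have z2: "\<bar>z\<bar>^2 \<le> 2 * exp \<bar>z\<bar>" and z3: "\<bar>z\<bar> ^ 3 \<le> 6 * exp \<bar>z\<bar>" for z :: real
    using power_le_exp[of "\<bar>z\<bar>" 2] power_le_exp[of "\<bar>z\<bar>" 3] by (simp_all add: fact_numeral)
  have el: "exp (l * \<bar>z\<bar>) * exp \<bar>z\<bar> = exp ((l + 1) * \<bar>z\<bar>)" for z
    by (simp add: distrib_right flip: exp_add)
  have rb: "\<bar>r z\<bar> \<le> (3 * \<sigma>^2 * B^2 * exp (\<bar>x\<bar> / 4)) * exp ((l + 1) * \<bar>z\<bar>)" for z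
  proof -
    have "\<bar>V (x + \<sigma> * z) - V x - V1 x * (\<sigma> * z)\<bar> \<le> B * exp ((\<bar>x\<bar> + \<bar>\<sigma> * z\<bar>) / 8) * (\<sigma> * z)^2"
      by (rule taylor2)
    also have "\<dots> \<le> B * (exp (\<bar>x\<bar> / 8) * exp (l * \<bar>z\<bar>)) * (\<sigma>^2 * (2 * exp \<bar>z\<bar>))"
      using e1 z2[of z] B1 by (intro mult_mono) (auto simp: power_mult_distrib intro: mult_left_mono)
    also have "\<dots> = 2 * \<sigma>^2 * B * exp (\<bar>x\<bar> / 8) * exp ((l + 1) * \<bar>z\<bar>)"
      by (simp flip: el)
    also have "\<dots> \<le> 2 * \<sigma>^2 * B^2 * exp (\<bar>x\<bar> / 4) * exp ((l + 1) * \<bar>z\<bar>)"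
      using B1 by (intro mult_mono) (auto simp: power2_eq_square)
    finally have 1: "\<bar>V (x + \<sigma> * z) - V x - V1 x * (\<sigma> * z)\<bar> \<le> 2 * (\<sigma>^2 * B^2 * exp (\<bar>x\<bar> / 4) * exp ((l + 1) * \<bar>z\<bar>))"
      by simp
    have "(V1 x)^2 \<le> (B * exp (1/8 * \<bar>x\<bar>))^2"
      using power_mono[OF bV1[of x] abs_ge_zero, of 2] by simp
    also have "\<dots> = B^2 * exp (\<bar>x\<bar> / 4)"
      by (simp add: power_mult_distrib power2_eq_square flip: exp_add)
    also have "\<dots> \<le> B^2 * exp (\<bar>x\<bar> / 4) * exp ((l + 1) * \<bar>z\<bar>)"
      using \<sigma> mult_left_mono[of 1 "exp ((l + 1) * \<bar>z\<bar>)" "B^2 * exp (\<bar>x\<bar> / 4)"] by simp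
    finally have "\<sigma>^2 * (V1 x)^2 \<le> \<sigma>^2 * (B^2 * exp (\<bar>x\<bar> / 4) * exp ((l + 1) * \<bar>z\<bar>))"
      by (intro mult_left_mono) auto
    moreover have "0 \<le> \<sigma>^2 * (V1 x)^2" by simp
    moreover have "r z = (V (x + \<sigma> * z) - V x - V1 x * (\<sigma> * z)) + \<sigma>^2 * (V1 x)^2 / 2"
      by (simp add: r_def)
    ultimately have "\<bar>r z\<bar> \<le> 3 * (\<sigma>^2 * (B^2 * exp (\<bar>x\<bar> / 4) * exp ((l + 1) * \<bar>z\<bar>)))"
      using 1 unfolding mult.assoc by linarith
    then show ?thesis by (simp only: mult.assoc)
  qed
  have r_meas[measurable]: "r \<in> borel_measurable borel" unfolding r_def by measurable
  have rb2: "\<bar>(r z)^2\<bar> \<le> (9 * \<sigma>^4 * B^4 * exp (\<bar>x\<bar> / 2)) * exp ((2 * (l + 1)) * \<bar>z\<bar>)" for z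
  proof -
    have "\<bar>r z\<bar>^2 \<le> ((3 * \<sigma>^2 * B^2 * exp (\<bar>x\<bar> / 4)) * exp ((l + 1) * \<bar>z\<bar>))^2"
      by (intro power_mono rb) auto
    also have "\<dots> = 9 * \<sigma>^4 * B^4 * (exp (\<bar>x\<bar> / 4))^2 * (exp ((l + 1) * \<bar>z\<bar>))^2"
      by (simp add: power_mult_distrib flip: power_mult)
    also have "(exp (\<bar>x\<bar> / 4))^2 = exp (\<bar>x\<bar> / 2)"
      by (simp add: power2_eq_square flip: exp_add)
    also have "(exp ((l + 1) * \<bar>z\<bar>))^2 = exp ((2 * (l + 1)) * \<bar>z\<bar>)"
      unfolding power2_eq_square exp_add[symmetric] by (simp add: algebra_simps)
    finally show ?thesis by simp
  qed
  show "integrable \<gamma> (\<lambda>z. (r z)^2)"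
    by (rule std_normal_exp_bound(1)[OF _ rb2]) simp
  show "(\<integral>z. (r z)^2 \<partial>\<gamma>) \<le> 9 * \<sigma>^4 * B^4 * (2 * exp ((2 * (l + 1))^2 / 2)) * exp (\<bar>x\<bar> / 2)"
    using std_normal_exp_bound(2)[OF _ rb2] by (simp add: mult_ac)
  define q where "q z = V (x + \<sigma> * z) - V x - V1 x * (\<sigma> * z) - V2 x * (\<sigma> * z)^2 / 2" for z
  have q_meas[measurable]: "q \<in> borel_measurable borel" unfolding q_def[abs_def] by measurable
  have qb: "\<bar>q z\<bar> \<le> (6 * \<sigma>^3 * B * exp (\<bar>x\<bar> / 2)) * exp ((l + 1) * \<bar>z\<bar>)" for z
  proof -
    have "\<bar>q z\<bar> \<le> B * exp ((\<bar>x\<bar> + \<bar>\<sigma> * z\<bar>) / 8) * \<bar>\<sigma> * z\<bar> ^ 3"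
      unfolding q_def by (rule taylor3)
    also have "\<dots> \<le> B * (exp (\<bar>x\<bar> / 2) * exp (l * \<bar>z\<bar>)) * (\<sigma>^3 * (6 * exp \<bar>z\<bar>))"
    proof (intro mult_mono)
      show "exp ((\<bar>x\<bar> + \<bar>\<sigma> * z\<bar>) / 8) \<le> exp (\<bar>x\<bar> / 2) * exp (l * \<bar>z\<bar>)"
        using e1[of z] by (rule order_trans) (simp add: mult_right_mono)
      show "\<bar>\<sigma> * z\<bar> ^ 3 \<le> \<sigma>^3 * (6 * exp \<bar>z\<bar>)"
        using \<sigma> z3[of z] by (simp add: abs_mult power_mult_distrib)
    qed (use B1 \<sigma> in auto)
    also have "\<dots> = (6 * \<sigma>^3 * B * exp (\<bar>x\<bar> / 2)) * exp ((l + 1) * \<bar>z\<bar>)"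
      by (simp flip: el)
    finally show ?thesis .
  qed
  note m = std_normal_moments
  have qi: "integrable \<gamma> q" by (rule std_normal_exp_bound(1)[OF _ qb]) simp
  have "r z = q z + (V2 x * \<sigma>^2 / 2) * z^2 + \<sigma>^2 * (V1 x)^2 / 2" for z
    by (simp add: r_def q_def power_mult_distrib)
  then have "(\<integral>z. r z \<partial>\<gamma>)
    = (\<integral>z. q z + (V2 x * \<sigma>^2 / 2) * z^2 + \<sigma>^2 * (V1 x)^2 / 2 \<partial>\<gamma>)"
    by simp
  also have "\<dots> = (\<integral>z. q z \<partial>\<gamma>) + (V2 x * \<sigma>^2 / 2) * 1 + \<sigma>^2 * (V1 x)^2 / 2"
    using qi m G.prob_space by simp
  finally have "(\<integral>z. r z \<partial>\<gamma>) - \<sigma>^2 / 2 * (V2 x + (V1 x)^2) = (\<integral>z. q z \<partial>\<gamma>)"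
    by (simp add: algebra_simps)
  then show "\<bar>(\<integral>z. r z \<partial>\<gamma>) - \<sigma>^2 / 2 * (V2 x + (V1 x)^2)\<bar>
      \<le> 6 * \<sigma>^3 * B * (2 * exp ((l + 1)^2 / 2)) * exp (\<bar>x\<bar> / 2)"
    using std_normal_exp_bound(3)[OF _ qb] by (simp add: mult_ac)
qed

text \<open>The bound has two small factors, |\<delta>| and \<open>\<sigma>\<close>: displacements
  of order |u| / n in about \<open>n\<close> coordinates add up to order |u|
  \<open>\<sigma>\<close>, as required of a translation error. The restriction of \<delta> to size
  \<open>\<sigma> * b\<close> keeps the exponential weight bounded.\<close>

lemma increment_mean_bound:
  fixes x \<sigma> l b \<delta> :: real
  assumes \<sigma>: "0 < \<sigma>" "\<sigma> \<le> l" and b: "0 \<le> b" and \<delta>: "\<bar>\<delta>\<bar> \<le> \<sigma> * b"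
  defines "q \<equiv> \<lambda>z. V (x + \<sigma> * z + \<delta>) - V (x + \<sigma> * z) - \<delta> * V1 x"
  shows "integrable \<gamma> q"
    and "(\<integral>z. \<bar>q z\<bar> \<partial>\<gamma>)
      \<le> \<bar>\<delta>\<bar> * \<sigma> * (1 + b) * exp (l * b) * B * (2 * exp ((l + 1)^2 / 2)) * exp (\<bar>x\<bar> / 8)"
proof -
  have q_meas[measurable]: "q \<in> borel_measurable borel" unfolding q_def by measurable
  have qb: "\<bar>q z\<bar> \<le> (\<bar>\<delta>\<bar> * \<sigma> * (1 + b) * exp (l * b) * B * exp (\<bar>x\<bar> / 8)) * exp ((l + 1) * \<bar>z\<bar>)" for z
  proof -
    have a: "\<bar>\<sigma> * z\<bar> + \<bar>\<delta>\<bar> \<le> \<sigma> * (1 + b) * exp \<bar>z\<bar>"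
    proof -
      have "\<bar>z\<bar> + b \<le> (1 + b) * exp \<bar>z\<bar>"
      proof -
        have "\<bar>z\<bar> \<le> exp \<bar>z\<bar>" "b * 1 \<le> b * exp \<bar>z\<bar>"
          using exp_ge_add_one_self[of "\<bar>z\<bar>"] b by (linarith, intro mult_left_mono) auto
        then show ?thesis by (simp add: distrib_right)
      qed
      then have "\<sigma> * (\<bar>z\<bar> + b) \<le> \<sigma> * ((1 + b) * exp \<bar>z\<bar>)" using \<sigma> by (intro mult_left_mono) auto
      then show ?thesis
        using \<delta> unfolding abs_mult abs_of_pos[OF \<sigma>(1)] mult.assoc distrib_left[of \<sigma> "\<bar>z\<bar>" b] by linarith
    qed
    have ex: "exp ((\<bar>x\<bar> + \<bar>\<sigma> * z\<bar> + \<bar>\<delta>\<bar>) / 8) \<le> exp (\<bar>x\<bar> / 8) * exp (l * \<bar>z\<bar>) * exp (l * b)"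
    proof -
      have "\<sigma> * \<bar>z\<bar> \<le> l * \<bar>z\<bar>" "0 \<le> \<sigma> * \<bar>z\<bar>" "\<sigma> * b \<le> l * b" "0 \<le> \<sigma> * b"
        using \<sigma> b by (auto intro: mult_right_mono)
      then have "(\<sigma> * \<bar>z\<bar>) / 8 \<le> l * \<bar>z\<bar>" "\<bar>\<delta>\<bar> / 8 \<le> l * b"
        using \<delta> by linarith+
      then have "(\<bar>x\<bar> + \<bar>\<sigma> * z\<bar> + \<bar>\<delta>\<bar>) / 8 \<le> \<bar>x\<bar> / 8 + l * \<bar>z\<bar> + l * b"
        unfolding abs_mult abs_of_pos[OF \<sigma>(1)] add_divide_distrib by (intro add_mono order_refl)
      then show ?thesis by (simp flip: exp_add)
    qed
    have "\<bar>q z\<bar> \<le> \<bar>\<delta>\<bar> * (\<bar>\<sigma> * z\<bar> + \<bar>\<delta>\<bar>) * (B * exp ((\<bar>x\<bar> + \<bar>\<sigma> * z\<bar> + \<bar>\<delta>\<bar>) / 8))"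
      unfolding q_def by (rule increment_bound)
    also have "\<dots> \<le> \<bar>\<delta>\<bar> * (\<sigma> * (1 + b) * exp \<bar>z\<bar>) * (B * (exp (\<bar>x\<bar> / 8) * exp (l * \<bar>z\<bar>) * exp (l * b)))"
      by (rule mult_mono[OF mult_left_mono[OF a] mult_left_mono[OF ex]]) (use B1 \<sigma> b in auto)
    also have "\<dots> = (\<bar>\<delta>\<bar> * \<sigma> * (1 + b) * exp (l * b) * B * exp (\<bar>x\<bar> / 8)) * exp ((l + 1) * \<bar>z\<bar>)"
      by (simp add: distrib_right exp_add)
    finally show ?thesis .
  qed
  show "integrable \<gamma> q" by (rule std_normal_exp_bound(1)[OF _ qb]) simp
  show "(\<integral>z. \<bar>q z\<bar> \<partial>\<gamma>)
      \<le> \<bar>\<delta>\<bar> * \<sigma> * (1 + b) * exp (l * b) * B * (2 * exp ((l + 1)^2 / 2)) * exp (\<bar>x\<bar> / 8)"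
    using std_normal_exp_bound(2)[OF _ qb] by (simp add: mult_ac)
qed


text \<open>The point enters only through three inequalities on empirical sums, which makes the
  constant uniform in the point and in the dimension. \<open>n\<close> is the scale of the step and
  not the cardinality of \<open>I\<close>: in the application it is \<open>d\<close>, while
  \<open>I\<close> has \<open>d - 1\<close> elements. \<open>k\<close> bounds the empirical bias and
  also absorbs \<open>1 / sqrt n\<close>.\<close>

lemma accept_log_ratio:
  fixes l s0 K :: real
  assumes l: "0 < l" and s0: "0 < s0" and K: "0 \<le> K"
  obtains C where "0 < C" and
    "\<And>(I :: 'i set) x n k \<sigma> u. \<lbrakk>finite I; I \<noteq> {}; 1 \<le> n; \<sigma> = l / sqrt n; 1 / sqrt n \<le> k;
       s0 * n \<le> (\<Sum>i\<in>I. (V1 (x i))^2); \<bar>\<Sum>i\<in>I. V2 (x i) + (V1 (x i))^2\<bar> \<le> k * n;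
       (\<Sum>i\<in>I. exp (\<bar>x i\<bar> / 2)) \<le> K * n\<rbrakk> \<Longrightarrow>
     \<bar>(\<integral>z. accept (log_ratio I x \<sigma> z) \<partial>Pi\<^sub>M I (\<lambda>_. \<gamma>))
        - 2 * cdf \<gamma> (- (\<sigma> * sqrt (\<Sum>i\<in>I. (V1 (x i))^2)) / 2)\<bar> \<le> C * k \<and>
     \<bar>(\<integral>z. accept (log_ratio I x \<sigma> z + u) \<partial>Pi\<^sub>M I (\<lambda>_. \<gamma>))
        - (\<integral>z. accept (log_ratio I x \<sigma> z) \<partial>Pi\<^sub>M I (\<lambda>_. \<gamma>))
        - u * cdf \<gamma> (- (\<sigma> * sqrt (\<Sum>i\<in>I. (V1 (x i))^2)) / 2)\<bar>
      \<le> C * \<bar>u\<bar> * (k + \<bar>u\<bar>)"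
proof -
  define g1 where "g1 = 2 * exp ((2 * (l + 1))^2 / 2)"
  define g2 where "g2 = 2 * exp ((l + 1)^2 / 2)"
  \<comment> \<open>\<open>c1 / n\<close> will bound the summed second moments of the coordinatewise
    discrepancies and \<open>c2 * k\<close> their total mean, so that \<open>E * k\<close> bounds
    \<open>W - N\<close> in L2. \<open>c3\<close> controls the translation error, and
    \<open>T0\<close> bounds \<open>T\<close> from below.\<close>
  define c1 where "c1 = 9 * B^4 * g1 * K * l^4"
  define c2 where "c2 = l^2 / 2 + 6 * l^3 * B * g2 * K"
  define E where "E = sqrt (c1 + c2^2)"
  define b where "b = 1 / (l * sqrt s0)"
  define c3 where "c3 = B / s0 * l * (1 + b) * exp (l * b) * B * g2 * K"
  define T0 where "T0 = l * sqrt s0"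
  define C where "C = E + c3 + E * (exp (1 / T0^2) / T0) + (1 + 2 / T0) + 2"
  have g: "0 < g1" "0 < g2" by (auto simp: g1_def g2_def)
  have B0: "0 < B" using B1 by simp
  have b0: "0 < b" and T0: "0 < T0" using l s0 by (auto simp: b_def T0_def)
  have c: "0 \<le> c1" "0 < c2" "0 \<le> c3"
    using g B0 K l s0 b0 by (auto simp: c1_def c2_def c3_def intro!: add_pos_nonneg)
  have E: "0 < E" using c by (simp add: E_def add_nonneg_pos)
  have C: "E \<le> C" "c3 + E * (exp (1 / T0^2) / T0) \<le> C" "1 + 2 / T0 \<le> C" "2 \<le> C"
    "c3 + E * (exp (1 / T0^2) / T0) + (1 + 2 / T0) \<le> C"
    using c E T0 by (auto simp: C_def)
  then have "0 < C" by linarith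
  show thesis
  proof (rule that[OF \<open>0 < C\<close>])
    fix I :: "'i set" and x n k \<sigma> u
    assume fin: "finite I" and ne: "I \<noteq> {}" and n: "1 \<le> n" and \<sigma>: "\<sigma> = l / sqrt n" and k: "1 / sqrt n \<le> k"
      and H1: "s0 * n \<le> (\<Sum>i\<in>I. (V1 (x i))^2)" and H2: "\<bar>\<Sum>i\<in>I. V2 (x i) + (V1 (x i))^2\<bar> \<le> k * n"
      and H3: "(\<Sum>i\<in>I. exp (\<bar>x i\<bar> / 2)) \<le> K * n"
    have \<sigma>0: "0 < \<sigma>" "\<sigma> \<le> l" using n l by (auto simp: \<sigma> field_simps)
    have \<sigma>2: "\<sigma>^2 * n = l^2" using n by (simp add: \<sigma> power_divide)
    have k0: "0 < k" using k n by (smt (verit) divide_pos_pos real_sqrt_gt_zero)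
    have sn: "0 \<le> s0 * n" "0 < s0 * n" using s0 n by auto
    interpret gaussian_linear I "\<lambda>i. V1 (x i)" \<sigma>
      using fin \<sigma>0 H1 sn by unfold_locales auto
    interpret prob_space P by (rule prob_space_P)
      let ?W = "log_ratio I x \<sigma>"
    define r where "r i z = V (x i + \<sigma> * z) - V (x i) - \<sigma> * V1 (x i) * z + \<sigma>^2 * (V1 (x i))^2 / 2" for i z
    have r_meas[measurable]: "r i \<in> borel_measurable borel" for i unfolding r_def[abs_def] by measurable
    have WN: "?W z - N z = (\<Sum>i\<in>I. r i (z i))" for z
      by (simp add: log_ratio_def N_def r_def T_sq S_def sum.distrib sum_subtractf sum_distrib_left sum_divide_distrib mult.assoc)
    have i2: "integrable P (\<lambda>z. (?W z - N z)^2)"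
      unfolding WN using one_step_bounds(1)[OF \<sigma>0] fin prob_space_std_normal
      by (intro second_moment_sum(1)) (auto simp: r_def)
    have "(\<integral>z. (?W z - N z)^2 \<partial>P) \<le> (\<Sum>i\<in>I. \<integral>z. (r i z)^2 \<partial>\<gamma>) + (\<Sum>i\<in>I. \<integral>z. r i z \<partial>\<gamma>)^2"
      unfolding WN using one_step_bounds(1)[OF \<sigma>0] fin prob_space_std_normal
      by (intro second_moment_sum(2)) (auto simp: r_def)
    also have "\<dots> \<le> c1 / n + (c2 * k)^2"
    proof (rule add_mono)
      have "(\<Sum>i\<in>I. \<integral>z. (r i z)^2 \<partial>\<gamma>) \<le> (\<Sum>i\<in>I. (9 * \<sigma>^4 * B^4 * g1) * exp (\<bar>x i\<bar> / 2))"
        unfolding r_def g1_def by (intro sum_mono one_step_bounds \<sigma>0)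
      also have "\<dots> = (9 * \<sigma>^4 * B^4 * g1) * (\<Sum>i\<in>I. exp (\<bar>x i\<bar> / 2))" by (simp only: sum_distrib_left)
      also have "\<dots> \<le> (9 * \<sigma>^4 * B^4 * g1) * (K * n)"
        using H3 B0 g \<sigma>0 by (intro mult_left_mono) auto
      also have "\<dots> = c1 / n"
        using n by (simp add: \<sigma> c1_def power_divide) (simp add: field_simps power4_eq_xxxx)
      finally show "(\<Sum>i\<in>I. \<integral>z. (r i z)^2 \<partial>\<gamma>) \<le> c1 / n" .
      \<comment> \<open>Only the third-order remainder is estimated coordinate by coordinate; the
        leading term stays inside the sum, where the assumption on the empirical sum of
        \<open>V2 + V1^2\<close> applies.\<close>
      have "\<bar>(\<Sum>i\<in>I. \<integral>z. r i z \<partial>\<gamma>) - \<sigma>^2 / 2 * (\<Sum>i\<in>I. V2 (x i) + (V1 (x i))^2)\<bar>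
        = \<bar>\<Sum>i\<in>I. (\<integral>z. r i z \<partial>\<gamma>) - \<sigma>^2 / 2 * (V2 (x i) + (V1 (x i))^2)\<bar>"
        by (simp only: sum_subtractf sum_distrib_left)
      also have "\<dots> \<le> (\<Sum>i\<in>I. \<bar>(\<integral>z. r i z \<partial>\<gamma>) - \<sigma>^2 / 2 * (V2 (x i) + (V1 (x i))^2)\<bar>)"
        by (rule sum_abs)
      also have "\<dots> \<le> (\<Sum>i\<in>I. (6 * \<sigma>^3 * B * g2) * exp (\<bar>x i\<bar> / 2))"
        unfolding r_def g2_def by (intro sum_mono one_step_bounds \<sigma>0)
      also have "\<dots> = (6 * \<sigma>^3 * B * g2) * (\<Sum>i\<in>I. exp (\<bar>x i\<bar> / 2))" by (simp only: sum_distrib_left)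
      also have "\<dots> \<le> (6 * \<sigma>^3 * B * g2) * (K * n)"
        using H3 B0 g \<sigma>0 by (intro mult_left_mono) auto
      also have "\<dots> = (6 * l^3 * B * g2 * K) * (1 / sqrt n)"
        using n by (simp add: \<sigma> power_divide power3_eq_cube field_simps)
      also have "\<dots> \<le> (6 * l^3 * B * g2 * K) * k"
        using k l B0 g K by (intro mult_left_mono) auto
      finally have m1: "\<bar>(\<Sum>i\<in>I. \<integral>z. r i z \<partial>\<gamma>) - \<sigma>^2 / 2 * (\<Sum>i\<in>I. V2 (x i) + (V1 (x i))^2)\<bar> \<le> (6 * l^3 * B * g2 * K) * k" .
      have "\<bar>\<sigma>^2 / 2 * (\<Sum>i\<in>I. V2 (x i) + (V1 (x i))^2)\<bar> = \<sigma>^2 / 2 * \<bar>\<Sum>i\<in>I. V2 (x i) + (V1 (x i))^2\<bar>"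
        by (simp add: abs_mult)
      also have "\<dots> \<le> \<sigma>^2 / 2 * (k * n)"
        using H2 by (intro mult_left_mono) auto
      also have "\<dots> = l^2 / 2 * k" using \<sigma>2 by (simp add: algebra_simps)
      finally have "\<bar>\<Sum>i\<in>I. \<integral>z. r i z \<partial>\<gamma>\<bar> \<le> l^2 / 2 * k + (6 * l^3 * B * g2 * K) * k"
        using m1 by linarith
      also have "\<dots> = c2 * k" by (simp add: c2_def distrib_right)
      finally have "\<bar>\<Sum>i\<in>I. \<integral>z. r i z \<partial>\<gamma>\<bar>^2 \<le> (c2 * k)^2" by (intro power_mono) auto
      then show "(\<Sum>i\<in>I. \<integral>z. r i z \<partial>\<gamma>)^2 \<le> (c2 * k)^2" by simp
    qed
    also have "\<dots> \<le> (E * k)^2"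
    proof -
      have "1 / n = (1 / sqrt n)^2" using n by (simp add: power_divide)
      also have "\<dots> \<le> k^2" using k n by (intro power_mono) auto
      finally have "c1 * (1 / n) \<le> c1 * k^2" using c by (intro mult_left_mono) auto
      then show ?thesis using c by (simp add: E_def power_mult_distrib distrib_right)
    qed
    finally have \<eta>: "(\<integral>z. (?W z - N z)^2 \<partial>P) \<le> (E * k)^2" .
    have T: "T = \<sigma> * sqrt (\<Sum>i\<in>I. (V1 (x i))^2)" by (simp add: T_def S_def)
    have Ek: "0 < E * k" using E k0 by simp
    \<comment> \<open>A lower bound on \<open>T\<close> keeps the factors
      \<open>exp (1 / T^2) / T\<close> and \<open>2 / T\<close> of the perturbation bound uniformly
      bounded.\<close>
    have TT0: "T0 \<le> T"
    proof -
      have "T0 = \<sigma> * sqrt (s0 * n)" using n by (simp add: T0_def \<sigma> real_sqrt_mult)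
      also have "\<dots> \<le> T" unfolding T using H1 \<sigma>0 by (intro mult_left_mono) auto
      finally show ?thesis .
    qed
    have first: "\<bar>(\<integral>z. accept (?W z) \<partial>P) - 2 * cdf \<gamma> (- T / 2)\<bar> \<le> C * k"
    proof -
      have "\<bar>(\<integral>z. accept (?W z) \<partial>P) - 2 * cdf \<gamma> (- T / 2)\<bar> \<le> E * k"
        by (rule accept_perturbation(1)[OF _ i2 \<eta> Ek]) simp
      also have "\<dots> \<le> C * k" using C k0 by (intro mult_right_mono) auto
      finally show ?thesis .
    qed
    have second: "\<bar>(\<integral>z. accept (?W z + u) \<partial>P) - (\<integral>z. accept (?W z) \<partial>P) - u * cdf \<gamma> (- T / 2)\<bar> \<le> C * \<bar>u\<bar> * (k + \<bar>u\<bar>)"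
    \<comment> \<open>For |u| > 1 the Lipschitz property suffices: the left side is at most 2 |u|,
      and \<open>C\<close> is at least \<open>2\<close>.\<close>
    proof (cases "\<bar>u\<bar> \<le> 1")
      case True
      \<comment> \<open>The displacement of \<open>x i + \<sigma> * z i\<close> caused by
        \<open>translate u\<close>.\<close>
      define \<delta> where "\<delta> i = \<sigma> * (u / (\<sigma> * S) * V1 (x i))" for i
      define q where "q i z = V (x i + \<sigma> * z + \<delta> i) - V (x i + \<sigma> * z) - \<delta> i * V1 (x i)" for i z
      have q_meas[measurable]: "q i \<in> borel_measurable borel" for i unfolding q_def[abs_def] by measurable
      have Sn: "s0 * n \<le> S" using H1 by (simp add: S_def)
      have \<delta>: "\<delta> i = u * V1 (x i) / S" for i using \<sigma>0 by (simp add: \<delta>_def)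
      have d1: "\<bar>\<delta> i\<bar> \<le> \<sigma> * b" if "i \<in> I" for i
      proof -
        have "(V1 (x i))^2 \<le> S" unfolding S_def using that fin by (intro member_le_sum) auto
        then have "\<bar>V1 (x i)\<bar> \<le> sqrt S" by (intro real_le_rsqrt) simp
        then have "\<bar>u\<bar> * \<bar>V1 (x i)\<bar> \<le> 1 * sqrt S" using True by (intro mult_mono) auto
        then have "\<bar>\<delta> i\<bar> \<le> sqrt S / S" unfolding \<delta> using S_pos by (simp add: abs_mult divide_right_mono)
        also have "\<dots> = 1 / sqrt S" using S_pos by (simp add: field_simps)
        also have "\<dots> \<le> 1 / sqrt (s0 * n)" using Sn sn S_pos by (intro divide_left_mono) auto
        also have "\<dots> = \<sigma> * b" using l by (simp add: \<sigma> b_def real_sqrt_mult)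
        finally show ?thesis .
      qed
      have d2: "\<bar>\<delta> i\<bar> \<le> \<bar>u\<bar> * B * exp (\<bar>x i\<bar> / 8) / (s0 * n)" for i
      proof -
        have "\<bar>\<delta> i\<bar> = \<bar>u\<bar> * \<bar>V1 (x i)\<bar> / S" unfolding \<delta> using S_pos by (simp add: abs_mult)
        also have "\<dots> \<le> \<bar>u\<bar> * (B * exp (\<bar>x i\<bar> / 8)) / (s0 * n)"
          using bV1[of "x i"] Sn sn B0 by (intro frac_le mult_left_mono) auto
        finally show ?thesis by (simp add: mult.assoc)
      qed
      have qi: "integrable \<gamma> (q i)" if "i \<in> I" for i
        using increment_mean_bound(1)[OF \<sigma>0 less_imp_le[OF b0] d1[OF that], of "x i"] by (simp add: q_def[abs_def])
      \<comment> \<open>One weight exp (|x i| / 8) comes from \<open>V1\<close> inside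
        \<open>\<delta> i\<close>, the other from the increment bound; together they stay below exp
        (|x i| / 2).\<close>
      have qb: "(\<integral>z. \<bar>q i z\<bar> \<partial>\<gamma>) \<le> (c3' * \<bar>u\<bar> * \<sigma> / n) * exp (\<bar>x i\<bar> / 2)"
        if i: "i \<in> I" and c3': "c3' = B / s0 * (1 + b) * exp (l * b) * B * g2" for i c3'
      proof -
        have "(\<integral>z. \<bar>q i z\<bar> \<partial>\<gamma>) \<le> \<bar>\<delta> i\<bar> * \<sigma> * (1 + b) * exp (l * b) * B * g2 * exp (\<bar>x i\<bar> / 8)"
          using increment_mean_bound(2)[OF \<sigma>0 less_imp_le[OF b0] d1[OF i], of "x i"] by (simp add: q_def g2_def)
        also have "\<dots> \<le> (\<bar>u\<bar> * B * exp (\<bar>x i\<bar> / 8) / (s0 * n)) * \<sigma> * (1 + b) * exp (l * b) * B * g2 * exp (\<bar>x i\<bar> / 8)"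
          using d2[of i] \<sigma>0 b0 B0 g by (intro mult_right_mono) auto
        also have "\<dots> = (c3' * \<bar>u\<bar> * \<sigma> / n) * (exp (\<bar>x i\<bar> / 8) * exp (\<bar>x i\<bar> / 8))"
          using n s0 by (simp add: c3' field_simps)
        also have "\<dots> \<le> (c3' * \<bar>u\<bar> * \<sigma> / n) * exp (\<bar>x i\<bar> / 2)"
          using n s0 b0 B0 g \<sigma>0 by (intro mult_left_mono) (auto simp: c3' simp flip: exp_add)
        finally show ?thesis .
      qed
      \<comment> \<open>The linearised displacements \<open>\<delta> i * V1 (x i)\<close> sum to
        exactly \<open>u\<close>, so \<open>u\<close> can be distributed over the coordinates and
        only second-order errors remain.\<close>
      have id: "?W (translate u z) - ?W z - u = (\<Sum>i\<in>I. q i (z i))" for z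
      proof -
        have "(\<Sum>i\<in>I. \<delta> i * V1 (x i)) = (u / S) * (\<Sum>i\<in>I. (V1 (x i))^2)"
          unfolding sum_distrib_left by (intro sum.cong) (auto simp: \<delta> power2_eq_square)
        also have "\<dots> = u" using S_pos by (simp add: S_def)
        finally have u: "u = (\<Sum>i\<in>I. \<delta> i * V1 (x i))" by simp
        have "?W (translate u z) = (\<Sum>i\<in>I. V (x i + \<sigma> * z i + \<delta> i) - V (x i))"
          unfolding log_ratio_def by (intro sum.cong refl) (simp add: translate_def \<delta>_def distrib_left add.assoc)
        then show ?thesis by (subst (2) u) (simp add: log_ratio_def q_def sum_subtractf)
      qed
      have qP: "integrable P (\<lambda>z. q i (z i))" "(\<integral>z. \<bar>q i (z i)\<bar> \<partial>P) = (\<integral>z. \<bar>q i z\<bar> \<partial>\<gamma>)" if "i \<in> I" for i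
        using integrable_PiM_component[of "\<lambda>_. \<gamma>" i I "q i"] integral_PiM_component[of "\<lambda>_. \<gamma>" i I "\<lambda>z. \<bar>q i z\<bar>"]
          that prob_space_std_normal qi[OF that] by auto
      let ?c = "B / s0 * (1 + b) * exp (l * b) * B * g2 * \<bar>u\<bar> * \<sigma> / n"
      have "(\<integral>z. \<bar>?W (translate u z) - ?W z - u\<bar> \<partial>P) \<le> (\<integral>z. (\<Sum>i\<in>I. \<bar>q i (z i)\<bar>) \<partial>P)"
        unfolding id using qP
        by (intro integral_mono sum_abs integrable_abs Bochner_Integration.integrable_sum) auto
      also have "\<dots> = (\<Sum>i\<in>I. \<integral>z. \<bar>q i (z i)\<bar> \<partial>P)"
        using qP by (intro Bochner_Integration.integral_sum integrable_abs) auto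
      also have "\<dots> \<le> (\<Sum>i\<in>I. ?c * exp (\<bar>x i\<bar> / 2))"
        by (intro sum_mono) (simp only: qP qb)
      also have "\<dots> = ?c * (\<Sum>i\<in>I. exp (\<bar>x i\<bar> / 2))"
        by (simp only: sum_distrib_left)
      also have "\<dots> \<le> ?c * (K * n)"
        using H3 n s0 b0 B0 g \<sigma>0 by (intro mult_left_mono) auto
      also have "\<dots> = c3 * \<bar>u\<bar> * (1 / sqrt n)"
        using n by (simp add: c3_def \<sigma>)
      also have "\<dots> \<le> c3 * \<bar>u\<bar> * k"
        using c k by (intro mult_left_mono) auto
      finally have b: "(\<integral>z. \<bar>?W (translate u z) - ?W z - u\<bar> \<partial>P) \<le> (c3 * k) * \<bar>u\<bar>" by (simp add: mult_ac)
      have si: "integrable P (\<lambda>z. ?W (translate u z) - ?W z - u)"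
        unfolding id using qP by (intro Bochner_Integration.integrable_sum) auto
      have "\<bar>(\<integral>z. accept (?W z + u) \<partial>P) - (\<integral>z. accept (?W z) \<partial>P) - u * cdf \<gamma> (- T / 2)\<bar>
        \<le> \<bar>u\<bar> * (c3 * k + E * k * (exp (1 / T^2) / T) + (1 + 2 / T) * \<bar>u\<bar>)"
        by (rule accept_perturbation(2)[OF _ i2 \<eta> Ek True si b]) simp
      also have "\<dots> \<le> \<bar>u\<bar> * (c3 * k + E * k * (exp (1 / T0^2) / T0) + (1 + 2 / T0) * \<bar>u\<bar>)"
      proof -
        have "exp (1 / T^2) / T \<le> exp (1 / T0^2) / T0"
          using TT0 T0 by (intro frac_le exp_le_cancel_iff[THEN iffD2] divide_left_mono power_mono) auto
        moreover have "1 + 2 / T \<le> 1 + 2 / T0" using TT0 T0 by (simp add: frac_le)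
        ultimately show ?thesis using Ek c by (intro mult_left_mono add_mono mult_right_mono) auto
      qed
      also have "\<dots> = \<bar>u\<bar> * ((c3 + E * (exp (1 / T0^2) / T0)) * k + (1 + 2 / T0) * \<bar>u\<bar>)"
        by (simp add: algebra_simps)
      also have "\<dots> \<le> \<bar>u\<bar> * (C * k + C * \<bar>u\<bar>)"
        using C k0 by (intro mult_left_mono add_mono mult_right_mono) auto
      finally show ?thesis by (simp add: algebra_simps)
    next
      case False
      have cdf01: "0 \<le> cdf \<gamma> (- T / 2)" "cdf \<gamma> (- T / 2) \<le> 1"
        using prob_space.prob_le_1[OF prob_space_std_normal] by (auto simp: cdf_def)
      have "(\<integral>z. accept (?W z + u) \<partial>P) - (\<integral>z. accept (?W z) \<partial>P) = (\<integral>z. accept (?W z + u) - accept (?W z) \<partial>P)"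
        by (intro Bochner_Integration.integral_diff[symmetric] accept_int) auto
      then have "\<bar>(\<integral>z. accept (?W z + u) \<partial>P) - (\<integral>z. accept (?W z) \<partial>P)\<bar> \<le> (\<integral>z. \<bar>accept (?W z + u) - accept (?W z)\<bar> \<partial>P)"
        by (simp only: integral_abs_bound)
      also have "\<dots> \<le> (\<integral>z. \<bar>u\<bar> \<partial>P)"
      proof (rule integral_mono)
        show "\<bar>accept (?W z + u) - accept (?W z)\<bar> \<le> \<bar>u\<bar>" for z
          using accept_lipschitz[of "?W z + u" "?W z"] by simp
      qed (auto intro!: integrable_abs Bochner_Integration.integrable_diff accept_int)
      also have "\<dots> = \<bar>u\<bar>" by (simp add: prob_space)
      finally have "\<bar>(\<integral>z. accept (?W z + u) \<partial>P) - (\<integral>z. accept (?W z) \<partial>P)\<bar> \<le> \<bar>u\<bar>" .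
      moreover have "\<bar>u * cdf \<gamma> (- T / 2)\<bar> \<le> \<bar>u\<bar> * 1"
        unfolding abs_mult using cdf01 by (intro mult_left_mono) auto
      ultimately have "\<bar>(\<integral>z. accept (?W z + u) \<partial>P) - (\<integral>z. accept (?W z) \<partial>P) - u * cdf \<gamma> (- T / 2)\<bar> \<le> 2 * \<bar>u\<bar> * 1"
        by linarith
      also have "\<dots> \<le> C * \<bar>u\<bar> * (k + \<bar>u\<bar>)"
        using C \<open>0 < C\<close> False k0 by (intro mult_mono) auto
      finally show ?thesis .
    qed
    show "\<bar>(\<integral>z. accept (?W z) \<partial>P) - 2 * cdf \<gamma> (- (\<sigma> * sqrt (\<Sum>i\<in>I. (V1 (x i))^2)) / 2)\<bar> \<le> C * k \<and>
      \<bar>(\<integral>z. accept (?W z + u) \<partial>P) - (\<integral>z. accept (?W z) \<partial>P) - u * cdf \<gamma> (- (\<sigma> * sqrt (\<Sum>i\<in>I. (V1 (x i))^2)) / 2)\<bar>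
        \<le> C * \<bar>u\<bar> * (k + \<bar>u\<bar>)"
      using first second unfolding T by simp
  qed
qed


section \<open>Expansion of one step in the first coordinate\<close>

lemma one_coordinate_expansion:
  fixes f f1 f2 f3 \<psi> :: "real \<Rightarrow> real" and l D F \<theta> \<sigma> k x :: real
  assumes l: "0 < \<sigma>" "\<sigma> \<le> l" "\<sigma> \<le> l * k" and D: "0 \<le> D" and k: "0 \<le> k"
    and \<psi>_meas[measurable]: "\<psi> \<in> borel_measurable borel"
    and \<psi>01: "\<And>u. 0 \<le> \<psi> u" "\<And>u. \<psi> u \<le> 1"
    and \<theta>: "0 \<le> \<theta>" "\<theta> \<le> 1"
    and \<psi>0: "\<bar>\<psi> 0 - 2 * \<theta>\<bar> \<le> D * k"
    and \<psi>1: "\<And>u. \<bar>\<psi> u - \<psi> 0\<bar> \<le> \<bar>u\<bar>"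
    and \<psi>2: "\<And>u. \<bar>\<psi> u - \<psi> 0 - u * \<theta>\<bar> \<le> D * \<bar>u\<bar> * (k + \<bar>u\<bar>)"
    and df: "\<And>x. (f has_real_derivative f1 x) (at x)" "\<And>x. (f1 has_real_derivative f2 x) (at x)"
      "\<And>x. (f2 has_real_derivative f3 x) (at x)"
    and bf: "\<And>x. \<bar>f1 x\<bar> \<le> F * exp (1/2 * \<bar>x\<bar>)" "\<And>x. \<bar>f2 x\<bar> \<le> F * exp (1/2 * \<bar>x\<bar>)"
      "\<And>x. \<bar>f3 x\<bar> \<le> F * exp (1/2 * \<bar>x\<bar>)"
  shows "\<bar>(\<integral>z. (f (x + \<sigma> * z) - f x) * \<psi> (V (x + \<sigma> * z) - V x) \<partial>\<gamma>)
      - \<sigma>^2 * \<theta> * (f2 x + V1 x * f1 x)\<bar>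
    \<le> (D * B + D * B^2 * l + 3 * B * l + D + 6 * l) * (2 * exp ((2 * l + 3)^2 / 2)) * F * exp \<bar>x\<bar> * (\<sigma>^2 * k)"
proof -
  let ?X = "\<lambda>c. exp (c * \<bar>x\<bar>)"
  let ?Z = "\<lambda>z. exp ((2 * l + 3) * \<bar>z\<bar>)"
  have l0: "0 < l" using l by linarith
  have F0: "0 \<le> F" using order_trans[OF abs_ge_zero bf(1)[of 0]] by simp
  have f_meas[measurable]: "f \<in> borel_measurable borel"
    using df by (intro borel_measurable_continuous_onI) (auto intro!: DERIV_continuous simp: continuous_on_eq_continuous_at)
  define u where "u z = V (x + \<sigma> * z) - V x" for z
  define R where "R z = f (x + \<sigma> * z) - f x - f1 x * (\<sigma> * z) - f2 x * (\<sigma> * z)^2 / 2" for z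
  \<comment> \<open>The coefficient of \<open>z^2\<close> collects two products:
    \<open>f1 x * \<sigma> * z\<close> with \<open>\<theta> * V1 x * \<sigma> * z\<close>, from the
    slope of \<open>\<psi>\<close>, and \<open>f2 x * \<sigma>^2 * z^2 / 2\<close> with
    \<open>2 * \<theta>\<close>, from its value at \<open>0\<close>. The term linear in
    \<open>z\<close> has mean zero whatever \<open>\<psi> 0\<close> is.\<close>
  define Err where "Err z = (f (x + \<sigma> * z) - f x) * \<psi> (u z)
    - (\<sigma>^2 * \<theta> * (f2 x + V1 x * f1 x) * z^2 + f1 x * \<sigma> * \<psi> 0 * z)" for z
  have Err_meas[measurable]: "Err \<in> borel_measurable borel" unfolding Err_def[abs_def] u_def[abs_def] by measurable
  have Err_eq: "Err z = f1 x * (\<sigma> * z) * ((\<psi> (u z) - \<psi> 0 - u z * \<theta>) + (u z - V1 x * (\<sigma> * z)) * \<theta>)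
    + f2 x * (\<sigma>^2 * z^2) / 2 * ((\<psi> (u z) - \<psi> 0) + (\<psi> 0 - 2 * \<theta>)) + R z * \<psi> (u z)" for z
    by (simp add: Err_def R_def power2_eq_square) (simp add: field_simps)
  have sz: "\<bar>\<sigma> * z\<bar> \<le> l * \<bar>z\<bar>" for z using l by (auto simp: abs_mult intro: mult_right_mono)
  have ez: "exp (c * (\<bar>x\<bar> + \<bar>\<sigma> * z\<bar>)) \<le> ?X c * exp (l * \<bar>z\<bar>)" if "0 \<le> c" "c \<le> 1" for c z
  proof -
    have "c * \<bar>\<sigma> * z\<bar> \<le> 1 * (l * \<bar>z\<bar>)" using that sz[of z] by (intro mult_mono) auto
    then show ?thesis by (simp add: distrib_left flip: exp_add)
  qed
  have z1: "\<bar>z\<bar> \<le> exp \<bar>z\<bar>" and z2: "\<bar>z\<bar>^2 \<le> 2 * exp \<bar>z\<bar>" and z3: "\<bar>z\<bar> ^ 3 \<le> 6 * exp \<bar>z\<bar>" for z :: real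
    using power_le_exp[of "\<bar>z\<bar>" 1] power_le_exp[of "\<bar>z\<bar>" 2] power_le_exp[of "\<bar>z\<bar>" 3] by (simp_all add: fact_numeral)
  have el: "exp ((l + 1) * \<bar>z\<bar>) = exp (l * \<bar>z\<bar>) * exp \<bar>z\<bar>" for z
    by (simp add: distrib_right exp_add)
  have uz: "\<bar>u z\<bar> \<le> B * \<sigma> * (?X (1/8) * exp ((l + 1) * \<bar>z\<bar>))" for z
  proof -
    have "\<bar>u z\<bar> \<le> B * exp (1/8 * (\<bar>x\<bar> + \<bar>\<sigma> * z\<bar>)) * \<bar>\<sigma> * z\<bar>"
      unfolding u_def using taylor1[of x "\<sigma> * z"] by simp
    also have "\<dots> \<le> B * (?X (1/8) * exp (l * \<bar>z\<bar>)) * (\<sigma> * exp \<bar>z\<bar>)"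
      by (rule mult_mono[OF mult_left_mono[OF ez]]) (use z1[of z] B1 l in \<open>auto simp: abs_mult\<close>)
    finally show ?thesis unfolding el by (simp add: mult_ac)
  qed
  have uz2: "\<bar>u z - V1 x * (\<sigma> * z)\<bar> \<le> 2 * B * \<sigma>^2 * (?X (1/8) * exp ((l + 1) * \<bar>z\<bar>))" for z
  proof -
    have "\<bar>u z - V1 x * (\<sigma> * z)\<bar> \<le> B * exp (1/8 * (\<bar>x\<bar> + \<bar>\<sigma> * z\<bar>)) * (\<sigma> * z)^2"
      unfolding u_def using taylor2[of x "\<sigma> * z"] by simp
    also have "\<dots> \<le> B * (?X (1/8) * exp (l * \<bar>z\<bar>)) * (\<sigma>^2 * (2 * exp \<bar>z\<bar>))"
      by (rule mult_mono[OF mult_left_mono[OF ez]]) (use z2[of z] B1 l in \<open>auto simp: power_mult_distrib intro: mult_left_mono\<close>)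
    finally show ?thesis unfolding el by (simp add: mult_ac)
  qed
  have Rz: "\<bar>R z\<bar> \<le> 6 * F * \<sigma>^3 * (?X (1/2) * exp ((l + 1) * \<bar>z\<bar>))" for z
  proof -
    have "\<bar>R z\<bar> \<le> F * exp (1/2 * (\<bar>x\<bar> + \<bar>\<sigma> * z\<bar>)) * \<bar>\<sigma> * z\<bar> ^ 3"
      unfolding R_def by (rule exp_growth_taylor3[OF _ df(1) bf(1) df(2,3) bf(3)]) simp
    also have "\<dots> \<le> F * (?X (1/2) * exp (l * \<bar>z\<bar>)) * (\<sigma>^3 * (6 * exp \<bar>z\<bar>))"
      by (rule mult_mono[OF mult_left_mono[OF ez]]) (use z3[of z] F0 l in \<open>auto simp: abs_mult power_mult_distrib\<close>)
    finally show ?thesis unfolding el by (simp add: mult_ac)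
  qed
  \<comment> \<open>The rate \<open>2 * l + 3 = 1 + 2 * (l + 1)\<close> covers one factor
    \<open>z\<close> and two copies of the bound on \<open>u z\<close>.\<close>
  have Z1: "1 \<le> exp ((l + 1) * \<bar>z\<bar>)" "exp ((l + 1) * \<bar>z\<bar>) \<le> ?Z z" "exp \<bar>z\<bar> * exp ((l + 1) * \<bar>z\<bar>) \<le> ?Z z"
    "exp \<bar>z\<bar> * (exp ((l + 1) * \<bar>z\<bar>) * exp ((l + 1) * \<bar>z\<bar>)) \<le> ?Z z" "exp \<bar>z\<bar> \<le> ?Z z" for z
    using l0 by (auto simp: algebra_simps simp flip: exp_add)
  have Xm: "?X c \<le> ?X c'" "1 \<le> ?X c'" if "c \<le> c'" "0 \<le> c'" for c c'
    using that by (auto intro: mult_right_mono)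
  \<comment> \<open>Trading one power of the step size for \<open>k\<close> brings the error terms
    to the common form \<open>\<sigma>^2 * k\<close>.\<close>
  have \<sigma>k: "\<sigma>^2 \<le> l * (\<sigma> * k)" using l by (simp add: power2_eq_square mult.left_commute)
  have \<sigma>k0: "0 \<le> \<sigma> * k" using l k by simp
  let ?Q = "\<lambda>z. (\<psi> (u z) - \<psi> 0 - u z * \<theta>) + (u z - V1 x * (\<sigma> * z)) * \<theta>"
  let ?R = "\<lambda>z. (\<psi> (u z) - \<psi> 0) + (\<psi> 0 - 2 * \<theta>)"
  let ?M = "\<lambda>z. F * exp \<bar>x\<bar> * (\<sigma>^2 * k) * ?Z z" and ?c = "D * B + D * B^2 * l + 2 * B * l"
  have T1: "\<bar>f1 x * (\<sigma> * z) * ?Q z\<bar>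
      \<le> ?c * ?M z" for z
  proof -
    let ?e = "exp ((l + 1) * \<bar>z\<bar>)"
    have "\<bar>u z\<bar> * \<bar>u z\<bar> \<le> (B * \<sigma> * (?X (1/8) * ?e)) * (B * \<sigma> * (?X (1/8) * ?e))"
      using uz[of z] by (intro mult_mono) auto
    also have "\<dots> = B^2 * \<sigma>^2 * ((?X (1/8) * ?X (1/8)) * (?e * ?e))"
      by (simp add: power2_eq_square)
    also have "?X (1/8) * ?X (1/8) = ?X (1/4)" by (simp flip: exp_add)
    finally have uu: "\<bar>u z\<bar> * \<bar>u z\<bar> \<le> B^2 * \<sigma>^2 * (?X (1/4) * (?e * ?e))" .
    have ee: "?e \<le> ?e * ?e" using mult_left_mono[OF Z1(1)[of z], of ?e] by simp
    have x18: "?X (1/8) * ?e \<le> ?X (1/4) * (?e * ?e)"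
      using Xm(1)[of "1/8" "1/4"] ee by (intro mult_mono) auto
    have "\<bar>?Q z\<bar>
      \<le> D * \<bar>u z\<bar> * (k + \<bar>u z\<bar>) + \<bar>u z - V1 x * (\<sigma> * z)\<bar> * 1"
      using \<theta> by (intro order_trans[OF abs_triangle_ineq] add_mono \<psi>2) (auto simp: abs_mult intro!: mult_left_le)
    also have "\<dots> = D * k * \<bar>u z\<bar> + D * (\<bar>u z\<bar> * \<bar>u z\<bar>) + \<bar>u z - V1 x * (\<sigma> * z)\<bar>"
      by (simp add: algebra_simps)
    also have "\<dots> \<le> D * k * (B * \<sigma> * (?X (1/4) * (?e * ?e))) + D * (B^2 * (l * (\<sigma> * k)) * (?X (1/4) * (?e * ?e)))
      + 2 * B * (l * (\<sigma> * k)) * (?X (1/4) * (?e * ?e))"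
    proof (intro add_mono mult_left_mono)
      show "\<bar>u z\<bar> \<le> B * \<sigma> * (?X (1/4) * (?e * ?e))"
        using uz[of z] by (rule order_trans) (intro mult_left_mono x18; use B1 l in auto)
      show "\<bar>u z\<bar> * \<bar>u z\<bar> \<le> B^2 * (l * (\<sigma> * k)) * (?X (1/4) * (?e * ?e))"
        using uu by (rule order_trans) (intro mult_right_mono mult_left_mono \<sigma>k; simp)
      show "\<bar>u z - V1 x * (\<sigma> * z)\<bar> \<le> 2 * B * (l * (\<sigma> * k)) * (?X (1/4) * (?e * ?e))"
        using uz2[of z] by (rule order_trans) (intro mult_mono mult_left_mono \<sigma>k x18; use B1 \<sigma>k0 l0 in auto)
    qed (use D k in auto)
    also have "\<dots> = ?c * (\<sigma> * k) * (?X (1/4) * (?e * ?e))"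
      by (simp add: algebra_simps)
    finally have *: "\<bar>?Q z\<bar>
      \<le> ?c * (\<sigma> * k) * (?X (1/4) * (?e * ?e))" .
    have "\<bar>f1 x * (\<sigma> * z)\<bar> \<le> (F * ?X (1/2)) * (\<sigma> * exp \<bar>z\<bar>)"
      unfolding abs_mult using bf(1)[of x] z1[of z] l F0 by (intro mult_mono) auto
    then have "\<bar>f1 x * (\<sigma> * z) * ?Q z\<bar>
      \<le> ((F * ?X (1/2)) * (\<sigma> * exp \<bar>z\<bar>)) * (?c * (\<sigma> * k) * (?X (1/4) * (?e * ?e)))"
      unfolding abs_mult[of "f1 x * (\<sigma> * z)"] by (rule mult_mono[OF _ *]) (use l F0 in auto)
    also have "\<dots> = ?c * (F * (?X (1/2) * ?X (1/4)) * (\<sigma>^2 * k) * (exp \<bar>z\<bar> * (?e * ?e)))"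
      by (simp add: power2_eq_square)
    also have "\<dots> \<le> ?c * ?M z"
    proof (intro mult_left_mono mult_mono Z1 order_refl)
      show "?X (1/2) * ?X (1/4) \<le> exp \<bar>x\<bar>" by (simp flip: exp_add)
    qed (use F0 k D B1 l0 in auto)
    finally show ?thesis .
  qed
  have T2: "\<bar>f2 x * (\<sigma>^2 * z^2) / 2 * ?R z\<bar>
      \<le> (B * l + D) * ?M z" for z
  proof -
    let ?e = "exp ((l + 1) * \<bar>z\<bar>)"
    have xe1: "1 \<le> ?X (1/8) * ?e" using mult_mono[OF Xm(2)[of "1/8" "1/8"] Z1(1)[of z]] by simp
    have "\<bar>?R z\<bar> \<le> \<bar>u z\<bar> + D * k * 1"
      using \<psi>0 \<psi>1[of "u z"] by linarith
    also have "\<dots> \<le> B * (l * k) * (?X (1/8) * ?e) + D * k * (?X (1/8) * ?e)"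
    proof (intro add_mono mult_left_mono xe1)
      show "\<bar>u z\<bar> \<le> B * (l * k) * (?X (1/8) * ?e)"
        using uz[of z] by (rule order_trans) (intro mult_right_mono mult_left_mono l; use B1 in auto)
    qed (use D k in auto)
    finally have *: "\<bar>?R z\<bar> \<le> (B * l + D) * k * (?X (1/8) * ?e)"
      by (simp add: algebra_simps)
    have "\<bar>f2 x * (\<sigma>^2 * z^2) / 2\<bar> \<le> (F * ?X (1/2)) * (\<sigma>^2 * exp \<bar>z\<bar>)"
    proof -
      have "\<bar>f2 x * (\<sigma>^2 * z^2) / 2\<bar> = \<bar>f2 x\<bar> * (\<sigma>^2 * (\<bar>z\<bar>^2 / 2))" by (simp add: abs_mult)
      also have "\<dots> \<le> (F * ?X (1/2)) * (\<sigma>^2 * exp \<bar>z\<bar>)"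
        using bf(2)[of x] z2[of z] F0 by (intro mult_mono mult_left_mono) auto
      finally show ?thesis .
    qed
    then have "\<bar>f2 x * (\<sigma>^2 * z^2) / 2 * ?R z\<bar>
      \<le> ((F * ?X (1/2)) * (\<sigma>^2 * exp \<bar>z\<bar>)) * ((B * l + D) * k * (?X (1/8) * ?e))"
      unfolding abs_mult[of "f2 x * (\<sigma>^2 * z^2) / 2"] by (rule mult_mono[OF _ *]) (use F0 in auto)
    also have "\<dots> = (B * l + D) * (F * (?X (1/2) * ?X (1/8)) * (\<sigma>^2 * k) * (exp \<bar>z\<bar> * ?e))"
      by simp
    also have "\<dots> \<le> (B * l + D) * ?M z"
    proof (intro mult_left_mono mult_mono Z1 order_refl)
      show "?X (1/2) * ?X (1/8) \<le> exp \<bar>x\<bar>" by (simp flip: exp_add)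
    qed (use F0 k D B1 l0 in auto)
    finally show ?thesis .
  qed
  have T3: "\<bar>R z * \<psi> (u z)\<bar> \<le> 6 * l * ?M z" for z
  proof -
    have "\<bar>R z * \<psi> (u z)\<bar> \<le> \<bar>R z\<bar> * 1"
      unfolding abs_mult using \<psi>01 by (intro mult_left_mono) auto
    also have "\<dots> \<le> 6 * F * \<sigma>^3 * (?X (1/2) * exp ((l + 1) * \<bar>z\<bar>))" using Rz[of z] by simp
    also have "\<dots> \<le> 6 * F * (\<sigma>^2 * (l * k)) * (exp \<bar>x\<bar> * ?Z z)"
    proof (intro mult_mono Z1 mult_left_mono)
      show "\<sigma>^3 \<le> \<sigma>^2 * (l * k)"
        using mult_left_mono[OF l(3), of "\<sigma>^2"] by (simp add: power2_eq_square power3_eq_cube)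
    qed (use F0 k l0 l(1) in auto)
    finally show ?thesis by (simp add: mult_ac)
  qed
  have Eb: "\<bar>Err z\<bar> \<le> ((D * B + D * B^2 * l + 3 * B * l + D + 6 * l) * F * exp \<bar>x\<bar> * (\<sigma>^2 * k)) * ?Z z" for z
  proof -
    have "\<bar>Err z\<bar> \<le> ?c * ?M z
      + (B * l + D) * ?M z + 6 * l * ?M z"
      unfolding Err_eq by (intro order_trans[OF abs_triangle_ineq] add_mono T1 T2 T3)
    also have "\<dots> = (?c + (B * l + D) + 6 * l) * ?M z"
      by (simp only: distrib_right)
    also have "?c + (B * l + D) + 6 * l = D * B + D * B^2 * l + 3 * B * l + D + 6 * l"
      by simp
    finally show ?thesis by (simp only: mult.assoc)
  qed
  note m = std_normal_moments
  have Ei: "integrable \<gamma> Err" by (rule std_normal_exp_bound(1)[OF _ Eb]) simp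
  have "(\<integral>z. (f (x + \<sigma> * z) - f x) * \<psi> (u z) \<partial>\<gamma>)
    = (\<integral>z. Err z + (\<sigma>^2 * \<theta> * (f2 x + V1 x * f1 x) * z^2 + f1 x * \<sigma> * \<psi> 0 * z) \<partial>\<gamma>)"
    by (simp add: Err_def)
  also have "\<dots> = (\<integral>z. Err z \<partial>\<gamma>) + \<sigma>^2 * \<theta> * (f2 x + V1 x * f1 x)"
    using Ei m by (subst Bochner_Integration.integral_add) auto
  finally have "(\<integral>z. (f (x + \<sigma> * z) - f x) * \<psi> (u z) \<partial>\<gamma>) - \<sigma>^2 * \<theta> * (f2 x + V1 x * f1 x)
    = (\<integral>z. Err z \<partial>\<gamma>)" by simp
  then show ?thesis
    using std_normal_exp_bound(3)[OF _ Eb] unfolding u_def by (simp add: mult_ac)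
qed

end

section \<open>The generator as an iterated Gaussian integral\<close>

lemma normal_d_eq_distr:
  assumes "0 < \<sigma>"
  shows "normal_d d x \<sigma> = distr (Pi\<^sub>M {1..d} (\<lambda>_. \<gamma>)) (Pi\<^sub>M {1..d} (\<lambda>_. borel))
    (\<lambda>z. \<lambda>i\<in>{1..d}. x i + \<sigma> * z i)"
proof -
  have D: "distr \<gamma> borel (\<lambda>z. x i + \<sigma> * z) = density lborel (\<lambda>y. ennreal (normal_density (x i) \<sigma> y))" for i
    by (rule distr_std_normal_affine[OF assms])
  have "prob_space (density lborel (\<lambda>y. ennreal (normal_density (x i) \<sigma> y)))" for i
    using assms by (rule prob_space_normal_density)
  then show ?thesis
    unfolding normal_d_def
    by (subst distr_PiM_coordinates[where f="\<lambda>i z. x i + \<sigma> * z"])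
       (auto simp: D intro: prob_space_std_normal prob_space_imp_sigma_finite)
qed

text \<open>Fubini for one coordinate against the rest. A bound that depends on this coordinate
  alone gives joint integrability, because the remaining factor is a probability measure.\<close>

lemma integral_PiM_insert_pair:
  fixes h :: "real \<Rightarrow> ('i \<Rightarrow> real) \<Rightarrow> real"
  assumes fin: "finite I" "j \<notin> I"
    and h: "case_prod h \<in> borel_measurable (borel \<Otimes>\<^sub>M Pi\<^sub>M I (\<lambda>_. borel))"
    and b: "\<And>y w. \<bar>h y w\<bar> \<le> g y" and g: "integrable \<gamma> g"
  shows "(\<integral>z. h (z j) (restrict z I) \<partial>Pi\<^sub>M (insert j I) (\<lambda>_. \<gamma>))
    = (\<integral>y. \<integral>w. h y w \<partial>Pi\<^sub>M I (\<lambda>_. \<gamma>) \<partial>\<gamma>)"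
proof -
  let ?P = "Pi\<^sub>M I (\<lambda>_. \<gamma>)"
  interpret G: prob_space \<gamma> by (rule prob_space_std_normal)
  interpret P: prob_space ?P by (intro prob_space_PiM prob_space_std_normal)
  interpret GP: pair_prob_space \<gamma> ?P ..
  have sets: "sets (\<gamma> \<Otimes>\<^sub>M ?P) = sets (borel \<Otimes>\<^sub>M Pi\<^sub>M I (\<lambda>_. borel))"
    by (intro sets_pair_measure_cong sets_PiM_cong) auto
  have h'[measurable]: "case_prod h \<in> borel_measurable (\<gamma> \<Otimes>\<^sub>M ?P)"
    using h measurable_cong_sets[OF sets refl] by auto
  have "integrable (\<gamma> \<Otimes>\<^sub>M ?P) (\<lambda>p. g (fst p))"
    using integrable_distr_eq[of fst "\<gamma> \<Otimes>\<^sub>M ?P" \<gamma> g] g P.distr_pair_fst[of \<gamma>] by auto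
  then have int: "integrable (\<gamma> \<Otimes>\<^sub>M ?P) (case_prod h)"
    by (rule Bochner_Integration.integrable_bound) (use b in \<open>auto intro!: AE_I2 order_trans[OF _ abs_ge_self]\<close>)
  have upd[measurable]: "(\<lambda>(y, w). w(j := y)) \<in> measurable (\<gamma> \<Otimes>\<^sub>M ?P) (Pi\<^sub>M (insert j I) (\<lambda>_. \<gamma>))"
    using measurable_fun_upd[where I="insert j I" and J=I and i=j] fin by (auto simp: case_prod_beta')
  have H: "(\<lambda>z. h (z j) (restrict z I)) \<in> borel_measurable (Pi\<^sub>M (insert j I) (\<lambda>_. \<gamma>))"
  proof -
    have "(\<lambda>z. (z j, restrict z I)) \<in> measurable (Pi\<^sub>M (insert j I) (\<lambda>_. \<gamma>)) (\<gamma> \<Otimes>\<^sub>M ?P)"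
      by (intro measurable_Pair measurable_component_singleton measurable_restrict_subset) auto
    from measurable_compose[OF this h'] show ?thesis by simp
  qed
  have "(\<integral>z. h (z j) (restrict z I) \<partial>Pi\<^sub>M (insert j I) (\<lambda>_. \<gamma>))
    = (\<integral>z. h (z j) (restrict z I) \<partial>distr (\<gamma> \<Otimes>\<^sub>M ?P) (Pi\<^sub>M (insert j I) (\<lambda>_. \<gamma>)) (\<lambda>(y, w). w(j := y)))"
    by (subst distr_pair_PiM_eq_PiM) (auto intro: prob_space_std_normal)
  also have "\<dots> = (\<integral>p. h ((case p of (y, w) \<Rightarrow> w(j := y)) j) (restrict (case p of (y, w) \<Rightarrow> w(j := y)) I) \<partial>(\<gamma> \<Otimes>\<^sub>M ?P))"
    by (rule integral_distr[OF upd H])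
  also have "\<dots> = (\<integral>p. case_prod h p \<partial>(\<gamma> \<Otimes>\<^sub>M ?P))"
  proof (rule Bochner_Integration.integral_cong[OF refl])
    fix p assume "p \<in> space (\<gamma> \<Otimes>\<^sub>M ?P)"
    then obtain y w where p: "p = (y, w)" "w \<in> extensional I"
      by (auto simp: space_pair_measure space_PiM PiE_def)
    have "restrict (w(j := y)) I = w"
      using p(2) fin by (auto simp: restrict_def extensional_def fun_eq_iff)
    then show "h ((case p of (y, w) \<Rightarrow> w(j := y)) j) (restrict (case p of (y, w) \<Rightarrow> w(j := y)) I) = case_prod h p"
      by (simp add: p)
  qed
  also have "\<dots> = (\<integral>y. \<integral>w. h y w \<partial>?P \<partial>\<gamma>)"
    using GP.integral_fst'[OF int] by simp
  finally show ?thesis .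
qed

text \<open>The test function sees only coordinate \<open>1\<close>, so the others are integrated
  out first; what remains is the acceptance averaged over them, as a function of the first
  log-density increment.\<close>

lemma gen_d_first_coordinate:
  fixes V f :: "real \<Rightarrow> real"
  assumes d: "1 \<le> d" and l: "0 < l"
    and [measurable]: "V \<in> borel_measurable borel" "f \<in> borel_measurable borel"
    and \<rho>: "\<And>y. \<rho> y = exp (V y)"
    and f: "\<And>z. \<bar>f (x 1 + l / sqrt d * z) - f (x 1)\<bar> \<le> A * exp (c * \<bar>z\<bar>)"
  shows "gen_d \<rho> l d (\<lambda>y. f (y 1)) x = d *
    (\<integral>z. (f (x 1 + l / sqrt d * z) - f (x 1)) *
      (\<integral>w. accept ((\<Sum>i\<in>{2..d}. V (x i + l / sqrt d * w i) - V (x i)) + (V (x 1 + l / sqrt d * z) - V (x 1)))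
        \<partial>Pi\<^sub>M {2..d} (\<lambda>_. \<gamma>)) \<partial>\<gamma>)"
proof -
  define \<sigma> where "\<sigma> = l / sqrt (real d)"
  have \<sigma>: "0 < \<sigma>" using d l by (simp add: \<sigma>_def)
  have id: "{1..d} = insert 1 {2..d}" using d by auto
  have split: "(\<Sum>i\<in>{1..d}. g i) = (\<Sum>i\<in>{2..d}. g i) + g 1" for g :: "nat \<Rightarrow> real"
    unfolding id by (subst sum.insert) auto
  define h where "h y w = (f (x 1 + \<sigma> * y) - f (x 1)) *
    accept ((\<Sum>i\<in>{2..d}. V (x i + \<sigma> * w i) - V (x i)) + (V (x 1 + \<sigma> * y) - V (x 1)))" for y w
  have h_meas: "case_prod h \<in> borel_measurable (borel \<Otimes>\<^sub>M Pi\<^sub>M {2..d} (\<lambda>_. borel))"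
    unfolding h_def[abs_def] by measurable
  have ratio: "min 1 (rho_d \<rho> d y / rho_d \<rho> d x) = accept (\<Sum>i\<in>{1..d}. V (y i) - V (x i))" for y
    by (simp add: rho_d_def \<rho> accept_def exp_sum[symmetric] sum_subtractf exp_diff)
  have F_meas: "(\<lambda>y. (f (y 1) - f (x 1)) * min 1 (rho_d \<rho> d y / rho_d \<rho> d x)) \<in> borel_measurable (Pi\<^sub>M {1..d} (\<lambda>_. borel))"
  proof -
    have [measurable]: "(\<lambda>y. y 1) \<in> borel_measurable (Pi\<^sub>M {1..d} (\<lambda>_. borel :: real measure))"
      using d by (intro measurable_component_singleton) auto
    show ?thesis unfolding ratio by measurable
  qed
  have "(\<integral>y. (f (y 1) - f (x 1)) * min 1 (rho_d \<rho> d y / rho_d \<rho> d x) \<partial>normal_d d x \<sigma>)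
    = (\<integral>z. (f ((\<lambda>i\<in>{1..d}. x i + \<sigma> * z i) 1) - f (x 1)) * min 1 (rho_d \<rho> d (\<lambda>i\<in>{1..d}. x i + \<sigma> * z i) / rho_d \<rho> d x)
      \<partial>Pi\<^sub>M {1..d} (\<lambda>_. \<gamma>))"
    unfolding normal_d_eq_distr[OF \<sigma>]
    by (rule integral_distr[OF _ F_meas]) (simp, measurable)
  also have "\<dots> = (\<integral>z. h (z 1) (restrict z {2..d}) \<partial>Pi\<^sub>M {1..d} (\<lambda>_. \<gamma>))"
    unfolding ratio split h_def using d by (intro Bochner_Integration.integral_cong[OF refl]) simp
  also have "\<dots> = (\<integral>z. h (z 1) (restrict z {2..d}) \<partial>Pi\<^sub>M (insert 1 {2..d}) (\<lambda>_. \<gamma>))"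
    by (simp only: id)
  also have "\<dots> = (\<integral>y. \<integral>w. h y w \<partial>Pi\<^sub>M {2..d} (\<lambda>_. \<gamma>) \<partial>\<gamma>)"
  proof (rule integral_PiM_insert_pair[OF _ _ h_meas])
    show "\<bar>h y w\<bar> \<le> A * exp (c * \<bar>y\<bar>)" for y w
      using mult_mono[OF f[of y] accept_range(2)] accept_range(1) order_trans[OF abs_ge_zero f[of y]]
      by (simp add: h_def abs_mult \<sigma>_def)
    show "integrable \<gamma> (\<lambda>y. A * exp (c * \<bar>y\<bar>))" using integrable_std_normal_exp_abs by simp
  qed auto
  finally show ?thesis by (simp add: gen_d_def \<sigma>_def h_def)
qed

section \<open>Deviation bounds at the scale of a sluggish sequence\<close>

lemma (in prob_space) exp_truncated_mean:
  fixes g :: "'a \<Rightarrow> real"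
  assumes [measurable]: "g \<in> borel_measurable M" and g: "integrable M g" "integrable M (\<lambda>x. (g x)^2)" "expectation g = 0"
    and lam: "0 < lam"
  shows "integrable M (\<lambda>x. exp (lam * (if g x \<le> 1 / lam then g x else 0)))"
    and "expectation (\<lambda>x. exp (lam * (if g x \<le> 1 / lam then g x else 0))) \<le> exp (lam^2 * expectation (\<lambda>x. (g x)^2))"
proof -
  define h where "h x = (if g x \<le> 1 / lam then g x else 0)" for x
  have [measurable]: "h \<in> borel_measurable M" unfolding h_def[abs_def] by measurable
  have h1: "lam * h x \<le> 1" for x using lam by (auto simp: h_def field_simps)
  have hg: "h x \<le> g x" for x
  proof -
    have "0 < 1 / lam" using lam by simp
    then have "\<not> g x \<le> 1 / lam \<Longrightarrow> 0 \<le> g x" by linarith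
    then show ?thesis by (simp add: h_def)
  qed
  have hi: "integrable M h"
    by (rule Bochner_Integration.integrable_bound[OF g(1)]) (auto simp: h_def)
  have h2i: "integrable M (\<lambda>x. (h x)^2)"
    by (rule Bochner_Integration.integrable_bound[OF g(2)]) (auto simp: h_def)
  show ei: "integrable M (\<lambda>x. exp (lam * (if g x \<le> 1 / lam then g x else 0)))"
    unfolding h_def[symmetric] by (rule integrable_const_bound[where B="exp 1"]) (use h1 in auto)
  \<comment> \<open>Truncation keeps the exponent at most \<open>1\<close>, so the quadratic bound
    for \<open>exp\<close> applies. Replacing large positive values by \<open>0\<close> can only
    lower the mean of the centred \<open>g\<close>, so the linear term may be dropped.\<close>
  have "expectation (\<lambda>x. exp (lam * h x)) \<le> expectation (\<lambda>x. 1 + lam * h x + (lam * h x)^2)"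
    using ei hi h2i exp_le_quadratic[OF h1] unfolding h_def[symmetric]
    by (intro integral_mono) (auto simp: power_mult_distrib)
  also have "\<dots> = 1 + lam * expectation h + lam^2 * expectation (\<lambda>x. (h x)^2)"
    using hi h2i by (simp add: power_mult_distrib prob_space)
  also have "\<dots> \<le> 1 + lam * 0 + lam^2 * expectation (\<lambda>x. (g x)^2)"
  proof (intro add_mono mult_left_mono order_refl)
    show "expectation h \<le> 0" using integral_mono[OF hi g(1) hg] g(3) by simp
    show "expectation (\<lambda>x. (h x)^2) \<le> expectation (\<lambda>x. (g x)^2)"
      using h2i g(2) by (intro integral_mono) (auto simp: h_def)
  qed (use lam in auto)
  also have "\<dots> \<le> exp (lam^2 * expectation (\<lambda>x. (g x)^2))"
    using exp_ge_add_one_self[of "lam^2 * expectation (\<lambda>x. (g x)^2)"] by simp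
  finally show "expectation (\<lambda>x. exp (lam * (if g x \<le> 1 / lam then g x else 0))) \<le> exp (lam^2 * expectation (\<lambda>x. (g x)^2))"
    by (simp add: h_def)
qed

text \<open>Either some coordinate in \<open>J\<close> reaches \<open>1 / lam\<close>, which a union
  bound covers, or the sum agrees with the truncated one, to which the exponential Markov inequality
  applies. \<open>J\<close> may be a proper part of the index set because the first coordinate is to
  stay free.\<close>

lemma truncated_chernoff:
  fixes g :: "'a \<Rightarrow> real"
  assumes M: "prob_space M" and fin: "finite I" "J \<subseteq> I" "card J \<le> n"
    and g_meas[measurable]: "g \<in> borel_measurable M"
    and g: "integrable M g" "integrable M (\<lambda>x. (g x)^2)" "(\<integral>x. g x \<partial>M) = 0"
    and lam: "0 < lam"
  shows "measure (Pi\<^sub>M I (\<lambda>_. M)) {z \<in> space (Pi\<^sub>M I (\<lambda>_. M)). t \<le> (\<Sum>i\<in>J. g (z i))}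
    \<le> n * measure M {x \<in> space M. 1 / lam \<le> g x} + exp (n * lam^2 * (\<integral>x. (g x)^2 \<partial>M) - lam * t)"
proof -
  interpret M: prob_space M by fact
  interpret P: prob_space "Pi\<^sub>M I (\<lambda>_. M)" by (intro prob_space_PiM M)
  interpret PS: product_sigma_finite "\<lambda>_. M"
    using M.sigma_finite_measure_axioms by (simp add: product_sigma_finite_def)
  let ?P = "Pi\<^sub>M I (\<lambda>_. M)"
  define h where "h x = (if g x \<le> 1 / lam then g x else 0)" for x
  have [measurable]: "h \<in> borel_measurable M" unfolding h_def[abs_def] by measurable
  have finJ: "finite J" using fin finite_subset by auto
  have cm[measurable]: "(\<lambda>z. z i) \<in> measurable ?P M" if "i \<in> J" for i
    using that fin by (intro measurable_component_singleton) auto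
  define E where "E = (\<integral>x. exp (lam * h x) \<partial>M)"
  define q where "q = (\<integral>x. (g x)^2 \<partial>M)"
  have q0: "0 \<le> q" by (simp add: q_def)
  have E: "integrable M (\<lambda>x. exp (lam * h x))" "E \<le> exp (lam^2 * q)" "0 \<le> E"
    using M.exp_truncated_mean[OF g_meas g lam] by (auto simp: h_def E_def q_def)
  define w where "w i x = (if i \<in> J then exp (lam * h x) else 1)" for i x
  have wi: "integrable M (w i)" "(\<integral>x. w i x \<partial>M) = (if i \<in> J then E else 1)" for i
    using E(1) by (cases "i \<in> J"; simp add: w_def[abs_def] E_def M.prob_space)+
  have prod_w: "(\<Prod>i\<in>I. w i (z i)) = exp (lam * (\<Sum>i\<in>J. h (z i)))" for z
  proof -
    have "(\<Prod>i\<in>I. w i (z i)) = (\<Prod>i\<in>J. exp (lam * h (z i)))"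
      using fin by (simp add: w_def prod.If_cases Int_absorb1)
    then show ?thesis using finJ by (simp add: exp_sum sum_distrib_left)
  qed
  have ei: "integrable ?P (\<lambda>z. exp (lam * (\<Sum>i\<in>J. h (z i))))"
    unfolding prod_w[symmetric] using fin wi by (intro PS.product_integrable_prod) auto
  have "(\<integral>z. exp (lam * (\<Sum>i\<in>J. h (z i))) \<partial>?P) = (\<Prod>i\<in>I. if i \<in> J then E else 1)"
    unfolding prod_w[symmetric] using fin wi by (subst PS.product_integral_prod) auto
  also have "\<dots> = E ^ card J" using fin by (simp add: prod.If_cases Int_absorb1)
  also have "\<dots> \<le> exp (lam^2 * q) ^ card J" using E by (intro power_mono) auto
  also have "\<dots> \<le> exp (lam^2 * q) ^ n" using fin q0 by (intro power_increasing) auto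
  also have "\<dots> = exp (n * lam^2 * q)" by (simp add: exp_of_nat_mult[symmetric] mult.assoc)
  finally have Eb: "(\<integral>z. exp (lam * (\<Sum>i\<in>J. h (z i))) \<partial>?P) \<le> exp (n * lam^2 * q)" .
  let ?A = "{z \<in> space ?P. exp (lam * t) \<le> exp (lam * (\<Sum>i\<in>J. h (z i)))}"
  let ?B = "\<lambda>i. {z \<in> space ?P. 1 / lam \<le> g (z i)}"
  have "measure ?P ?A \<le> (\<integral>z. exp (lam * (\<Sum>i\<in>J. h (z i))) \<partial>?P) / exp (lam * t)"
    by (rule integral_Markov_inequality_measure[OF ei, where A="{}"]) auto
  also have "\<dots> \<le> exp (n * lam^2 * q) / exp (lam * t)" using Eb by (intro divide_right_mono) auto
  finally have A: "measure ?P ?A \<le> exp (n * lam^2 * q - lam * t)" by (simp add: exp_diff)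
  have Bi: "measure ?P (?B i) = measure M {x \<in> space M. 1 / lam \<le> g x}" if "i \<in> J" for i
  proof -
    have "distr ?P M (\<lambda>z. z i) = M"
      using distr_PiM_component[of I "\<lambda>_. M" i] M that fin by auto
    then have "measure M {x \<in> space M. 1 / lam \<le> g x} = measure (distr ?P M (\<lambda>z. z i)) {x \<in> space M. 1 / lam \<le> g x}"
      by simp
    also have "\<dots> = measure ?P (?B i)"
      using that measurable_space[OF cm[OF that]]
      by (subst measure_distr) (auto intro!: arg_cong[where f="measure ?P"])
    finally show ?thesis ..
  qed
  have "measure ?P (\<Union>i\<in>J. ?B i) \<le> (\<Sum>i\<in>J. measure ?P (?B i))"
    using finJ by (intro P.finite_measure_subadditive_finite) auto
  also have "\<dots> = card J * measure M {x \<in> space M. 1 / lam \<le> g x}" by (simp add: Bi)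
  also have "\<dots> \<le> n * measure M {x \<in> space M. 1 / lam \<le> g x}" using fin by (intro mult_right_mono) auto
  finally have B: "measure ?P (\<Union>i\<in>J. ?B i) \<le> n * measure M {x \<in> space M. 1 / lam \<le> g x}" .
  have "measure ?P {z \<in> space ?P. t \<le> (\<Sum>i\<in>J. g (z i))} \<le> measure ?P ((\<Union>i\<in>J. ?B i) \<union> ?A)"
  proof (rule P.finite_measure_mono)
    show "{z \<in> space ?P. t \<le> (\<Sum>i\<in>J. g (z i))} \<subseteq> (\<Union>i\<in>J. ?B i) \<union> ?A"
    proof
      fix z assume z: "z \<in> {z \<in> space ?P. t \<le> (\<Sum>i\<in>J. g (z i))}"
      show "z \<in> (\<Union>i\<in>J. ?B i) \<union> ?A"
      proof (cases "\<exists>i\<in>J. 1 / lam \<le> g (z i)")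
        case True then show ?thesis using z by auto
      next
        case False
        then have "(\<Sum>i\<in>J. h (z i)) = (\<Sum>i\<in>J. g (z i))" by (intro sum.cong) (auto simp: h_def not_le)
        then show ?thesis using z lam by auto
      qed
    qed
    show "(\<Union>i\<in>J. ?B i) \<union> ?A \<in> sets ?P" using finJ by (intro sets.Un sets.finite_UN) auto
  qed
  also have "\<dots> \<le> measure ?P (\<Union>i\<in>J. ?B i) + measure ?P ?A"
    using finJ by (intro measure_Un_le sets.finite_UN) auto
  finally show ?thesis using A B by (simp add: q_def)
qed

text \<open>The lower bound lets errors of order \<open>1 / sqrt d\<close> be absorbed in
  \<open>a d / sqrt d\<close>. The upper bound is the growth condition in squared form.\<close>

lemma sluggish_bounds:
  assumes "sluggish a"
  shows "\<exists>m>0. \<forall>d\<ge>1. m \<le> a d" "\<exists>C>0. \<forall>d\<ge>2. (a d)^2 \<le> C * ln (real d)"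
proof -
  have pos: "\<And>d. 1 \<le> d \<Longrightarrow> 0 < a d" and lim: "filterlim a at_top sequentially"
    and bdd: "bdd_above ((\<lambda>d. a d / sqrt (ln (real d))) ` {2..})"
    using assms by (auto simp: sluggish_def)
  from lim obtain n where n: "\<And>d. n \<le> d \<Longrightarrow> 1 \<le> a d"
    unfolding filterlim_at_top eventually_sequentially by blast
  define m where "m = Min (insert 1 (a ` {1..n}))"
  have "0 < m" using pos by (auto simp: m_def)
  moreover have "m \<le> a d" if "1 \<le> d" for d
  proof (cases "d \<le> n")
    case True then show ?thesis using that unfolding m_def by (intro Min_le) auto
  next
    case False
    have "m \<le> 1" unfolding m_def by (intro Min_le) auto
    then show ?thesis using n[of d] False by simp
  qed
  ultimately show "\<exists>m>0. \<forall>d\<ge>1. m \<le> a d" by blast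
  from bdd obtain c where c: "\<And>d. 2 \<le> d \<Longrightarrow> a d / sqrt (ln (real d)) \<le> c"
    unfolding bdd_above_def by auto
  have "(a d)^2 \<le> (c^2 + 1) * ln (real d)" if d: "2 \<le> d" for d
  proof -
    have l: "0 < ln (real d)" using d by simp
    have "a d \<le> c * sqrt (ln (real d))" using c[OF d] l by (simp add: pos_divide_le_eq)
    then have "(a d)^2 \<le> (c * sqrt (ln (real d)))^2" using pos[of d] d by (intro power_mono) auto
    also have "\<dots> = c^2 * ln (real d)" using l by (simp add: power_mult_distrib)
    also have "\<dots> \<le> (c^2 + 1) * ln (real d)" using l by (intro mult_right_mono) auto
    finally show ?thesis .
  qed
  moreover have "0 < c^2 + 1" by (simp add: add_nonneg_pos)
  ultimately show "\<exists>C>0. \<forall>d\<ge>2. (a d)^2 \<le> C * ln (real d)" by blast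
qed

text \<open>As \<open>(a d)^2 \<le> C * ln d\<close>, the target \<open>exp (- (a d)^2)\<close> is
  at least \<open>d powr (- C)\<close>, whereas \<open>a d / sqrt d\<close> decays like a power of
  \<open>d\<close>. A sufficiently high moment therefore beats the factor \<open>d\<close> of the
  union bound.\<close>

lemma sluggish_polynomial_tail:
  assumes "sluggish a"
  shows "\<exists>p. \<exists>c>0. \<forall>d\<ge>1. real d * (a d / sqrt (real d)) ^ (2 * p) \<le> c * exp (- (a d)\<^sup>2)"
proof -
  have a1: "0 < a 1" using assms by (simp add: sluggish_def)
  from sluggish_bounds(2)[OF assms] obtain C where C: "0 < C" "\<And>d. 2 \<le> d \<Longrightarrow> (a d)^2 \<le> C * ln (real d)" by blast
  obtain k :: nat where k: "1 + C \<le> real k" using real_arch_simple by blast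
  \<comment> \<open>The first summand serves \<open>d \<ge> 2\<close>, where
    \<open>k \<ge> 1 + C\<close> gives \<open>d powr (1 - k) \<le> d powr (- C)\<close>. The second
    serves \<open>d = 1\<close>, which the logarithmic bound does not cover.\<close>
  define c where "c = (2 * C) ^ (2 * k) + a 1 ^ (2 * (2 * k)) * exp ((a 1)^2)"
  have c: "0 < c" using C a1 by (simp add: c_def add_pos_nonneg)
  show ?thesis
  proof (rule exI[of _ "2 * k"], rule exI[of _ c], rule conjI[OF c], intro allI impI)
    fix d :: nat assume d: "1 \<le> d"
    show "real d * (a d / sqrt (real d)) ^ (2 * (2 * k)) \<le> c * exp (- (a d)\<^sup>2)"
    proof (cases "d = 1")
      case True
      have "a 1 ^ (2 * (2 * k)) = (a 1 ^ (2 * (2 * k)) * exp ((a 1)^2)) * exp (- (a 1)\<^sup>2)"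
        by (simp add: mult.assoc flip: exp_add)
      also have "\<dots> \<le> c * exp (- (a 1)\<^sup>2)" using C by (intro mult_right_mono) (auto simp: c_def)
      finally show ?thesis using True by simp
    next
      case False
      then have d2: "2 \<le> d" using d by simp
      \<comment> \<open>The logarithm of the root gives \<open>ln d \<le> 2 * sqrt d\<close>, so the
        squared ratio decays only like \<open>1 / sqrt d\<close>; this is why \<open>p\<close> is
        \<open>2 * k\<close> and not \<open>k\<close>.\<close>
      have "ln (sqrt (real d)) \<le> sqrt (real d) - 1" using d by (intro ln_le_minus_one) auto
      then have ln: "ln (real d) \<le> 2 * sqrt (real d)" using d by (simp add: ln_sqrt)
      have "(a d)^2 / real d \<le> C * (2 * sqrt (real d)) / real d"
        using C(1) by (intro divide_right_mono order_trans[OF C(2)[OF d2]] mult_left_mono ln) auto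
      also have "\<dots> = 2 * C / sqrt (real d)" using d by (simp add: field_simps)
      finally have s: "(a d / sqrt (real d))^2 \<le> 2 * C / sqrt (real d)"
        by (simp add: power_divide)
      have "(a d / sqrt (real d)) ^ (2 * (2 * k)) = ((a d / sqrt (real d))^2) ^ (2 * k)"
        by (simp only: power_mult)
      also have "\<dots> \<le> (2 * C / sqrt (real d)) ^ (2 * k)" using s by (intro power_mono) auto
      also have "\<dots> = (2 * C) ^ (2 * k) / real d ^ k"
        by (simp add: power_divide power_mult[of "sqrt (real d)"])
      finally have "real d * (a d / sqrt (real d)) ^ (2 * (2 * k)) \<le> real d * ((2 * C) ^ (2 * k) / real d ^ k)"
        by (intro mult_left_mono) auto
      also have "\<dots> = (2 * C) ^ (2 * k) * (real d powr 1 / real d powr real k)"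
        using d by (simp add: powr_realpow)
      also have "\<dots> = (2 * C) ^ (2 * k) * real d powr (1 - real k)"
        using d by (simp add: powr_diff)
      also have "\<dots> \<le> (2 * C) ^ (2 * k) * real d powr (- C)"
        using d k C by (intro mult_left_mono powr_mono) auto
      also have "\<dots> \<le> (2 * C) ^ (2 * k) * exp (- (a d)\<^sup>2)"
        using d C C(2)[OF d2] by (intro mult_left_mono) (auto simp: powr_def)
      also have "\<dots> \<le> c * exp (- (a d)\<^sup>2)" using a1 by (intro mult_right_mono) (auto simp: c_def)
      finally show ?thesis .
    qed
  qed
qed

text \<open>Only polynomial moments of \<open>g\<close> are available for the truncation, which suffices because
  \<open>exp (- (a d)\<^sup>2)\<close> decays at most polynomially in \<open>d\<close>.\<close>

lemma sluggish_deviation: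
  fixes g :: "'a \<Rightarrow> real"
  assumes a: "sluggish a" and M: "prob_space M" and g_meas[measurable]: "g \<in> borel_measurable M"
    and mom: "\<And>p. integrable M (\<lambda>x. g x ^ p)" and mean: "(\<integral>x. g x \<partial>M) = 0"
  shows "\<exists>K>0. \<exists>c>0. \<forall>d\<ge>1. \<forall>K'\<ge>K. measure (Pi\<^sub>M {1..d} (\<lambda>_. M))
      {z \<in> space (Pi\<^sub>M {1..d} (\<lambda>_. M)). K' * (a d * sqrt (real d)) \<le> (\<Sum>i\<in>{2..d}. g (z i))} \<le> c * exp (- (a d)\<^sup>2)"
proof -
  interpret M: prob_space M by fact
  obtain p c where c: "0 < c"
    and tail: "\<forall>d\<ge>1. real d * (a d / sqrt (real d)) ^ (2 * p) \<le> c * exp (- (a d)\<^sup>2)"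
    using sluggish_polynomial_tail[OF a] by (elim exE conjE)
  define q where "q = (\<integral>x. (g x)^2 \<partial>M)"
  define r where "r = (\<integral>x. g x ^ (2 * p) \<partial>M)"
  have q0: "0 \<le> q" and r0: "0 \<le> r" by (auto simp: q_def r_def intro!: integral_nonneg_AE)
  have pos: "0 < 1 + q" "0 < c * r + 1" using q0 r0 c by (auto intro: add_pos_nonneg add_nonneg_pos)
  show ?thesis
  proof (rule exI[of _ "1 + q"], rule conjI[OF pos(1)], rule exI[of _ "c * r + 1"], rule conjI[OF pos(2)], intro allI impI)
    fix d :: nat and K' assume d: "1 \<le> d" and K': "1 + q \<le> K'"
    have ad: "0 < a d" using a d by (simp add: sluggish_def)
    \<comment> \<open>With this choice the Chernoff exponent equals
      \<open>(q - K') * (a d)^2\<close>, at most \<open>- (a d)^2\<close> once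
      \<open>K' \<ge> 1 + q\<close>, and Markov's inequality at level \<open>1 / lam\<close>
      produces exactly the power in \<open>tail\<close>.\<close>
    define lam where "lam = a d / sqrt (real d)"
    have lam: "0 < lam" using ad d by (simp add: lam_def)
    have "measure M {x \<in> space M. 1 / lam \<le> g x} \<le> measure M {x \<in> space M. (1 / lam) ^ (2 * p) \<le> g x ^ (2 * p)}"
      using lam by (intro M.finite_measure_mono) (auto intro: power_mono)
    also have "\<dots> \<le> r / (1 / lam) ^ (2 * p)"
      unfolding r_def using lam by (intro integral_Markov_inequality_measure[where A="{}"] mom) auto
    also have "\<dots> = r * lam ^ (2 * p)" by (simp add: power_divide)
    finally have "real d * measure M {x \<in> space M. 1 / lam \<le> g x} \<le> real d * (r * lam ^ (2 * p))"
      by (rule mult_left_mono) simp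
    also have "\<dots> = r * (real d * lam ^ (2 * p))" by simp
    also have "\<dots> \<le> r * (c * exp (- (a d)\<^sup>2))"
      using tail[rule_format, OF d] r0 by (intro mult_left_mono) (auto simp: lam_def)
    finally have 1: "real d * measure M {x \<in> space M. 1 / lam \<le> g x} \<le> r * (c * exp (- (a d)\<^sup>2))" .
    have "real d * lam^2 * q - lam * (K' * (a d * sqrt (real d))) = (q - K') * (a d)^2"
      using d by (simp add: lam_def power_divide power2_eq_square field_simps)
    also have "\<dots> \<le> (- 1) * (a d)^2" using K' by (intro mult_right_mono) auto
    finally have 2: "exp (real d * lam^2 * q - lam * (K' * (a d * sqrt (real d)))) \<le> exp (- (a d)\<^sup>2)" by simp
    have "measure (Pi\<^sub>M {1..d} (\<lambda>_. M)) {z \<in> space (Pi\<^sub>M {1..d} (\<lambda>_. M)). K' * (a d * sqrt (real d)) \<le> (\<Sum>i\<in>{2..d}. g (z i))}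
      \<le> d * measure M {x \<in> space M. 1 / lam \<le> g x} + exp (d * lam^2 * q - lam * (K' * (a d * sqrt (real d))))"
      unfolding q_def using mom[of 1] mom[of 2] mean lam by (intro truncated_chernoff M) auto
    also have "\<dots> \<le> r * (c * exp (- (a d)\<^sup>2)) + exp (- (a d)\<^sup>2)"
      using 1 2 by (rule add_mono)
    also have "\<dots> = (c * r + 1) * exp (- (a d)\<^sup>2)" by (simp add: algebra_simps)
    finally show "measure (Pi\<^sub>M {1..d} (\<lambda>_. M))
      {z \<in> space (Pi\<^sub>M {1..d} (\<lambda>_. M)). K' * (a d * sqrt (real d)) \<le> (\<Sum>i\<in>{2..d}. g (z i))} \<le> (c * r + 1) * exp (- (a d)\<^sup>2)" .
  qed
qed

section \<open>Tails of the target density and integration by parts\<close>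

lemma integrable_exp_neg_abs: "integrable lborel (\<lambda>x::real. exp (- \<bar>x\<bar>))"
proof -
  have "prob_space (density lborel (exponential_density 1))"
    by (rule prob_space_exponential_density) simp
  then have "emeasure (density lborel (exponential_density 1)) UNIV = 1"
    by (auto dest: prob_space.emeasure_space_1)
  then have "(\<integral>\<^sup>+x. ennreal (exponential_density 1 x) \<partial>lborel) = 1"
    by (subst (asm) emeasure_density) auto
  then have i: "integrable lborel (exponential_density 1)"
    by (intro integrableI_nonneg) (auto simp: exponential_density_def)
  then have "integrable lborel (\<lambda>x. exponential_density 1 (0 + (- 1) * x))"
    by (intro lborel_integrable_real_affine) auto
  with i have "integrable lborel (\<lambda>x. exponential_density 1 x + exponential_density 1 (0 + (- 1) * x))"
    by (rule Bochner_Integration.integrable_add)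
  then show ?thesis
    by (rule Bochner_Integration.integrable_bound) (auto simp: exponential_density_def)
qed

locale smooth_target = smooth_potential +
  fixes \<rho> :: "real \<Rightarrow> real"
  assumes \<rho>_exp: "\<And>x. \<rho> x = exp (V x)"
    and \<rho>_int: "integrable lborel \<rho>" "(\<integral>x. \<rho> x \<partial>lborel) = 1"
    and drift: "filterlim (\<lambda>x. x / \<bar>x\<bar> * V1 x) at_bot at_infinity"
begin

lemma \<rho>_pos: "0 < \<rho> x" by (simp add: \<rho>_exp)

lemma meas[measurable]:
  "\<rho> \<in> borel_measurable borel" "V1 \<in> borel_measurable borel" "V2 \<in> borel_measurable borel"
proof -
  show "\<rho> \<in> borel_measurable borel" unfolding \<rho>_exp[abs_def] by measurable
  show "V1 \<in> borel_measurable borel" "V2 \<in> borel_measurable borel"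
    using dV1 dV2 by (auto intro!: borel_measurable_continuous_onI DERIV_continuous simp: continuous_on_eq_continuous_at)
qed

text \<open>Far out the drift condition makes V x + k |x| nonincreasing away from the origin; on the
  middle interval it is bounded by the mean value estimate. Since \<open>k\<close> is arbitrary,
  \<open>\<rho>\<close> has all exponential moments.\<close>

lemma \<rho>_tail:
  assumes k: "0 \<le> k"
  obtains A where "0 < A" "\<And>x. \<rho> x \<le> A * exp (- k * \<bar>x\<bar>)"
proof -
  from drift have "eventually (\<lambda>x. x / \<bar>x\<bar> * V1 x \<le> - k) at_infinity"
    by (auto simp: filterlim_at_bot)
  then obtain b0 where b0: "\<And>x. b0 \<le> \<bar>x\<bar> \<Longrightarrow> x / \<bar>x\<bar> * V1 x \<le> - k"
    by (auto simp: eventually_at_infinity)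
  define b where "b = max b0 1"
  have b: "0 < b" "\<And>x. b \<le> x \<Longrightarrow> V1 x \<le> - k" "\<And>x. x \<le> - b \<Longrightarrow> k \<le> V1 x"
  proof -
    show "0 < b" by (simp add: b_def)
    show "V1 x \<le> - k" if "b \<le> x" for x using b0[of x] that by (auto simp: b_def)
    show "k \<le> V1 x" if "x \<le> - b" for x using b0[of x] that by (auto simp: b_def)
  qed
  define c where "c = \<bar>V b\<bar> + \<bar>V (- b)\<bar> + \<bar>V 0\<bar> + B * exp (b / 8) * b + k * b"
  have c_part: "0 \<le> B * exp (b / 8) * b" "0 \<le> k * b" using B1 b(1) k by auto
  have "V x + k * \<bar>x\<bar> \<le> c" for x
  proof -
    consider "b \<le> x" | "x \<le> - b" | "\<bar>x\<bar> \<le> b" by linarith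
    then show ?thesis
    proof cases
      case 1
      have "V x + k * x \<le> V b + k * b"
        using 1 b(2) by (intro DERIV_nonpos_imp_nonincreasing[where f="\<lambda>x. V x + k * x"])
          (force intro!: derivative_eq_intros dV)+
      then show ?thesis using 1 b(1) c_part by (simp add: c_def)
    next
      case 2
      have "V x - k * x \<le> V (- b) - k * (- b)"
        using 2 b(3) by (intro DERIV_nonneg_imp_nondecreasing[where f="\<lambda>x. V x - k * x"])
          (force intro!: derivative_eq_intros dV)+
      then show ?thesis using 2 b(1) c_part by (simp add: c_def)
    next
      case 3
      have "\<bar>V x - V 0\<bar> \<le> B * exp (\<bar>x\<bar> / 8) * \<bar>x\<bar>" using taylor1[of 0 x] by simp
      also have "\<dots> \<le> B * exp (b / 8) * b" using 3 B1 by (intro mult_mono) auto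
      finally have "\<bar>V x - V 0\<bar> \<le> B * exp (b / 8) * b" .
      moreover have "k * \<bar>x\<bar> \<le> k * b" using 3 k by (intro mult_left_mono) auto
      ultimately show ?thesis by (simp add: c_def)
    qed
  qed
  then have "\<rho> x \<le> exp c * exp (- k * \<bar>x\<bar>)" for x
    by (simp add: \<rho>_exp flip: exp_add) (smt (verit))
  then show thesis using that[of "exp c"] by simp
qed

text \<open>The tail bound at rate \<open>c + 1\<close> outweighs the growth of \<open>g\<close> and
  leaves an integrable exp (- |x|).\<close>

lemma integrable_\<rho>_exp_growth:
  fixes g :: "real \<Rightarrow> real"
  assumes [measurable]: "g \<in> borel_measurable borel" and g: "\<And>x. \<bar>g x\<bar> \<le> A * exp (c * \<bar>x\<bar>)" and c: "0 \<le> c"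
  shows "integrable lborel (\<lambda>x. \<rho> x * g x)"
proof -
  have A: "0 \<le> A" using order_trans[OF abs_ge_zero g[of 0]] by simp
  from \<rho>_tail[of "c + 1"] c obtain A' where A': "0 < A'" "\<And>x. \<rho> x \<le> A' * exp (- (c + 1) * \<bar>x\<bar>)" by auto
  have "integrable lborel (\<lambda>x::real. A' * A * exp (- \<bar>x\<bar>))" using integrable_exp_neg_abs by simp
  then show ?thesis
  proof (rule Bochner_Integration.integrable_bound)
    show "AE x in lborel. norm (\<rho> x * g x) \<le> norm (A' * A * exp (- \<bar>x\<bar>))"
    proof (rule AE_I2)
      fix x
      have "\<rho> x * \<bar>g x\<bar> \<le> (A' * exp (- (c + 1) * \<bar>x\<bar>)) * (A * exp (c * \<bar>x\<bar>))"
        using A'(2) g A' \<rho>_pos[of x] by (intro mult_mono) auto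
      also have "\<dots> = A' * A * (exp (- (c + 1) * \<bar>x\<bar>) * exp (c * \<bar>x\<bar>))" by simp
      also have "exp (- (c + 1) * \<bar>x\<bar>) * exp (c * \<bar>x\<bar>) = exp (- \<bar>x\<bar>)"
        by (simp add: algebra_simps flip: exp_add)
      finally show "norm (\<rho> x * g x) \<le> norm (A' * A * exp (- \<bar>x\<bar>))"
        using \<rho>_pos[of x] A A' by (simp add: abs_mult)
    qed
  qed simp
qed

abbreviation "\<mu> \<equiv> density lborel (\<lambda>x. ennreal (\<rho> x))"

lemma prob_space_\<mu>: "prob_space \<mu>"
proof
  have "(\<integral>\<^sup>+x. ennreal (\<rho> x) \<partial>lborel) = ennreal (\<integral>x. \<rho> x \<partial>lborel)"
    using \<rho>_int \<rho>_pos by (intro nn_integral_eq_integral) (auto intro: less_imp_le)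
  then show "emeasure \<mu> (space \<mu>) = 1" using \<rho>_int by (simp add: emeasure_density)
qed

lemma integral_\<mu>:
  fixes g :: "real \<Rightarrow> real"
  assumes [measurable]: "g \<in> borel_measurable borel"
  shows "(\<integral>x. g x \<partial>\<mu>) = (\<integral>x. \<rho> x * g x \<partial>lborel)"
  using \<rho>_pos by (subst integral_density) (auto intro: less_imp_le)

lemma integrable_\<mu>:
  fixes g :: "real \<Rightarrow> real"
  assumes [measurable]: "g \<in> borel_measurable borel" and g: "\<And>x. \<bar>g x\<bar> \<le> A * exp (c * \<bar>x\<bar>)" and c: "0 \<le> c"
  shows "integrable \<mu> (\<lambda>x. g x ^ p)"
proof -
  have "\<bar>g x ^ p\<bar> \<le> A ^ p * exp ((p * c) * \<bar>x\<bar>)" for x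
    using power_mono[OF g[of x] abs_ge_zero, of p]
    by (simp add: power_abs power_mult_distrib exp_of_nat_mult[symmetric] mult.assoc)
  then have "integrable lborel (\<lambda>x. \<rho> x * g x ^ p)"
    using c by (intro integrable_\<rho>_exp_growth[where A="A ^ p" and c="p * c"]) auto
  then show ?thesis using \<rho>_pos by (subst integrable_density) (auto intro: less_imp_le)
qed

lemma V1_sq_bound: "(V1 x)^2 \<le> B^2 * exp (1 * \<bar>x\<bar>)"
proof -
  have "(V1 x)^2 \<le> (B * exp (1/8 * \<bar>x\<bar>))^2" using power_mono[OF bV1[of x] abs_ge_zero, of 2] by simp
  also have "\<dots> = B^2 * exp (\<bar>x\<bar> / 4)" by (simp add: power_mult_distrib power2_eq_square flip: exp_add)
  also have "\<dots> \<le> B^2 * exp (1 * \<bar>x\<bar>)" by (intro mult_left_mono) auto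
  finally show ?thesis .
qed

lemma generator_bound: "\<bar>V2 x + (V1 x)^2\<bar> \<le> (B + B^2) * exp (1 * \<bar>x\<bar>)"
proof -
  have "\<bar>V2 x\<bar> \<le> B * exp (1 * \<bar>x\<bar>)"
    using bV2[of x] by (rule order_trans) (use B1 in \<open>auto intro!: mult_left_mono\<close>)
  moreover have "0 \<le> (V1 x)^2" by simp
  ultimately show ?thesis using V1_sq_bound[of x] unfolding distrib_right by linarith
qed

text \<open>Against Lebesgue measure the integrand is the derivative of
  \<open>\<rho> x * V1 x\<close>, which vanishes at both ends. This centres the empirical mean that
  governs the bias of \<open>W - N\<close>.\<close>

lemma integral_generator_eq_0: "(\<integral>x. V2 x + (V1 x)^2 \<partial>\<mu>) = 0"
proof -
  let ?F = "\<lambda>x. \<rho> x * V1 x" and ?f = "\<lambda>x. \<rho> x * (V2 x + (V1 x)^2)"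
  have d\<rho>: "(\<rho> has_real_derivative \<rho> x * V1 x) (at x)" for x
    unfolding \<rho>_exp[abs_def] by (auto intro!: derivative_eq_intros dV)
  have dF: "(?F has_real_derivative ?f x) (at x)" for x
    by (auto intro!: derivative_eq_intros d\<rho> dV1 simp: power2_eq_square algebra_simps)
  have fi: "integrable lborel ?f"
    by (intro integrable_\<rho>_exp_growth[OF _ generator_bound]) auto
  \<comment> \<open>The rate \<open>9/8 = 1 + 1/8\<close> compensates the growth of
    \<open>V1\<close> and leaves exp (- |x|).\<close>
  from \<rho>_tail[of "9/8"] obtain A where A: "0 < A" "\<And>x. \<rho> x \<le> A * exp (- (9/8) * \<bar>x\<bar>)" by auto
  have Fb: "\<bar>?F x\<bar> \<le> A * B * exp (- \<bar>x\<bar>)" for x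
  proof -
    have "\<rho> x * \<bar>V1 x\<bar> \<le> (A * exp (- (9/8) * \<bar>x\<bar>)) * (B * exp (1/8 * \<bar>x\<bar>))"
      using A bV1[of x] \<rho>_pos[of x] by (intro mult_mono) auto
    also have "\<dots> = A * B * exp (- \<bar>x\<bar>)" by (simp flip: exp_add)
    finally show ?thesis using \<rho>_pos[of x] by (simp add: abs_mult)
  qed
  have "((\<lambda>x::real. exp (- norm x)) \<longlongrightarrow> 0) at_infinity"
    by (rule filterlim_compose[OF exp_at_bot]) (subst filterlim_uminus_at_bot, simp only: minus_minus, rule filterlim_norm_at_top)
  then have "((\<lambda>x::real. A * B * exp (- norm x)) \<longlongrightarrow> 0) at_infinity"
    by (rule tendsto_mult_right_zero)
  then have "(?F \<longlongrightarrow> 0) at_infinity"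
    by (rule Lim_null_comparison[rotated]) (use Fb in auto)
  then have "(?F \<longlongrightarrow> 0) at_top" "(?F \<longlongrightarrow> 0) at_bot"
    by (auto intro: tendsto_mono at_top_le_at_infinity at_bot_le_at_infinity)
  then have "(LBINT x=-\<infinity>..\<infinity>. ?f x) = 0 - 0"
  proof (intro interval_integral_FTC_integrable)
    show "(?F has_vector_derivative ?f x) (at x)" for x
      using dF[of x] by (simp add: has_real_derivative_iff_has_vector_derivative)
    show "isCont ?f x" for x
      using DERIV_isCont[OF d\<rho>] DERIV_isCont[OF dV1] DERIV_isCont[OF dV2] by (intro continuous_intros) auto
  qed (use fi in \<open>auto simp: ereal_tendsto_simps set_integrable_def\<close>)
  then have "(\<integral>x. ?f x \<partial>lborel) = 0"
    by (simp add: interval_lebesgue_integral_def set_lebesgue_integral_def)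
  then show ?thesis by (subst integral_\<mu>) auto
qed

definition "J = (\<integral>x. (V1 x)^2 \<partial>\<mu>)"

text \<open>If \<open>J\<close> were \<open>0\<close>, then \<open>V1\<close> would vanish almost
  everywhere, but the drift condition forces |V1| \<ge> 1 far out. Positivity keeps the standard
  deviation of \<open>N\<close> away from \<open>0\<close>.\<close>

lemma J_pos: "0 < J"
proof -
  have i: "integrable \<mu> (\<lambda>x. (V1 x)^2)"
    by (rule integrable_\<mu>[of V1 B "1/8" 2]) (use bV1 in auto)
  have "J \<noteq> 0"
  proof
    assume "J = 0"
    then have "AE x in \<mu>. (V1 x)^2 = 0"
      using i unfolding J_def by (subst (asm) integral_nonneg_eq_0_iff_AE) auto
    then have ae: "AE x in lborel. V1 x = 0"
      by (subst (asm) AE_density) (auto simp: \<rho>_pos)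
    from drift have "eventually (\<lambda>x. x / \<bar>x\<bar> * V1 x \<le> - 1) at_infinity"
      by (auto simp: filterlim_at_bot)
    then obtain b where b: "\<And>x. b \<le> \<bar>x\<bar> \<Longrightarrow> x / \<bar>x\<bar> * V1 x \<le> - 1"
      by (auto simp: eventually_at_infinity)
    from ae have "AE x in lborel. x \<notin> {\<bar>b\<bar>..\<bar>b\<bar> + 1}"
    proof eventually_elim
      case (elim x)
      moreover have "b \<le> \<bar>x\<bar>" if "x \<in> {\<bar>b\<bar>..\<bar>b\<bar> + 1}" using that by auto
      ultimately show ?case using b[of x] by auto
    qed
    then have "{\<bar>b\<bar>..\<bar>b\<bar> + 1} \<in> null_sets lborel"
      by (subst (asm) AE_iff_null_sets[symmetric]) auto
    then show False by auto
  qed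
  moreover have "0 \<le> J" unfolding J_def by (intro integral_nonneg_AE) auto
  ultimately show ?thesis by simp
qed

end

lemma sluggish_ratio_tendsto_0:
  assumes "sluggish a"
  shows "(\<lambda>d. a d / sqrt (real d)) \<longlonglongrightarrow> 0"
proof -
  from sluggish_bounds(2)[OF assms] obtain C where C: "0 < C" "\<And>d. 2 \<le> d \<Longrightarrow> (a d)^2 \<le> C * ln (real d)" by blast
  have "(\<lambda>d. sqrt (C * (ln (real d) / real d))) \<longlonglongrightarrow> sqrt (C * 0)"
    by (intro tendsto_real_sqrt tendsto_mult tendsto_const lim_ln_over_n)
  then have lim: "(\<lambda>d. sqrt (C * (ln (real d) / real d))) \<longlonglongrightarrow> 0" by simp
  show ?thesis
  proof (rule Lim_null_comparison[OF _ lim])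
    show "\<forall>\<^sub>F d in sequentially. norm (a d / sqrt (real d)) \<le> sqrt (C * (ln (real d) / real d))"
      using eventually_ge_at_top[of 2]
    proof eventually_elim
      case (elim d)
      have "\<bar>a d / sqrt (real d)\<bar>^2 = (a d)^2 / real d" by (simp add: power_divide)
      also have "\<dots> \<le> C * (ln (real d) / real d)" using C(2)[OF elim] by (simp add: divide_right_mono)
      finally show ?case unfolding real_norm_def by (rule real_le_rsqrt)
    qed
  qed
qed

section \<open>Typical points and their probability\<close>

context smooth_target
begin

lemma rho_d_measure_eq: "rho_d_measure \<rho> d = Pi\<^sub>M {1..d} (\<lambda>_. \<mu>)"
proof -
  have "rho_d_measure \<rho> d = density (lborel_d d) (\<lambda>z. \<Prod>i\<in>{1..d}. ennreal (\<rho> (z i)))"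
    unfolding rho_d_measure_def rho_d_def using \<rho>_pos by (simp add: prod_ennreal less_imp_le)
  also have "\<dots> = Pi\<^sub>M {1..d} (\<lambda>_. \<mu>)"
    by (intro density_PiM[where g="\<lambda>_ x. ennreal (\<rho> x)"])
       (auto intro: prob_space_imp_sigma_finite prob_space_\<mu> sigma_finite_lborel)
  finally show ?thesis .
qed

text \<open>The one-sided bound is applied to the centred \<open>g\<close> and to its negative.
  Allowing every \<open>K' \<ge> K\<close> lets several functions share one threshold later.\<close>

lemma deviation:
  assumes a: "sluggish a" and g[measurable]: "g \<in> borel_measurable borel"
    and b: "\<And>x. \<bar>g x\<bar> \<le> A * exp (1 * \<bar>x\<bar>)" and mean: "(\<integral>x. g x \<partial>\<mu>) = m"
  shows "\<exists>K>0. \<exists>c>0. \<forall>d\<ge>1. \<forall>K'\<ge>K. measure (rho_d_measure \<rho> d)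
      {z \<in> space (lborel_d d). K' * (a d * sqrt (real d)) \<le> (\<Sum>i\<in>{2..d}. g (z i) - m)} \<le> c * exp (- (a d)\<^sup>2) \<and>
    measure (rho_d_measure \<rho> d)
      {z \<in> space (lborel_d d). K' * (a d * sqrt (real d)) \<le> - (\<Sum>i\<in>{2..d}. g (z i) - m)} \<le> c * exp (- (a d)\<^sup>2)"
proof -
  interpret M: prob_space \<mu> by (rule prob_space_\<mu>)
  have A: "0 \<le> A" using order_trans[OF abs_ge_zero b[of 0]] by simp
  have gi: "integrable \<mu> g" using integrable_\<mu>[OF g b, of 1] by simp
  have b': "\<bar>g x - m\<bar> \<le> (A + \<bar>m\<bar>) * exp (1 * \<bar>x\<bar>)" "\<bar>- (g x - m)\<bar> \<le> (A + \<bar>m\<bar>) * exp (1 * \<bar>x\<bar>)" for x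
  proof -
    have "\<bar>m\<bar> * 1 \<le> \<bar>m\<bar> * exp (1 * \<bar>x\<bar>)" by (intro mult_left_mono) auto
    then show "\<bar>g x - m\<bar> \<le> (A + \<bar>m\<bar>) * exp (1 * \<bar>x\<bar>)" "\<bar>- (g x - m)\<bar> \<le> (A + \<bar>m\<bar>) * exp (1 * \<bar>x\<bar>)"
      using b[of x] unfolding distrib_right by linarith+
  qed
  have sp: "space (Pi\<^sub>M {1..d} (\<lambda>_. \<mu>)) = space (lborel_d d)" for d by (simp add: space_PiM)
  have g1: "(\<lambda>x. g x - m) \<in> borel_measurable \<mu>" "(\<lambda>x. - (g x - m)) \<in> borel_measurable \<mu>" by auto
  have i1: "integrable \<mu> (\<lambda>x. (g x - m) ^ p)" "integrable \<mu> (\<lambda>x. (- (g x - m)) ^ p)" for p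
    by (rule integrable_\<mu>[OF _ b'(1)] integrable_\<mu>[OF _ b'(2)]; simp)+
  have m1: "(\<integral>x. g x - m \<partial>\<mu>) = 0" "(\<integral>x. - (g x - m) \<partial>\<mu>) = 0"
    using gi mean M.prob_space by (simp_all add: Bochner_Integration.integral_diff)
  from sluggish_deviation[OF a prob_space_\<mu> g1(1) i1(1) m1(1)]
  obtain K1 c1 where 1: "0 < K1" "0 < c1"
    "\<forall>d\<ge>1. \<forall>K'\<ge>K1. measure (rho_d_measure \<rho> d)
      {z \<in> space (lborel_d d). K' * (a d * sqrt (real d)) \<le> (\<Sum>i\<in>{2..d}. g (z i) - m)} \<le> c1 * exp (- (a d)\<^sup>2)"
    unfolding rho_d_measure_eq sp by (elim exE conjE)
  from sluggish_deviation[OF a prob_space_\<mu> g1(2) i1(2) m1(2)]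
  obtain K2 c2 where 2: "0 < K2" "0 < c2"
    "\<forall>d\<ge>1. \<forall>K'\<ge>K2. measure (rho_d_measure \<rho> d)
      {z \<in> space (lborel_d d). K' * (a d * sqrt (real d)) \<le> (\<Sum>i\<in>{2..d}. - (g (z i) - m))} \<le> c2 * exp (- (a d)\<^sup>2)"
    unfolding rho_d_measure_eq sp by (elim exE conjE)
  have pos: "0 < max K1 K2" "0 < max c1 c2" using 1(1,2) by auto
  show ?thesis
  proof (rule exI[of _ "max K1 K2"], rule conjI[OF pos(1)], rule exI[of _ "max c1 c2"], rule conjI[OF pos(2)], intro allI impI conjI)
    fix d K' assume d: "1 \<le> (d::nat)" and "max K1 K2 \<le> K'"
    then have K: "K1 \<le> K'" "K2 \<le> K'" by auto
    have le: "c1 * exp (- (a d)\<^sup>2) \<le> max c1 c2 * exp (- (a d)\<^sup>2)" "c2 * exp (- (a d)\<^sup>2) \<le> max c1 c2 * exp (- (a d)\<^sup>2)"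
      by (intro mult_right_mono; simp)+
    show "measure (rho_d_measure \<rho> d)
      {z \<in> space (lborel_d d). K' * (a d * sqrt (real d)) \<le> (\<Sum>i\<in>{2..d}. g (z i) - m)} \<le> max c1 c2 * exp (- (a d)\<^sup>2)"
      using 1(3)[rule_format, OF d K(1)] le(1) by (rule order_trans)
    show "measure (rho_d_measure \<rho> d)
      {z \<in> space (lborel_d d). K' * (a d * sqrt (real d)) \<le> - (\<Sum>i\<in>{2..d}. g (z i) - m)} \<le> max c1 c2 * exp (- (a d)\<^sup>2)"
      using 2(3)[rule_format, OF d K(2)] le(2) unfolding sum_negf by (rule order_trans)
  qed
qed

text \<open>The first coordinate is left free: it is treated by its own expansion, at the cost of
  the weight exp |x 1|. The thresholds correspond to deviations of order \<open>a d / sqrt d\<close>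
  of the averages. The last condition is one-sided because the exponential weights only have to be
  bounded from above.\<close>

definition typical :: "(nat \<Rightarrow> real) \<Rightarrow> real \<Rightarrow> real \<Rightarrow> nat \<Rightarrow> (nat \<Rightarrow> real) set" where
  "typical a K m d = {x \<in> space (lborel_d d).
     \<bar>\<Sum>i\<in>{2..d}. (V1 (x i))^2 - J\<bar> < K * (a d * sqrt (real d)) \<and>
     \<bar>\<Sum>i\<in>{2..d}. V2 (x i) + (V1 (x i))^2\<bar> < K * (a d * sqrt (real d)) \<and>
     (\<Sum>i\<in>{2..d}. exp (\<bar>x i\<bar> / 2) - m) < K * (a d * sqrt (real d))}"

lemma component_meas: "i \<in> {2..d} \<Longrightarrow> (\<lambda>z. z i) \<in> borel_measurable (lborel_d d)"
  using measurable_component_singleton[of i "{1..d}" "\<lambda>_. lborel"] by simp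

lemma typical_sets: "typical a K m d \<in> sets (lborel_d d)"
proof -
  note component_meas[measurable]
  show ?thesis unfolding typical_def by measurable
qed

lemma typical_probability:
  assumes a: "sluggish a"
  obtains K m c where "0 < K" "0 \<le> m" "0 < c"
    "\<And>d. 1 \<le> d \<Longrightarrow> measure (rho_d_measure \<rho> d) (space (lborel_d d) - typical a K m d) \<le> c * exp (- (a d)\<^sup>2)"
proof -
  define m where "m = (\<integral>x. exp (\<bar>x\<bar> / 2) \<partial>\<mu>)"
  have b1: "\<bar>(V1 x)^2\<bar> \<le> B^2 * exp (1 * \<bar>x\<bar>)" for x using V1_sq_bound by simp
  have b3: "\<bar>exp (\<bar>x\<bar> / 2)\<bar> \<le> 1 * exp (1 * \<bar>x\<bar>)" for x :: real by simp
  have gm: "(\<lambda>x. (V1 x)^2) \<in> borel_measurable borel" "(\<lambda>x. V2 x + (V1 x)^2) \<in> borel_measurable borel"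
    "(\<lambda>x::real. exp (\<bar>x\<bar> / 2)) \<in> borel_measurable borel"
    by measurable
  obtain K1 c1 where 1: "0 < K1" "0 < c1"
    "\<forall>d\<ge>1. \<forall>K'\<ge>K1. measure (rho_d_measure \<rho> d)
      {z \<in> space (lborel_d d). K' * (a d * sqrt (real d)) \<le> (\<Sum>i\<in>{2..d}. (V1 (z i))^2 - J)} \<le> c1 * exp (- (a d)\<^sup>2) \<and>
     measure (rho_d_measure \<rho> d)
      {z \<in> space (lborel_d d). K' * (a d * sqrt (real d)) \<le> - (\<Sum>i\<in>{2..d}. (V1 (z i))^2 - J)} \<le> c1 * exp (- (a d)\<^sup>2)"
    using deviation[OF a gm(1) b1 J_def[symmetric]] by (elim exE conjE)
  obtain K2 c2 where 2: "0 < K2" "0 < c2"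
    "\<forall>d\<ge>1. \<forall>K'\<ge>K2. measure (rho_d_measure \<rho> d)
      {z \<in> space (lborel_d d). K' * (a d * sqrt (real d)) \<le> (\<Sum>i\<in>{2..d}. V2 (z i) + (V1 (z i))^2 - 0)} \<le> c2 * exp (- (a d)\<^sup>2) \<and>
     measure (rho_d_measure \<rho> d)
      {z \<in> space (lborel_d d). K' * (a d * sqrt (real d)) \<le> - (\<Sum>i\<in>{2..d}. V2 (z i) + (V1 (z i))^2 - 0)} \<le> c2 * exp (- (a d)\<^sup>2)"
    using deviation[OF a gm(2) generator_bound integral_generator_eq_0] by (elim exE conjE)
  obtain K3 c3 where 3: "0 < K3" "0 < c3"
    "\<forall>d\<ge>1. \<forall>K'\<ge>K3. measure (rho_d_measure \<rho> d)
      {z \<in> space (lborel_d d). K' * (a d * sqrt (real d)) \<le> (\<Sum>i\<in>{2..d}. exp (\<bar>z i\<bar> / 2) - m)} \<le> c3 * exp (- (a d)\<^sup>2) \<and>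
     measure (rho_d_measure \<rho> d)
      {z \<in> space (lborel_d d). K' * (a d * sqrt (real d)) \<le> - (\<Sum>i\<in>{2..d}. exp (\<bar>z i\<bar> / 2) - m)} \<le> c3 * exp (- (a d)\<^sup>2)"
    using deviation[OF a gm(3) b3 m_def[symmetric]] by (elim exE conjE)
  define K where "K = max K1 (max K2 K3)"
  have K: "K1 \<le> K" "K2 \<le> K" "K3 \<le> K" by (auto simp: K_def)
  show thesis
  \<comment> \<open>The constant counts five events: two for each two-sided condition and one for
    the one-sided condition.\<close>
  proof (rule that[of K m "2 * c1 + 2 * c2 + c3"])
    fix d :: nat assume d: "1 \<le> d"
    interpret P: prob_space "rho_d_measure \<rho> d"
      unfolding rho_d_measure_eq by (intro prob_space_PiM prob_space_\<mu>)
    let ?t = "K * (a d * sqrt (real d))"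
    let ?S = "\<lambda>h :: (nat \<Rightarrow> real) \<Rightarrow> real. {z \<in> space (lborel_d d). ?t \<le> h z}"
    let ?U = "?S (\<lambda>z. \<Sum>i\<in>{2..d}. (V1 (z i))^2 - J) \<union>
      (?S (\<lambda>z. - (\<Sum>i\<in>{2..d}. (V1 (z i))^2 - J)) \<union>
      (?S (\<lambda>z. \<Sum>i\<in>{2..d}. V2 (z i) + (V1 (z i))^2 - 0) \<union>
      (?S (\<lambda>z. - (\<Sum>i\<in>{2..d}. V2 (z i) + (V1 (z i))^2 - 0)) \<union> ?S (\<lambda>z. \<Sum>i\<in>{2..d}. exp (\<bar>z i\<bar> / 2) - m))))"
    note component_meas[measurable]
    have S: "?S h \<in> sets (lborel_d d)" if [measurable]: "h \<in> borel_measurable (lborel_d d)" for h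
      by measurable
    have m1: "?S (\<lambda>z. \<Sum>i\<in>{2..d}. (V1 (z i))^2 - J) \<in> sets (lborel_d d)"
      "?S (\<lambda>z. - (\<Sum>i\<in>{2..d}. (V1 (z i))^2 - J)) \<in> sets (lborel_d d)"
      "?S (\<lambda>z. \<Sum>i\<in>{2..d}. V2 (z i) + (V1 (z i))^2 - 0) \<in> sets (lborel_d d)"
      "?S (\<lambda>z. - (\<Sum>i\<in>{2..d}. V2 (z i) + (V1 (z i))^2 - 0)) \<in> sets (lborel_d d)"
      "?S (\<lambda>z. \<Sum>i\<in>{2..d}. exp (\<bar>z i\<bar> / 2) - m) \<in> sets (lborel_d d)"
      by (rule S, measurable)+
    have sets: "sets (rho_d_measure \<rho> d) = sets (lborel_d d)" by (simp add: rho_d_measure_def)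
    note dv = 1(3)[rule_format, OF d K(1), THEN conjunct1] 1(3)[rule_format, OF d K(1), THEN conjunct2]
      2(3)[rule_format, OF d K(2), THEN conjunct1] 2(3)[rule_format, OF d K(2), THEN conjunct2]
      3(3)[rule_format, OF d K(3), THEN conjunct1]
    have un: "measure (rho_d_measure \<rho> d) (X \<union> Y) \<le> x + y"
      if "X \<in> sets (lborel_d d)" "Y \<in> sets (lborel_d d)"
        "measure (rho_d_measure \<rho> d) X \<le> x" "measure (rho_d_measure \<rho> d) Y \<le> y" for X Y x y
      using measure_Un_le[of X "rho_d_measure \<rho> d" Y] that by (simp add: sets)
    have "measure (rho_d_measure \<rho> d) (space (lborel_d d) - typical a K m d) \<le> measure (rho_d_measure \<rho> d) ?U"
    proof (rule P.finite_measure_mono)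
      have split: "t \<le> p \<or> t \<le> - p \<or> t \<le> q \<or> t \<le> - q \<or> t \<le> r"
        if "\<not> (\<bar>p\<bar> < t \<and> \<bar>q\<bar> < t \<and> r < t)" for p q r t :: real
        using that by linarith
      show "space (lborel_d d) - typical a K m d \<subseteq> ?U"
      proof
        fix z assume z: "z \<in> space (lborel_d d) - typical a K m d"
        then have "\<not> (\<bar>\<Sum>i\<in>{2..d}. (V1 (z i))^2 - J\<bar> < ?t \<and> \<bar>\<Sum>i\<in>{2..d}. V2 (z i) + (V1 (z i))^2 - 0\<bar> < ?t \<and>
          (\<Sum>i\<in>{2..d}. exp (\<bar>z i\<bar> / 2) - m) < ?t)"
          unfolding typical_def diff_0_right by blast
        from split[OF this] z show "z \<in> ?U"
          by blast
      qed
    qed (unfold sets, intro sets.Un m1)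
    also have "\<dots> \<le> c1 * exp (- (a d)\<^sup>2) + (c1 * exp (- (a d)\<^sup>2) + (c2 * exp (- (a d)\<^sup>2) + (c2 * exp (- (a d)\<^sup>2) + c3 * exp (- (a d)\<^sup>2))))"
      by (intro un sets.Un m1 dv)
    also have "\<dots> = (2 * c1 + 2 * c2 + c3) * exp (- (a d)\<^sup>2)" by (simp add: algebra_simps)
    finally show "measure (rho_d_measure \<rho> d) (space (lborel_d d) - typical a K m d) \<le> (2 * c1 + 2 * c2 + c3) * exp (- (a d)\<^sup>2)" .
  next
    show "0 \<le> m" unfolding m_def by (intro integral_nonneg_AE) auto
  qed (use 1(1,2) 2(1,2) 3(1,2) K in auto)
qed


section \<open>The generator error at typical points\<close>

lemma generator_error_on_typical:
  assumes a: "sluggish a" and l: "0 < l" and K: "0 < K" and m: "0 \<le> m"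
  obtains d0 C where "1 \<le> d0" "0 < C"
    "\<And>d x f f1 f2 f3 F. \<lbrakk>d0 \<le> d; x \<in> typical a K m d;
      \<And>x. (f has_real_derivative f1 x) (at x); \<And>x. (f1 has_real_derivative f2 x) (at x);
      \<And>x. (f2 has_real_derivative f3 x) (at x);
      \<And>x. \<bar>f1 x\<bar> \<le> F * exp (1/2 * \<bar>x\<bar>); \<And>x. \<bar>f2 x\<bar> \<le> F * exp (1/2 * \<bar>x\<bar>);
      \<And>x. \<bar>f3 x\<bar> \<le> F * exp (1/2 * \<bar>x\<bar>)\<rbrakk> \<Longrightarrow>
      \<bar>l^2 * cdf \<gamma> (- l * sqrt J / 2) * (f2 (x 1) + V1 (x 1) * f1 (x 1))
        - gen_d \<rho> l d (\<lambda>y. f (y 1)) x\<bar> \<le> C * F * exp \<bar>x 1\<bar> * (a d / sqrt (real d))"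
proof -
  from sluggish_bounds(1)[OF a] obtain am where am: "0 < am" "\<And>d. 1 \<le> d \<Longrightarrow> am \<le> a d" by blast
  from sluggish_bounds(2)[OF a] obtain C0 where C0: "0 < C0" "\<And>d. 2 \<le> d \<Longrightarrow> (a d)^2 \<le> C0 * ln (real d)" by blast
  define \<theta> where "\<theta> = cdf \<gamma> (- l * sqrt J / 2)"
  \<comment> \<open>\<open>L\<close> collects what the error scale has to absorb: the threshold
    \<open>K\<close>, the one missing coordinate through \<open>J / am\<close>, and
    \<open>1 / sqrt d\<close> through \<open>1 / am\<close>.\<close>
  define L where "L = K + J / am + 1 / am"
  \<comment> \<open>The second summand bounds the permitted deviation, because
    \<open>(a d)^2 \<le> C0 * d\<close>.\<close>
  define K3 where "K3 = m + K * sqrt C0"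
  \<comment> \<open>With \<open>\<tau> = l * sqrt J\<close>, passing from squares to roots divides
    by \<open>T + \<tau> \<ge> \<tau>\<close>; as the squares differ by at most
    \<open>l^2 * k\<close>, the roots differ by at most \<open>e * k\<close>.\<close>
  define e where "e = l / sqrt J"
  have J: "0 < J" by (rule J_pos)
  have L: "0 < L" "K \<le> L" "K + J / am \<le> L" "1 / am \<le> L"
    using K J am by (auto simp: L_def intro!: add_pos_nonneg)
  have K3: "0 \<le> K3" using m K C0 by (simp add: K3_def)
  have e: "0 < e" using l J by (simp add: e_def)
  have th: "0 \<le> \<theta>" "\<theta> \<le> 1"
    using prob_space.prob_le_1[OF prob_space_std_normal] by (auto simp: \<theta>_def cdf_def)
  obtain C1 where C1: "0 < C1" and acc:
    "\<And>(I :: nat set) x n k \<sigma> u. \<lbrakk>finite I; I \<noteq> {}; 1 \<le> n; \<sigma> = l / sqrt n; 1 / sqrt n \<le> k;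
       J / 2 * n \<le> (\<Sum>i\<in>I. (V1 (x i))^2); \<bar>\<Sum>i\<in>I. V2 (x i) + (V1 (x i))^2\<bar> \<le> k * n;
       (\<Sum>i\<in>I. exp (\<bar>x i\<bar> / 2)) \<le> K3 * n\<rbrakk> \<Longrightarrow>
     \<bar>(\<integral>z. accept (log_ratio I x \<sigma> z) \<partial>Pi\<^sub>M I (\<lambda>_. \<gamma>))
        - 2 * cdf \<gamma> (- (\<sigma> * sqrt (\<Sum>i\<in>I. (V1 (x i))^2)) / 2)\<bar> \<le> C1 * k \<and>
     \<bar>(\<integral>z. accept (log_ratio I x \<sigma> z + u) \<partial>Pi\<^sub>M I (\<lambda>_. \<gamma>))
        - (\<integral>z. accept (log_ratio I x \<sigma> z) \<partial>Pi\<^sub>M I (\<lambda>_. \<gamma>))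
        - u * cdf \<gamma> (- (\<sigma> * sqrt (\<Sum>i\<in>I. (V1 (x i))^2)) / 2)\<bar>
      \<le> C1 * \<bar>u\<bar> * (k + \<bar>u\<bar>)"
    using accept_log_ratio[OF l half_gt_zero[OF J] K3] by blast
  \<comment> \<open>The summand \<open>2 * e\<close> pays for replacing \<open>\<theta>'\<close> by
    \<open>\<theta>\<close> in the mean acceptance, where it occurs doubled.\<close>
  define D where "D = C1 + 2 * e"
  have D: "0 < D" using C1 e by (simp add: D_def add_pos_pos)
  define C2 where "C2 = (D * B + D * B^2 * l + 3 * B * l + D + 6 * l) * (2 * exp ((2 * l + 3)^2 / 2))"
  have C2: "0 < C2" using D B1 l by (auto simp: C2_def intro!: mult_pos_pos add_pos_pos)
  have "\<forall>\<^sub>F d in sequentially. a d / sqrt (real d) < J / (4 * K)"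
    using sluggish_ratio_tendsto_0[OF a] J K by (intro order_tendstoD) auto
  then obtain d1 where d1: "\<And>d. d1 \<le> d \<Longrightarrow> a d / sqrt (real d) < J / (4 * K)"
    by (auto simp: eventually_sequentially)
  \<comment> \<open>Beyond \<open>d1\<close> the deviation is at most \<open>J / 4 * d\<close>, and
    \<open>d \<ge> 4\<close> makes the missing coordinate cost at most as much;
    \<open>J / 2 * d\<close> remains as the lower bound for \<open>S\<close>.\<close>
  define d0 where "d0 = max d1 4"
  show thesis
  proof (rule that[of d0 "l^2 * C2 * L"])
    show "1 \<le> d0" by (simp add: d0_def)
    show "0 < l^2 * C2 * L" using l C2 L by simp
    fix d x and f f1 f2 f3 :: "real \<Rightarrow> real" and F
    assume d: "d0 \<le> d" and x: "x \<in> typical a K m d"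
      and df: "\<And>x. (f has_real_derivative f1 x) (at x)" "\<And>x. (f1 has_real_derivative f2 x) (at x)"
        "\<And>x. (f2 has_real_derivative f3 x) (at x)"
      and bf: "\<And>x. \<bar>f1 x\<bar> \<le> F * exp (1/2 * \<bar>x\<bar>)" "\<And>x. \<bar>f2 x\<bar> \<le> F * exp (1/2 * \<bar>x\<bar>)"
        "\<And>x. \<bar>f3 x\<bar> \<le> F * exp (1/2 * \<bar>x\<bar>)"
    have d4: "4 \<le> d" "1 \<le> d" "2 \<le> d" and dd: "a d / sqrt (real d) < J / (4 * K)"
      using d d1[of d] by (auto simp: d0_def)
    have sd: "0 < sqrt (real d)" "sqrt (real d) * sqrt (real d) = real d" using d4 by auto
    have ad: "am \<le> a d" "0 < a d" using am d4 by (auto intro: less_le_trans)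
    define I where "I = {2..d}"
    have I: "finite I" "I \<noteq> {}" "card I = d - 1" using d4 by (auto simp: I_def)
    define \<sigma> where "\<sigma> = l / sqrt (real d)"
    define k where "k = L * (a d / sqrt (real d))"
    define S where "S = (\<Sum>i\<in>I. (V1 (x i))^2)"
    have t: "a d * sqrt (real d) = (a d / sqrt (real d)) * real d" using sd by (simp add: field_simps)
    have x1: "\<bar>S - (real d - 1) * J\<bar> < K * (a d * sqrt (real d))"
      and x2: "\<bar>\<Sum>i\<in>I. V2 (x i) + (V1 (x i))^2\<bar> < K * (a d * sqrt (real d))"
      and x3: "(\<Sum>i\<in>I. exp (\<bar>x i\<bar> / 2)) - (real d - 1) * m < K * (a d * sqrt (real d))"
      using x I d4 by (auto simp: typical_def S_def sum_subtractf of_nat_diff simp flip: I_def)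
    have \<sigma>: "0 < \<sigma>" "\<sigma> \<le> l" using sd l d4 by (auto simp: \<sigma>_def field_simps)
    have k1: "1 / sqrt (real d) \<le> k"
    proof -
      have "1 \<le> L * a d"
        using mult_mono[OF L(4) ad(1)] am L by simp
      then show ?thesis using sd by (simp add: k_def divide_right_mono)
    qed
    have k0: "0 \<le> k" using k1 sd by (smt (verit) divide_pos_pos)
    have H1: "J / 2 * real d \<le> S"
    proof -
      have "K * (a d * sqrt (real d)) \<le> J / 4 * real d"
      proof -
        have "K * (a d * sqrt (real d)) = (K * real d) * (a d / sqrt (real d))" unfolding t by (simp only: mult_ac)
        also have "\<dots> \<le> (K * real d) * (J / (4 * K))"
          using K by (intro mult_left_mono less_imp_le[OF dd]) auto
        also have "\<dots> = J / 4 * real d" using K by simp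
        finally show ?thesis .
      qed
      moreover have "J \<le> J / 4 * real d" using J d4 by simp
      ultimately show ?thesis using x1 by (simp add: algebra_simps)
    qed
    have H2: "\<bar>\<Sum>i\<in>I. V2 (x i) + (V1 (x i))^2\<bar> \<le> k * real d"
    proof -
      have "K * (a d * sqrt (real d)) \<le> L * (a d * sqrt (real d))" using L ad by (intro mult_right_mono) auto
      then show ?thesis using x2 unfolding k_def t by simp
    qed
    have H3: "(\<Sum>i\<in>I. exp (\<bar>x i\<bar> / 2)) \<le> K3 * real d"
    proof -
      have "ln (real d) \<le> real d" using ln_le_minus_one[of "real d"] d4 by simp
      then have "(a d)^2 \<le> C0 * real d"
        using C0 d4 by (intro order_trans[OF C0(2)] mult_left_mono) auto
      then have "a d \<le> sqrt (C0 * real d)" by (rule real_le_rsqrt)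
      then have "a d * sqrt (real d) \<le> sqrt (C0 * real d) * sqrt (real d)" by (rule mult_right_mono) simp
      also have "\<dots> = sqrt C0 * real d" by (simp add: real_sqrt_mult)
      finally have "K * (a d * sqrt (real d)) \<le> K * (sqrt C0 * real d)" using K by (intro mult_left_mono) auto
      moreover have "(real d - 1) * m \<le> real d * m" using m by (intro mult_right_mono) auto
      ultimately show ?thesis using x3 by (simp add: K3_def algebra_simps)
    qed
    define \<theta>' where "\<theta>' = cdf \<gamma> (- (\<sigma> * sqrt S) / 2)"
    have th': "\<bar>\<theta>' - \<theta>\<bar> \<le> e * k"
    proof -
      define T where "T = \<sigma> * sqrt S"
      define \<tau> where "\<tau> = l * sqrt J"
      have S0: "0 \<le> S" by (auto simp: S_def intro: sum_nonneg)
      have T0: "0 \<le> T" "0 < \<tau>" using \<sigma> S0 l J by (auto simp: T_def \<tau>_def)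
      have diff: "T^2 - \<tau>^2 = l^2 / real d * (S - real d * J)"
        using S0 J d4 by (simp add: T_def \<tau>_def \<sigma>_def power_mult_distrib power_divide field_simps)
      \<comment> \<open>The centre is moved from \<open>(d - 1) * J\<close> to \<open>d * J\<close>;
        the extra \<open>J\<close> is absorbed by means of the lower bound \<open>am\<close> of the
        sequence.\<close>
      have S_near: "\<bar>S - real d * J\<bar> \<le> k * real d"
      proof -
        have "J * am \<le> J * (a d * sqrt (real d))"
        proof (rule mult_left_mono)
          have "am * 1 \<le> a d * sqrt (real d)" using ad am d4 by (intro mult_mono) auto
          then show "am \<le> a d * sqrt (real d)" by simp
        qed (use J in simp)
        then have "J \<le> J / am * (a d * sqrt (real d))" using am by (simp add: field_simps)
        moreover have "(K + J / am) * (a d * sqrt (real d)) \<le> L * (a d * sqrt (real d))"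
          using L ad by (intro mult_right_mono) auto
        moreover have "k * real d = L * (a d * sqrt (real d))" unfolding k_def t by simp
        ultimately show ?thesis using x1 J by (simp add: distrib_right left_diff_distrib)
      qed
      have "\<bar>T^2 - \<tau>^2\<bar> = l^2 / real d * \<bar>S - real d * J\<bar>" by (simp add: diff abs_mult)
      also have "\<dots> \<le> l^2 / real d * (k * real d)" by (rule mult_left_mono[OF S_near]) simp
      also have "\<dots> = l^2 * k" using d4 by simp
      finally have sq: "\<bar>T^2 - \<tau>^2\<bar> \<le> l^2 * k" .
      have "\<bar>T - \<tau>\<bar> * \<tau> \<le> \<bar>T - \<tau>\<bar> * (T + \<tau>)" using T0 by (intro mult_left_mono) auto
      also have "\<dots> = \<bar>T^2 - \<tau>^2\<bar>"
        using T0 by (simp add: square_diff_square_factored power2_eq_square abs_mult mult.commute)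
      also note sq
      finally have "\<bar>T - \<tau>\<bar> \<le> l^2 * k / \<tau>" using T0 by (simp add: pos_le_divide_eq)
      also have "\<dots> = e * k" using l by (simp add: \<tau>_def e_def power2_eq_square)
      finally have "\<bar>T - \<tau>\<bar> \<le> e * k" .
      moreover have "\<bar>\<theta>' - \<theta>\<bar> \<le> \<bar>- T / 2 - (- \<tau> / 2)\<bar> / 2"
        using std_normal_cdf_lipschitz[of "- T / 2" "- \<tau> / 2"] by (simp add: \<theta>'_def \<theta>_def T_def \<tau>_def)
      moreover have "\<bar>- T / 2 - (- \<tau> / 2)\<bar> / 2 \<le> \<bar>T - \<tau>\<bar>" by (simp add: abs_if)
      ultimately show ?thesis by linarith
    qed
    interpret P: prob_space "Pi\<^sub>M I (\<lambda>_. \<gamma>)" by (intro prob_space_PiM prob_space_std_normal)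
    let ?P = "Pi\<^sub>M I (\<lambda>_. \<gamma>)"
    \<comment> \<open>The mean acceptance given that the first coordinate changes its log-density by
      \<open>u\<close>.\<close>
    define \<psi> where "\<psi> u = (\<integral>w. accept (log_ratio I x \<sigma> w + u) \<partial>?P)" for u
    have ai: "integrable ?P (\<lambda>w. accept (log_ratio I x \<sigma> w + u))" for u
      by (rule P.integrable_const_bound[where B=1]) (auto simp: accept_range abs_of_nonneg)
    have \<psi>_lip: "\<bar>\<psi> u - \<psi> v\<bar> \<le> \<bar>u - v\<bar>" for u v
    proof -
      have "\<psi> u - \<psi> v = (\<integral>w. accept (log_ratio I x \<sigma> w + u) - accept (log_ratio I x \<sigma> w + v) \<partial>?P)"
        unfolding \<psi>_def by (intro Bochner_Integration.integral_diff[symmetric] ai)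
      then have "\<bar>\<psi> u - \<psi> v\<bar> \<le> (\<integral>w. \<bar>accept (log_ratio I x \<sigma> w + u) - accept (log_ratio I x \<sigma> w + v)\<bar> \<partial>?P)"
        by (simp only: integral_abs_bound)
      also have "\<dots> \<le> (\<integral>w. \<bar>u - v\<bar> \<partial>?P)"
      proof (rule integral_mono)
        show "\<bar>accept (log_ratio I x \<sigma> w + u) - accept (log_ratio I x \<sigma> w + v)\<bar> \<le> \<bar>u - v\<bar>" for w
          using accept_lipschitz[of "log_ratio I x \<sigma> w + u" "log_ratio I x \<sigma> w + v"] by simp
      qed (auto intro!: integrable_abs Bochner_Integration.integrable_diff ai)
      finally show ?thesis by (simp add: P.prob_space)
    qed
    have \<psi>_meas: "\<psi> \<in> borel_measurable borel"
    proof -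
      have "1-lipschitz_on UNIV \<psi>" by (rule lipschitz_onI) (auto simp: dist_real_def \<psi>_lip)
      then have "continuous_on UNIV \<psi>" by (rule lipschitz_on_continuous_on)
      then show ?thesis by (rule borel_measurable_continuous_onI)
    qed
    have \<psi>01: "0 \<le> \<psi> u" "\<psi> u \<le> 1" for u
    proof -
      show "0 \<le> \<psi> u" unfolding \<psi>_def by (intro integral_nonneg_AE) (auto simp: accept_range)
      have "\<psi> u \<le> (\<integral>w. 1 \<partial>?P)" unfolding \<psi>_def by (intro integral_mono ai) (auto simp: accept_range)
      then show "\<psi> u \<le> 1" by (simp add: P.prob_space)
    qed
    have A: "\<bar>\<psi> 0 - 2 * \<theta>'\<bar> \<le> C1 * k" "\<bar>\<psi> u - \<psi> 0 - u * \<theta>'\<bar> \<le> C1 * \<bar>u\<bar> * (k + \<bar>u\<bar>)" for u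
    proof -
      have "1 \<le> real d" using d4 by simp
      note acc[OF I(1,2) this \<sigma>_def k1 H1[unfolded S_def] H2 H3, of u]
      then show "\<bar>\<psi> 0 - 2 * \<theta>'\<bar> \<le> C1 * k" "\<bar>\<psi> u - \<psi> 0 - u * \<theta>'\<bar> \<le> C1 * \<bar>u\<bar> * (k + \<bar>u\<bar>)"
        unfolding \<psi>_def \<theta>'_def S_def add_0_right by blast+
    qed
    have B1: "\<bar>\<psi> 0 - 2 * \<theta>\<bar> \<le> D * k"
      using A(1) th' by (simp add: D_def algebra_simps)
    have B2: "\<bar>\<psi> u - \<psi> 0 - u * \<theta>\<bar> \<le> D * \<bar>u\<bar> * (k + \<bar>u\<bar>)" for u
    proof -
      have "\<bar>u * (\<theta>' - \<theta>)\<bar> \<le> \<bar>u\<bar> * (e * k)"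
        unfolding abs_mult using th' by (intro mult_left_mono) auto
      note err = add_mono[OF A(2)[of u] this]
      have "\<psi> u - \<psi> 0 - u * \<theta> = (\<psi> u - \<psi> 0 - u * \<theta>') + u * (\<theta>' - \<theta>)" by (simp add: algebra_simps)
      from abs_triangle_ineq[of "\<psi> u - \<psi> 0 - u * \<theta>'" "u * (\<theta>' - \<theta>)", folded this]
      have "\<bar>\<psi> u - \<psi> 0 - u * \<theta>\<bar> \<le> C1 * \<bar>u\<bar> * (k + \<bar>u\<bar>) + \<bar>u\<bar> * (e * k)"
        by (rule order_trans[OF _ err])
      also have "\<dots> \<le> C1 * \<bar>u\<bar> * (k + \<bar>u\<bar>) + 2 * e * \<bar>u\<bar> * (k + \<bar>u\<bar>)"
      proof -
        have "\<bar>u\<bar> * (e * k) \<le> 2 * (\<bar>u\<bar> * (e * (k + \<bar>u\<bar>)))"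
        proof -
          have "\<bar>u\<bar> * (e * k) \<le> \<bar>u\<bar> * (e * (k + \<bar>u\<bar>))" using e l by (intro mult_left_mono) auto
          moreover have "0 \<le> \<bar>u\<bar> * (e * (k + \<bar>u\<bar>))" using e l k0 by simp
          ultimately show ?thesis by linarith
        qed
        then show ?thesis by (simp add: mult_ac)
      qed
      also have "\<dots> = D * \<bar>u\<bar> * (k + \<bar>u\<bar>)" by (simp only: D_def distrib_right)
      finally show ?thesis .
    qed
    have \<sigma>k: "\<sigma> \<le> l * k" using mult_left_mono[OF k1, of l] l by (simp add: \<sigma>_def)
    let ?int = "\<integral>z. (f (x 1 + \<sigma> * z) - f (x 1)) * \<psi> (V (x 1 + \<sigma> * z) - V (x 1)) \<partial>\<gamma>"
    have main: "\<bar>?int - \<sigma>^2 * \<theta> * (f2 (x 1) + V1 (x 1) * f1 (x 1))\<bar> \<le> C2 * F * exp \<bar>x 1\<bar> * (\<sigma>^2 * k)"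
      unfolding C2_def
    proof (rule one_coordinate_expansion[where ?f3.0=f3])
      show "\<bar>\<psi> u - \<psi> 0\<bar> \<le> \<bar>u\<bar>" for u using \<psi>_lip[of u 0] by simp
      show "0 \<le> D" using D by simp
    qed (fact \<sigma> \<sigma>k k0 \<psi>_meas \<psi>01 th B1 B2 df bf)+
    have f_meas: "f \<in> borel_measurable borel"
      using df by (intro borel_measurable_continuous_onI) (auto intro!: DERIV_continuous simp: continuous_on_eq_continuous_at)
    have growth: "\<bar>f (x 1 + l / sqrt (real d) * z) - f (x 1)\<bar> \<le> (F * exp (1/2 * \<bar>x 1\<bar>) * \<sigma>) * exp ((\<sigma> / 2 + 1) * \<bar>z\<bar>)" for z
    proof -
      have F0: "0 \<le> F" using order_trans[OF abs_ge_zero bf(1)[of 0]] by simp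
      have "\<bar>f (x 1 + \<sigma> * z) - f (x 1)\<bar> \<le> F * exp (1/2 * (\<bar>x 1\<bar> + \<bar>\<sigma> * z\<bar>)) * \<bar>\<sigma> * z\<bar>"
        by (rule exp_growth_taylor1[OF _ df(1) bf(1)]) simp
      also have "\<dots> \<le> F * exp (1/2 * (\<bar>x 1\<bar> + \<bar>\<sigma> * z\<bar>)) * (\<sigma> * exp \<bar>z\<bar>)"
      proof -
        have "\<bar>z\<bar> \<le> exp \<bar>z\<bar>" using exp_ge_add_one_self[of "\<bar>z\<bar>"] by linarith
        then show ?thesis using \<sigma> F0 by (intro mult_left_mono) (auto simp: abs_mult)
      qed
      also have "\<dots> = (F * exp (1/2 * \<bar>x 1\<bar>) * \<sigma>) * (exp (1/2 * (\<sigma> * \<bar>z\<bar>)) * exp \<bar>z\<bar>)"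
        using \<sigma> by (simp add: abs_mult distrib_left exp_add)
      also have "exp (1/2 * (\<sigma> * \<bar>z\<bar>)) * exp \<bar>z\<bar> = exp ((\<sigma> / 2 + 1) * \<bar>z\<bar>)"
        by (simp add: distrib_right flip: exp_add)
      finally show ?thesis by (simp only: \<sigma>_def)
    qed
    have gen: "gen_d \<rho> l d (\<lambda>y. f (y 1)) x = real d * ?int"
      using gen_d_first_coordinate[where V=V and f=f and d=d and l=l and x=x and \<rho>=\<rho>
        and A="F * exp (1/2 * \<bar>x 1\<bar>) * \<sigma>" and c="\<sigma> / 2 + 1", OF d4(2) l V_meas f_meas \<rho>_exp growth]
      by (simp add: \<psi>_def log_ratio_def I_def \<sigma>_def)
    have \<sigma>2: "real d * \<sigma>^2 = l^2" using d4 by (simp add: \<sigma>_def power_divide)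
    have "l^2 * \<theta> * (f2 (x 1) + V1 (x 1) * f1 (x 1)) - gen_d \<rho> l d (\<lambda>y. f (y 1)) x
      = - (real d * (?int - \<sigma>^2 * \<theta> * (f2 (x 1) + V1 (x 1) * f1 (x 1))))"
      unfolding gen \<sigma>2[symmetric] by (simp add: algebra_simps)
    then have "\<bar>l^2 * \<theta> * (f2 (x 1) + V1 (x 1) * f1 (x 1)) - gen_d \<rho> l d (\<lambda>y. f (y 1)) x\<bar>
      = real d * \<bar>?int - \<sigma>^2 * \<theta> * (f2 (x 1) + V1 (x 1) * f1 (x 1))\<bar>"
      by (simp add: abs_mult)
    also have "\<dots> \<le> real d * (C2 * F * exp \<bar>x 1\<bar> * (\<sigma>^2 * k))"
      using main by (rule mult_left_mono) simp
    also have "\<dots> = C2 * F * exp \<bar>x 1\<bar> * ((real d * \<sigma>^2) * k)" by simp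
    also have "\<dots> = l^2 * C2 * L * F * exp \<bar>x 1\<bar> * (a d / sqrt (real d))"
      unfolding \<sigma>2 by (simp add: k_def)
    finally show "\<bar>l^2 * cdf \<gamma> (- l * sqrt J / 2) * (f2 (x 1) + V1 (x 1) * f1 (x 1)) - gen_d \<rho> l d (\<lambda>y. f (y 1)) x\<bar>
      \<le> l^2 * C2 * L * F * exp \<bar>x 1\<bar> * (a d / sqrt (real d))"
      by (simp only: \<theta>_def)
  qed
qed

end

section \<open>From weighted norms to pointwise bounds, and the conclusion\<close>

lemma wnorm_sum_bound:
  assumes fin: "finite I" and i: "i \<in> I" and W: "(\<Sum>i\<in>I. wnorm s (g i)) < \<infinity>"
  shows "\<bar>g i x\<bar> \<le> enn2real (\<Sum>i\<in>I. wnorm s (g i)) * exp (s * \<bar>x\<bar>)"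
proof -
  have "ennreal (exp (- s * \<bar>x\<bar>) * \<bar>g i x\<bar>) \<le> wnorm s (g i)"
    unfolding wnorm_def by (rule SUP_upper) simp
  also have "\<dots> \<le> (\<Sum>i\<in>I. wnorm s (g i))" using fin i by (intro member_le_sum) auto
  \<comment> \<open>Finiteness is essential here, since \<open>enn2real\<close> sends infinity to
    \<open>0\<close>.\<close>
  also have "\<dots> = ennreal (enn2real (\<Sum>i\<in>I. wnorm s (g i)))" using W by (simp add: less_top)
  finally have "exp (- s * \<bar>x\<bar>) * \<bar>g i x\<bar> \<le> enn2real (\<Sum>i\<in>I. wnorm s (g i))"
    by (simp add: ennreal_le_iff)
  then have "exp (s * \<bar>x\<bar>) * (exp (- s * \<bar>x\<bar>) * \<bar>g i x\<bar>) \<le> exp (s * \<bar>x\<bar>) * enn2real (\<Sum>i\<in>I. wnorm s (g i))"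
    by (intro mult_left_mono) auto
  moreover have "exp (s * \<bar>x\<bar>) * (exp (- s * \<bar>x\<bar>) * \<bar>g i x\<bar>) = \<bar>g i x\<bar>"
    by (simp add: exp_minus)
  ultimately show ?thesis by (simp only: mult.commute)
qed

lemma S_class_deriv:
  assumes "g \<in> S_class n" "i < n"
  shows "((deriv ^^ i) g has_real_derivative (deriv ^^ Suc i) g x) (at x)"
proof -
  have "(deriv ^^ i) g differentiable (at x)" using assms by (auto simp: S_class_def C_class_def)
  then show ?thesis
    by (simp add: DERIV_deriv_iff_real_differentiable)
qed

theorem theorem3:
  fixes \<rho> :: "real \<Rightarrow> real" and l :: real and a :: "nat \<Rightarrow> real"
  assumes "positive_prob_density \<rho>"
    and "(\<lambda>x. ln (\<rho> x)) \<in> S_class 4"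
    and "filterlim (\<lambda>x. x / \<bar>x\<bar> * deriv (\<lambda>u. ln (\<rho> u)) x) at_bot at_infinity"
    and "0 < l"
    and "sluggish a"
  shows "\<exists>c\<^sub>3>0. \<exists>C\<^sub>3>0. \<exists>A :: nat \<Rightarrow> (nat \<Rightarrow> real) set. \<forall>d\<ge>1.
      A d \<in> sets (lborel_d d) \<and>
      measure (rho_d_measure \<rho> d) (space (lborel_d d) - A d) \<le> c\<^sub>3 * exp (- (a d)\<^sup>2) \<and>
      (\<forall>f\<in>S_class 3. \<forall>x\<in>A d.
        ennreal \<bar>gen_limit \<rho> l f (x 1) - gen_d \<rho> l d (\<lambda>y. f (y 1)) x\<bar>
          \<le> ennreal C\<^sub>3 * (\<Sum>i=1..3. wnorm (1/2) ((deriv ^^ i) f))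
              * ennreal (exp \<bar>x 1\<bar> * (a d / sqrt (real d))))"
proof -
  define V where "V = (\<lambda>x. ln (\<rho> x))"
  note V_class = assms(2)[folded V_def]
  have \<rho>: "\<And>x. 0 < \<rho> x" "integrable lborel \<rho>" "(\<integral>x. \<rho> x \<partial>lborel) = 1"
    using assms(1) by (auto simp: positive_prob_density_def)
  \<comment> \<open>The added \<open>1\<close> ensures \<open>1 \<le> B\<close>. Membership in
    \<open>S_class 4\<close> makes the norms finite at every positive rate, so \<open>1/8\<close>
    may be chosen.\<close>
  define B where "B = 1 + enn2real (\<Sum>i\<le>4. wnorm (1/8) ((deriv ^^ i) V))"
  have bV: "\<bar>(deriv ^^ i) V x\<bar> \<le> B * exp (1/8 * \<bar>x\<bar>)" if "i \<le> 4" for i x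
  proof -
    have "(\<Sum>i\<le>4. wnorm (1/8) ((deriv ^^ i) V)) < \<infinity>" using V_class by (auto simp: S_class_def)
    from wnorm_sum_bound[OF _ _ this, of i x] that
    have "\<bar>(deriv ^^ i) V x\<bar> \<le> enn2real (\<Sum>i\<le>4. wnorm (1/8) ((deriv ^^ i) V)) * exp (1/8 * \<bar>x\<bar>)" by simp
    also have "\<dots> \<le> B * exp (1/8 * \<bar>x\<bar>)" by (intro mult_right_mono) (auto simp: B_def)
    finally show ?thesis .
  qed
  have V1: "(deriv ^^ 1) V = deriv V" by simp
  interpret smooth_target V "deriv V" "(deriv ^^ 2) V" "(deriv ^^ 3) V" B \<rho>
  proof
    show "(V has_real_derivative deriv V x) (at x)" for x
      using S_class_deriv[OF V_class, of 0 x] by simp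
    show "(deriv V has_real_derivative (deriv ^^ 2) V x) (at x)" for x
      using S_class_deriv[OF V_class, of 1 x] by (simp add: numeral_2_eq_2)
    show "((deriv ^^ 2) V has_real_derivative (deriv ^^ 3) V x) (at x)" for x
      using S_class_deriv[OF V_class, of 2 x] by (simp add: numeral_3_eq_3 numeral_2_eq_2)
    show "1 \<le> B" by (simp add: B_def)
    show "\<bar>deriv V x\<bar> \<le> B * exp (1/8 * \<bar>x\<bar>)" "\<bar>(deriv ^^ 2) V x\<bar> \<le> B * exp (1/8 * \<bar>x\<bar>)"
      "\<bar>(deriv ^^ 3) V x\<bar> \<le> B * exp (1/8 * \<bar>x\<bar>)" for x
      using bV[of 1 x] bV[of 2 x] bV[of 3 x] unfolding V1 by auto
    show "\<rho> x = exp (V x)" for x using \<rho>(1)[of x] by (simp add: V_def)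
    show "filterlim (\<lambda>x. x / \<bar>x\<bar> * deriv V x) at_bot at_infinity" using assms(3) by (simp add: V_def)
  qed (use \<rho> in auto)
  have J: "J_const \<rho> = J"
    by (simp add: J_const_def J_def integral_\<mu> mult.commute flip: V_def)
  show ?thesis
  proof (rule typical_probability[OF assms(5)])
    fix K m c :: real
    assume K: "0 < K" "0 \<le> m" "0 < c"
      and prob: "\<And>d. 1 \<le> d \<Longrightarrow> measure (rho_d_measure \<rho> d) (space (lborel_d d) - typical a K m d) \<le> c * exp (- (a d)\<^sup>2)"
    show ?thesis
    proof (rule generator_error_on_typical[OF assms(5,4) K(1,2)])
      fix d0 :: nat and C :: real
      assume "1 \<le> d0" and C: "0 < C" and err:
        "\<And>d x f f1 f2 f3 F. \<lbrakk>d0 \<le> d; x \<in> typical a K m d;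
          \<And>x. (f has_real_derivative f1 x) (at x); \<And>x. (f1 has_real_derivative f2 x) (at x);
          \<And>x. (f2 has_real_derivative f3 x) (at x);
          \<And>x. \<bar>f1 x\<bar> \<le> F * exp (1/2 * \<bar>x\<bar>); \<And>x. \<bar>f2 x\<bar> \<le> F * exp (1/2 * \<bar>x\<bar>);
          \<And>x. \<bar>f3 x\<bar> \<le> F * exp (1/2 * \<bar>x\<bar>)\<rbrakk> \<Longrightarrow>
          \<bar>l^2 * cdf \<gamma> (- l * sqrt J / 2) * (f2 (x 1) + deriv V (x 1) * f1 (x 1))
            - gen_d \<rho> l d (\<lambda>y. f (y 1)) x\<bar> \<le> C * F * exp \<bar>x 1\<bar> * (a d / sqrt (real d))"
      \<comment> \<open>In the finitely many dimensions below \<open>d0\<close> the set is empty: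
        the error bound is then vacuous, and the probability of the complement is at most
        \<open>1 = exp ((a d)^2) * exp (- (a d)^2)\<close>, which the added sum covers.\<close>
      define c3 where "c3 = c + (\<Sum>d<d0. exp ((a d)^2))"
      define A where "A d = (if d < d0 then {} else typical a K m d)" for d
      have c3: "0 < c3" "c \<le> c3" using K by (auto simp: c3_def intro!: add_pos_nonneg sum_nonneg)
      show ?thesis
      proof (rule exI[of _ c3], rule conjI[OF c3(1)], rule exI[of _ C], rule conjI[OF C], rule exI[of _ A],
          intro allI impI conjI ballI)
        fix d :: nat assume d: "1 \<le> d"
        interpret P: prob_space "rho_d_measure \<rho> d"
          unfolding rho_d_measure_eq by (intro prob_space_PiM prob_space_\<mu>)
        show "A d \<in> sets (lborel_d d)" using typical_sets by (simp add: A_def)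
        show "measure (rho_d_measure \<rho> d) (space (lborel_d d) - A d) \<le> c3 * exp (- (a d)\<^sup>2)"
        proof (cases "d < d0")
          case True
          have "measure (rho_d_measure \<rho> d) (space (lborel_d d) - A d) \<le> exp ((a d)^2) * exp (- (a d)\<^sup>2)"
            by (simp flip: exp_add)
          also have "\<dots> \<le> c3 * exp (- (a d)\<^sup>2)"
          proof (intro mult_right_mono)
            have "exp ((a d)^2) \<le> (\<Sum>d<d0. exp ((a d)^2))"
              using True by (intro member_le_sum[where f="\<lambda>d. exp ((a d)^2)"]) auto
            then show "exp ((a d)^2) \<le> c3" using K by (simp add: c3_def)
          qed simp
          finally show ?thesis .
        next
          case False
          have "measure (rho_d_measure \<rho> d) (space (lborel_d d) - A d) \<le> c * exp (- (a d)\<^sup>2)"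
            using prob[OF d] False by (simp add: A_def)
          also have "\<dots> \<le> c3 * exp (- (a d)\<^sup>2)" using c3 by (intro mult_right_mono) auto
          finally show ?thesis .
        qed
        fix f x assume f: "f \<in> S_class 3" and x: "x \<in> A d"
        define W where "W = (\<Sum>i=1..3. wnorm (1/2) ((deriv ^^ i) f))"
        have sub: "W \<le> (\<Sum>i\<le>3. wnorm (1/2) ((deriv ^^ i) f))"
          unfolding W_def by (intro sum_mono2) auto
        have W: "W < \<infinity>"
          using f sub by (auto simp: S_class_def intro: le_less_trans)
        have W_eq: "ennreal (enn2real W) = W" using W by (simp add: less_top)
        have bf: "\<bar>(deriv ^^ i) f y\<bar> \<le> enn2real W * exp (1/2 * \<bar>y\<bar>)" if "i \<in> {1..3}" for i y
          unfolding W_def using that W by (intro wnorm_sum_bound) (auto simp: W_def)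
        have x': "d0 \<le> d" "x \<in> typical a K m d" using x by (auto simp: A_def split: if_splits)
        have f1: "(deriv ^^ 1) f = deriv f" by simp
        have lim: "gen_limit \<rho> l f (x 1)
          = l^2 * cdf \<gamma> (- l * sqrt J / 2) * ((deriv ^^ 2) f (x 1) + deriv V (x 1) * deriv f (x 1))"
          by (simp add: gen_limit_def h_const_def J flip: V_def)
        have "\<bar>l^2 * cdf \<gamma> (- l * sqrt J / 2) * ((deriv ^^ 2) f (x 1) + deriv V (x 1) * deriv f (x 1))
            - gen_d \<rho> l d (\<lambda>y. f (y 1)) x\<bar> \<le> C * enn2real W * exp \<bar>x 1\<bar> * (a d / sqrt (real d))"
        proof (rule err[OF x', of f "deriv f" "(deriv ^^ 2) f" "(deriv ^^ 3) f" "enn2real W"])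
          show "(f has_real_derivative deriv f y) (at y)" for y
            using S_class_deriv[OF f, of 0 y] by simp
          show "(deriv f has_real_derivative (deriv ^^ 2) f y) (at y)" for y
            using S_class_deriv[OF f, of 1 y] by (simp add: numeral_2_eq_2)
          show "((deriv ^^ 2) f has_real_derivative (deriv ^^ 3) f y) (at y)" for y
            using S_class_deriv[OF f, of 2 y] by (simp add: numeral_3_eq_3 numeral_2_eq_2)
          show "\<bar>deriv f y\<bar> \<le> enn2real W * exp (1/2 * \<bar>y\<bar>)" "\<bar>(deriv ^^ 2) f y\<bar> \<le> enn2real W * exp (1/2 * \<bar>y\<bar>)"
            "\<bar>(deriv ^^ 3) f y\<bar> \<le> enn2real W * exp (1/2 * \<bar>y\<bar>)" for y
            using bf[of 1 y] bf[of 2 y] bf[of 3 y] unfolding f1 by auto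
        qed
        then have "ennreal \<bar>gen_limit \<rho> l f (x 1) - gen_d \<rho> l d (\<lambda>y. f (y 1)) x\<bar>
          \<le> ennreal (C * enn2real W * (exp \<bar>x 1\<bar> * (a d / sqrt (real d))))"
          unfolding lim by (intro ennreal_leI) (simp only: mult.assoc)
        also have "\<dots> = ennreal C * ennreal (enn2real W) * ennreal (exp \<bar>x 1\<bar> * (a d / sqrt (real d)))"
        proof -
          have mult3: "ennreal (p * q * r) = ennreal p * ennreal q * ennreal r" if "0 \<le> p" "0 \<le> q" "0 \<le> r" for p q r
            using that by (simp add: ennreal_mult)
          have "0 < a d" using assms(5) d by (simp add: sluggish_def)
          then show ?thesis using C by (intro mult3) auto
        qed
        finally show "ennreal \<bar>gen_limit \<rho> l f (x 1) - gen_d \<rho> l d (\<lambda>y. f (y 1)) x\<bar>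
          \<le> ennreal C * (\<Sum>i=1..3. wnorm (1/2) ((deriv ^^ i) f)) * ennreal (exp \<bar>x 1\<bar> * (a d / sqrt (real d)))"
          unfolding W_eq unfolding W_def .
      qed
    qed
  qed
qed

end
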